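(* Let $\mathcal{M}\models\mathrm{I}\Delta_0$ and let $j$ be a nontrivial self-embedding of $\mathcal{M}$ such that $j(\mathcal{M})\preceq_{\Delta_0}\mathcal{M}$. Then $\mathrm{I}_{\mathrm{fix}}(j)$, regarded as a substructure of $\mathcal{M}$, satisfies $\mathrm{I}\Delta_0+\mathrm{B}\Sigma_1+\mathrm{Exp}$.
   Context: $\mathrm{I}\Delta_0$ is Peano Arithmetic with induction restricted to bounded formulae. $\mathrm{B}\Sigma_1$ is the $\Sigma_1$-collection scheme: the universal closures of $[\forall x<v\,\exists y\,\varphi(x,y)]\to\exists z\,[\forall x<v\,\exists y<z\,\varphi(x,y)]$ for $\Sigma_1$-formulae $\varphi$ (with parameters). $\mathrm{Exp}$ is $\forall x\exists y\,\mathrm{Exp}(x,y)$, where $\mathrm{Exp}(x,y)$ is the standard $\Delta_0$-formula expressing $y=2^x$. A self-embedding of $\mathcal{M}$ is an isomorphism between $\mathcal{M}$ and a submodel of $\mathcal{M}$; it is nontrivial if it is not the identity. $j(\mathcal{M})\preceq_{\Delta_0}\mathcal{M}$ means $\Delta_0$-formulae with parameters in $j(M)$ are absolute between $j(\mathcal{M})$ and $\mathcal{M}$. $\mathrm{I}_{\mathrm{fix}}(j):=\{m\in M:\forall x\le m\ j(x)=x\}$. *)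

theory Defs
  imports Main
begin

text \<open>First-order formulae of the language \<open>{0, 1, +, \<cdot>, <}\<close> (with equality), in de Bruijn
  notation: \<open>Var 0\<close> refers to the innermost quantifier.\<close>

datatype tm = Var nat | Zero | One | Add tm tm | Mul tm tm

datatype fm =
    Eq tm tm
  | Lt tm tm
  | Neg fm
  | And fm fm
  | Or fm fm
  | Imp fm fm
  | Forall fm
  | Exists fm

primrec subst_tm :: "(nat \<Rightarrow> tm) \<Rightarrow> tm \<Rightarrow> tm" where
  "subst_tm \<sigma> (Var n) = \<sigma> n"
| "subst_tm \<sigma> Zero = Zero"
| "subst_tm \<sigma> One = One"
| "subst_tm \<sigma> (Add s t) = Add (subst_tm \<sigma> s) (subst_tm \<sigma> t)"
| "subst_tm \<sigma> (Mul s t) = Mul (subst_tm \<sigma> s) (subst_tm \<sigma> t)"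

definition lift :: "tm \<Rightarrow> tm" where
  "lift = subst_tm (\<lambda>n. Var (Suc n))"

primrec subst :: "(nat \<Rightarrow> tm) \<Rightarrow> fm \<Rightarrow> fm" where
  "subst \<sigma> (Eq s t) = Eq (subst_tm \<sigma> s) (subst_tm \<sigma> t)"
| "subst \<sigma> (Lt s t) = Lt (subst_tm \<sigma> s) (subst_tm \<sigma> t)"
| "subst \<sigma> (Neg \<phi>) = Neg (subst \<sigma> \<phi>)"
| "subst \<sigma> (And \<phi> \<psi>) = And (subst \<sigma> \<phi>) (subst \<sigma> \<psi>)"
| "subst \<sigma> (Or \<phi> \<psi>) = Or (subst \<sigma> \<phi>) (subst \<sigma> \<psi>)"
| "subst \<sigma> (Imp \<phi> \<psi>) = Imp (subst \<sigma> \<phi>) (subst \<sigma> \<psi>)"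
| "subst \<sigma> (Forall \<phi>) = Forall (subst (case_nat (Var 0) (\<lambda>n. lift (\<sigma> n))) \<phi>)"
| "subst \<sigma> (Exists \<phi>) = Exists (subst (case_nat (Var 0) (\<lambda>n. lift (\<sigma> n))) \<phi>)"

text \<open>Bounded quantifiers; the bound \<open>t\<close> is a term outside the scope of the quantifier.\<close>

definition BForall :: "tm \<Rightarrow> fm \<Rightarrow> fm" where
  "BForall t \<phi> = Forall (Imp (Lt (Var 0) (lift t)) \<phi>)"

definition BExists :: "tm \<Rightarrow> fm \<Rightarrow> fm" where
  "BExists t \<phi> = Exists (And (Lt (Var 0) (lift t)) \<phi>)"

inductive Delta0 :: "fm \<Rightarrow> bool" where
  "Delta0 (Eq s t)"
| "Delta0 (Lt s t)"
| "Delta0 \<phi> \<Longrightarrow> Delta0 (Neg \<phi>)"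
| "Delta0 \<phi> \<Longrightarrow> Delta0 \<psi> \<Longrightarrow> Delta0 (And \<phi> \<psi>)"
| "Delta0 \<phi> \<Longrightarrow> Delta0 \<psi> \<Longrightarrow> Delta0 (Or \<phi> \<psi>)"
| "Delta0 \<phi> \<Longrightarrow> Delta0 \<psi> \<Longrightarrow> Delta0 (Imp \<phi> \<psi>)"
| "Delta0 \<phi> \<Longrightarrow> Delta0 (BForall t \<phi>)"
| "Delta0 \<phi> \<Longrightarrow> Delta0 (BExists t \<phi>)"

inductive Sigma1 :: "fm \<Rightarrow> bool" where
  "Delta0 \<phi> \<Longrightarrow> Sigma1 \<phi>"
| "Sigma1 \<phi> \<Longrightarrow> Sigma1 (Exists \<phi>)"


record 'a arith_struct =
  carr :: "'a set"
  zero :: 'a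
  one :: 'a
  add :: "'a \<Rightarrow> 'a \<Rightarrow> 'a"
  mul :: "'a \<Rightarrow> 'a \<Rightarrow> 'a"
  less :: "'a \<Rightarrow> 'a \<Rightarrow> bool"

definition subuniverse :: "'a arith_struct \<Rightarrow> 'a set \<Rightarrow> bool" where
  "subuniverse M A \<longleftrightarrow> A \<subseteq> carr M \<and> zero M \<in> A \<and> one M \<in> A \<and>
     (\<forall>x\<in>A. \<forall>y\<in>A. add M x y \<in> A \<and> mul M x y \<in> A)"

definition is_structure :: "'a arith_struct \<Rightarrow> bool" where
  "is_structure M \<longleftrightarrow> subuniverse M (carr M)"

definition induced :: "'a arith_struct \<Rightarrow> 'a set \<Rightarrow> 'a arith_struct" where
  "induced M A = M\<lparr>carr := A\<rparr>"

primrec eval :: "'a arith_struct \<Rightarrow> (nat \<Rightarrow> 'a) \<Rightarrow> tm \<Rightarrow> 'a" where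
  "eval M e (Var n) = e n"
| "eval M e Zero = zero M"
| "eval M e One = one M"
| "eval M e (Add s t) = add M (eval M e s) (eval M e t)"
| "eval M e (Mul s t) = mul M (eval M e s) (eval M e t)"

primrec sat :: "'a arith_struct \<Rightarrow> (nat \<Rightarrow> 'a) \<Rightarrow> fm \<Rightarrow> bool" where
  "sat M e (Eq s t) \<longleftrightarrow> eval M e s = eval M e t"
| "sat M e (Lt s t) \<longleftrightarrow> less M (eval M e s) (eval M e t)"
| "sat M e (Neg \<phi>) \<longleftrightarrow> \<not> sat M e \<phi>"
| "sat M e (And \<phi> \<psi>) \<longleftrightarrow> sat M e \<phi> \<and> sat M e \<psi>"
| "sat M e (Or \<phi> \<psi>) \<longleftrightarrow> sat M e \<phi> \<or> sat M e \<psi>"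
| "sat M e (Imp \<phi> \<psi>) \<longleftrightarrow> (sat M e \<phi> \<longrightarrow> sat M e \<psi>)"
| "sat M e (Forall \<phi>) \<longleftrightarrow> (\<forall>a\<in>carr M. sat M (case_nat a e) \<phi>)"
| "sat M e (Exists \<phi>) \<longleftrightarrow> (\<exists>a\<in>carr M. sat M (case_nat a e) \<phi>)"

text \<open>Quantifying over all assignments amounts to taking universal closures, so a formula with
  free variables may serve as an axiom.\<close>

definition models :: "'a arith_struct \<Rightarrow> fm set \<Rightarrow> bool" where
  "models M T \<longleftrightarrow> (\<forall>\<phi>\<in>T. \<forall>e. range e \<subseteq> carr M \<longrightarrow> sat M e \<phi>)"


text \<open>\<open>PA\<^sup>-\<close>: the axioms of the non-negative parts of discretely ordered rings.\<close>

definition PA_minus :: "fm set" where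
  "PA_minus = (let x = Var 0; y = Var 1; z = Var 2 in
    {Eq (Add (Add x y) z) (Add x (Add y z)),
     Eq (Add x y) (Add y x),
     Eq (Mul (Mul x y) z) (Mul x (Mul y z)),
     Eq (Mul x y) (Mul y x),
     Eq (Mul x (Add y z)) (Add (Mul x y) (Mul x z)),
     Eq (Add x Zero) x,
     Eq (Mul x Zero) Zero,
     Eq (Mul x One) x,
     Imp (And (Lt x y) (Lt y z)) (Lt x z),
     Neg (Lt x x),
     Or (Lt x y) (Or (Eq x y) (Lt y x)),
     Imp (Lt x y) (Lt (Add x z) (Add y z)),
     Imp (And (Lt Zero z) (Lt x y)) (Lt (Mul x z) (Mul y z)),
     Imp (Lt x y) (Exists (Eq (Add (lift x) (Var 0)) (lift y))),
     Lt Zero One,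
     Imp (Lt Zero x) (Or (Eq x One) (Lt One x)),
     Or (Eq x Zero) (Lt Zero x)})"

text \<open>The induction variable is \<open>Var 0\<close>; the remaining free variables are parameters.\<close>

definition induction_ax :: "fm \<Rightarrow> fm" where
  "induction_ax \<phi> =
     Imp (And (subst (case_nat Zero Var) \<phi>)
              (Forall (Imp \<phi> (subst (case_nat (Add (Var 0) One) (\<lambda>n. Var (Suc n))) \<phi>))))
         (Forall \<phi>)"

definition IDelta0 :: "fm set" where
  "IDelta0 = PA_minus \<union> {induction_ax \<phi> | \<phi>. Delta0 \<phi>}"

text \<open>In \<open>\<phi>\<close>, \<open>Var 1\<close> is \<open>x\<close>, \<open>Var 0\<close> is \<open>y\<close>, and all further variables are parameters.  Outside
  the quantifiers \<open>v\<close> is \<open>Var 0\<close>.  On the right the parameters are renamed so as to skip \<open>z\<close>.\<close>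

definition collection_ax :: "fm \<Rightarrow> fm" where
  "collection_ax \<phi> =
     Imp (BForall (Var 0) (Exists \<phi>))
         (Exists (BForall (Var 1) (BExists (Var 1)
            (subst (case_nat (Var 0) (case_nat (Var 1) (\<lambda>n. Var (n + 3)))) \<phi>))))"

definition BSigma1 :: "fm set" where
  "BSigma1 = {collection_ax \<phi> | \<phi>. Sigma1 \<phi>}"


text \<open>The graph of exponentiation as a \<open>\<Delta>\<^sub>0\<close>-formula, by repeated squaring.\<close>

definition Two :: tm where "Two = Add One One"

definition Dvd :: "tm \<Rightarrow> tm \<Rightarrow> fm" where
  "Dvd s t = BExists (Add t One) (Eq (Mul (lift s) (Var 0)) (lift t))"

text \<open>\<open>t\<close> is a power of two: every divisor \<open>r > 1\<close> of \<open>t\<close> is even.\<close>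

definition Pow2 :: "tm \<Rightarrow> fm" where
  "Pow2 t = And (Lt Zero t)
     (BForall (Add t One) (Imp (And (Lt One (Var 0)) (Dvd (Var 0) (lift t))) (Dvd Two (Var 0))))"

text \<open>For a power of two \<open>u\<close>: the binary digit of \<open>m\<close> at the place with value \<open>u\<close> is \<open>1\<close>, that is
  \<open>m = (2q + 1)u + r\<close> with \<open>r < u\<close>.\<close>

definition Bit :: "tm \<Rightarrow> tm \<Rightarrow> fm" where
  "Bit u m = BExists (Add m One) (BExists (lift u)
     (Eq (lift (lift m)) (Add (Mul (Add (Mul Two (Var 1)) One) (lift (lift u))) (Var 0))))"

text \<open>\<open>t\<close> is of the form \<open>2^(2^i)\<close>: some \<open>m < 2t\<close> has its binary digits \<open>1\<close> exactly at the places
  with values \<open>2, 4, 16, 256, \<dots>, t\<close>.\<close>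

definition PPow2 :: "tm \<Rightarrow> fm" where
  "PPow2 t = And (Pow2 t) (BExists (Mul Two t)
     (And (Bit (lift t) (Var 0))
     (And (Neg (Bit One (Var 0)))
     (And (Bit Two (Var 0))
       (BForall (Add (Var 0) One) (Imp (And (Pow2 (Var 0)) (Lt Two (Var 0)))
          (let i = Var 0; m = Var 1;
               root_in_m = BExists (Add i One)
                 (And (Eq (Mul (Var 0) (Var 0)) (lift i)) (Bit (Var 0) (lift m)))
           in And (Imp (Bit i m) root_in_m) (Imp root_in_m (Bit i m)))))))))"

text \<open>\<open>w = (z div u) mod u\<close>.  For \<open>u = 4, 16, 256, \<dots>\<close> these are disjoint blocks of binary digits
  of \<open>z\<close>, so a number codes a sequence indexed by such \<open>u\<close>.\<close>

definition Block :: "tm \<Rightarrow> tm \<Rightarrow> tm \<Rightarrow> fm" where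
  "Block u z w = And (Lt w u) (BExists (Add z One) (BExists (lift u)
     (let q = Var 1; r = Var 0; u' = lift (lift u); z' = lift (lift z); w' = lift (lift w)
      in Eq z' (Add (Mul (Add (Mul q u') w') u') r))))"

text \<open>\<open>y = 2^x\<close>: either \<open>x = 0\<close> and \<open>y = 1\<close>, or there are sequences \<open>X\<close>, \<open>Y\<close>, indexed by
  \<open>v = 4, 16, \<dots>, u\<close> and starting with \<open>1\<close> and \<open>2\<close>, in which each step takes \<open>(a, b)\<close> to
  \<open>(2a, b^2)\<close> or \<open>(2a + 1, 2b^2)\<close>, ending in \<open>(x, y)\<close>.\<close>

definition Exp_fm :: "tm \<Rightarrow> tm \<Rightarrow> fm" where
  "Exp_fm x y = Or (And (Eq x Zero) (Eq y One))
     (BExists (Add (Mul y y) One)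
       (And (PPow2 (Var 0)) (And (Lt Two (Var 0))
         (BExists (Mul (Var 0) (Var 0)) (BExists (Mul (Var 1) (Var 1))
           (let u = Var 2; X = Var 1; Y = Var 0;
                x' = lift (lift (lift x)); y' = lift (lift (lift y)); four = Add Two Two
            in And (And (Block four X One) (Block four Y Two))
              (And (And (Block u X x') (Block u Y y'))
                (BForall u (Imp (And (PPow2 (Var 0)) (Lt Two (Var 0)))
                  (BExists (Var 0) (BExists (Var 1)
                    (let v = Var 2; a = Var 1; b = Var 0; X = Var 4; Y = Var 3
                     in And (And (Block v X a) (Block v Y b))
                       (Or (And (Block (Mul v v) X (Mul Two a))
                                (Block (Mul v v) Y (Mul b b)))
                           (And (Block (Mul v v) X (Add (Mul Two a) One))
                                (Block (Mul v v) Y (Mul Two (Mul b b)))))))))))))))))"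

definition Exp_ax :: fm where
  "Exp_ax = Forall (Exists (Exp_fm (Var 1) (Var 0)))"


definition isomorphism :: "('a \<Rightarrow> 'b) \<Rightarrow> 'a arith_struct \<Rightarrow> 'b arith_struct \<Rightarrow> bool" where
  "isomorphism f M N \<longleftrightarrow> bij_betw f (carr M) (carr N) \<and>
     f (zero M) = zero N \<and> f (one M) = one N \<and>
     (\<forall>x\<in>carr M. \<forall>y\<in>carr M. f (add M x y) = add N (f x) (f y) \<and>
        f (mul M x y) = mul N (f x) (f y) \<and> (less M x y \<longleftrightarrow> less N (f x) (f y)))"

definition self_embedding :: "'a arith_struct \<Rightarrow> ('a \<Rightarrow> 'a) \<Rightarrow> bool" where
  "self_embedding M j \<longleftrightarrow>
     subuniverse M (j ` carr M) \<and> isomorphism j M (induced M (j ` carr M))"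

definition nontrivial :: "'a arith_struct \<Rightarrow> ('a \<Rightarrow> 'a) \<Rightarrow> bool" where
  "nontrivial M j \<longleftrightarrow> (\<exists>m\<in>carr M. j m \<noteq> m)"

definition Delta0_elementary :: "'a arith_struct \<Rightarrow> 'a arith_struct \<Rightarrow> bool" where
  "Delta0_elementary N M \<longleftrightarrow> carr N \<subseteq> carr M \<and>
     (\<forall>\<phi>. Delta0 \<phi> \<longrightarrow> (\<forall>e. range e \<subseteq> carr N \<longrightarrow> (sat N e \<phi> \<longleftrightarrow> sat M e \<phi>)))"

definition I_fix :: "'a arith_struct \<Rightarrow> ('a \<Rightarrow> 'a) \<Rightarrow> 'a set" where
  "I_fix M j = {m \<in> carr M. \<forall>x\<in>carr M. less M x m \<or> x = m \<longrightarrow> j x = x}"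


text \<open>Adequacy of \<open>Exp_fm\<close>: it is \<open>\<Delta>\<^sub>0\<close> and defines the graph of \<open>2^x\<close> in the standard model
  (\<open>sat_Exp_fm\<close>).\<close>


lemma Delta0_Exp_fm: "Delta0 (Exp_fm s t)"
  by (simp add: Exp_fm_def PPow2_def Pow2_def Dvd_def Bit_def Block_def Let_def Delta0.intros)

definition nat_struct :: "nat arith_struct" where
  "nat_struct = \<lparr>carr = UNIV, zero = 0, one = 1, add = (+), mul = (*), less = (<)\<rparr>"

lemma nat_struct_simps [simp]:
  "carr nat_struct = UNIV" "zero nat_struct = 0" "one nat_struct = 1"
  "add nat_struct = (+)" "mul nat_struct = (*)" "less nat_struct = (<)"
  by (simp_all add: nat_struct_def)

lemma eval_lift [simp]: "eval M (case_nat a e) (lift t) = eval M e t"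
  by (induction t) (simp_all add: lift_def)

lemma lift_simps [simp]: "lift (Var n) = Var (Suc n)"
  by (simp add: lift_def)

lemma eval_Two [simp]: "eval nat_struct e Two = 2"
  by (simp add: Two_def)

lemma sat_BForall [simp]:
  "sat nat_struct e (BForall t \<phi>) \<longleftrightarrow> (\<forall>a<eval nat_struct e t. sat nat_struct (case_nat a e) \<phi>)"
  by (simp add: BForall_def)

lemma sat_BExists [simp]:
  "sat nat_struct e (BExists t \<phi>) \<longleftrightarrow> (\<exists>a<eval nat_struct e t. sat nat_struct (case_nat a e) \<phi>)"
  by (simp add: BExists_def)

lemma sat_Dvd: "sat nat_struct e (Dvd s t) \<longleftrightarrow>
    (eval nat_struct e s) dvd (eval nat_struct e t)"
  (is "_ \<longleftrightarrow> ?s dvd ?t")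
proof
  assume "?s dvd ?t"
  then obtain k where k: "?t = ?s * k" ..
  show "sat nat_struct e (Dvd s t)"
  proof (cases "?s = 0")
    case True
    then show ?thesis using k by (auto simp: Dvd_def)
  next
    case False
    then have "k < Suc ?t" using k by (simp add: less_Suc_eq_le)
    then show ?thesis using k by (auto simp: Dvd_def)
  qed
qed (auto simp: Dvd_def dvd_def dest: sym)

lemma sat_Pow2: "sat nat_struct e (Pow2 t) \<longleftrightarrow> (\<exists>k. eval nat_struct e t = 2 ^ k)"
proof -
  have *: "\<exists>k. n = 2 ^ k" if "0 < n" "\<forall>r<Suc n. 1 < r \<and> r dvd n \<longrightarrow> 2 dvd r" for n :: nat
    using that
  proof (induction n rule: less_induct)
    case (less n)
    show ?case
    proof (cases "n = 1")
      case True
      then have "n = 2 ^ 0" by simp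
      then show ?thesis ..
    next
      case False
      then have "2 dvd n" using less.prems by (metis One_nat_def Suc_lessI dvd_refl lessI)
      then obtain m where m: "n = 2 * m" ..
      then have "\<exists>k. m = 2 ^ k"
        using less.prems by (intro less.IH) (auto simp: less_Suc_eq_le)
      then show ?thesis using m by (metis power_Suc)
    qed
  qed
  have "2 dvd r" if "1 < r" "r dvd 2 ^ k" for r k :: nat
  proof (rule ccontr)
    assume "\<not> 2 dvd r"
    then have "coprime r (2 ^ k)" by simp
    then show False using that by (metis coprime_common_divisor_nat dvd_refl less_irrefl)
  qed
  then show ?thesis using * by (auto simp: Pow2_def sat_Dvd)
qed

lemma sat_Bit:
  "sat nat_struct e (Bit u m) \<longleftrightarrow> odd (eval nat_struct e m div eval nat_struct e u)"
  (is "_ \<longleftrightarrow> odd (?m div ?u)")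
proof
  assume "odd (?m div ?u)"
  then have "?u > 0" by (intro gr0I) simp
  from \<open>odd (?m div ?u)\<close> obtain q where q: "?m div ?u = 2 * q + 1" by (rule oddE)
  have "?m = (2 * q + 1) * ?u + ?m mod ?u" by (metis q div_mult_mod_eq)
  moreover have "q < Suc ?m"
    using q div_le_dividend[of ?m ?u] by linarith
  moreover have "?m mod ?u < ?u" using \<open>?u > 0\<close> by simp
  ultimately show "sat nat_struct e (Bit u m)" unfolding Bit_def by auto
next
  assume "sat nat_struct e (Bit u m)"
  then obtain q r where m: "?m = (2 * q + 1) * ?u + r" and r: "r < ?u" by (auto simp: Bit_def)
  have "?m div ?u = 2 * q + 1" unfolding m using r by (intro div_nat_eqI) auto
  then show "odd (?m div ?u)" by simp
qed

lemma sat_Block: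
  "sat nat_struct e (Block u z w) \<longleftrightarrow>
    eval nat_struct e u > 0 \<and>
    eval nat_struct e z div eval nat_struct e u mod eval nat_struct e u = eval nat_struct e w"
  (is "_ \<longleftrightarrow> ?u > 0 \<and> ?z div ?u mod ?u = ?w")
proof
  assume "?u > 0 \<and> ?z div ?u mod ?u = ?w"
  then have *: "?u > 0" "?w = ?z div ?u mod ?u" by simp_all
  let ?q = "?z div ?u div ?u"
  have "?z = (?q * ?u + ?w) * ?u + ?z mod ?u" by (simp add: *)
  moreover have "?q < Suc ?z"
    by (meson div_le_dividend le_imp_less_Suc le_trans)
  moreover have "?z mod ?u < ?u" "?w < ?u" using * by simp_all
  ultimately have "\<exists>q<Suc ?z. \<exists>r<?u. ?z = (q * ?u + ?w) * ?u + r" by blast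
  then show "sat nat_struct e (Block u z w)" using \<open>?w < ?u\<close> by (simp add: Block_def Let_def)
next
  assume "sat nat_struct e (Block u z w)"
  then obtain q r where "?w < ?u" "?z = (q * ?u + ?w) * ?u + r" "r < ?u"
    by (auto simp: Block_def Let_def)
  then show "?u > 0 \<and> ?z div ?u mod ?u = ?w" by auto
qed

primrec tower_bits :: "nat \<Rightarrow> nat" where
  "tower_bits 0 = set_bit (2 ^ 0) 0"
| "tower_bits (Suc i) = set_bit (2 ^ Suc i) (tower_bits i)"

lemma bit_tower_bits: "bit (tower_bits i) n \<longleftrightarrow> (\<exists>k\<le>i. n = 2 ^ k)"
  by (induction i) (auto simp: bit_set_bit_iff bit_exp_iff le_Suc_eq simp del: power_Suc power_0)

lemma tower_bits_less: "tower_bits i < 2 * 2 ^ 2 ^ i"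
proof -
  have "take_bit (Suc (2 ^ i)) (tower_bits i) = tower_bits i"
    by (rule bit_eqI) (auto simp: bit_take_bit_iff bit_tower_bits less_Suc_eq_le)
  then show ?thesis by (metis take_bit_nat_less_exp power_Suc)
qed

lemma square_eq_power2: "(s::nat) * s = 2 ^ n \<longleftrightarrow> (\<exists>l. s = 2 ^ l \<and> n = 2 * l)"
proof
  assume *: "s * s = 2 ^ n"
  then show "\<exists>l. s = 2 ^ l \<and> n = 2 * l"
  proof (induction n arbitrary: s rule: less_induct)
    case (less n)
    show ?case
    proof (cases n)
      case 0
      then show ?thesis using less.prems by auto
    next
      case (Suc n')
      then have "even (s * s)" using less.prems by simp
      then obtain r where r: "s = 2 * r" by auto
      then have e: "4 * (r * r) = 2 * 2 ^ n'" using less.prems Suc by simp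
      have "n' \<noteq> 0"
      proof
        assume "n' = 0"
        then have "(4 * (r * r)) mod 4 = 2 mod 4" using e by simp
        then show False by simp
      qed
      then obtain n'' where "n' = Suc n''" by (metis not0_implies_Suc)
      then have "r * r = 2 ^ n''" "n'' < n" using e Suc by simp_all
      then obtain l where "r = 2 ^ l" "n'' = 2 * l" using less.IH by blast
      then show ?thesis using r Suc \<open>n' = Suc n''\<close> by (intro exI[of _ "Suc l"]) simp
    qed
  qed
qed (auto simp: power_add[symmetric] mult_2)

lemma sat_PPow2: "sat nat_struct e (PPow2 t) \<longleftrightarrow> (\<exists>i. eval nat_struct e t = 2 ^ 2 ^ i)"
  (is "?L \<longleftrightarrow> _")
proof -
  let ?t = "eval nat_struct e t"
  have L: "?L \<longleftrightarrow> (\<exists>k. ?t = 2 ^ k) \<and> (\<exists>m<2 * ?t. odd (m div ?t) \<and> even m \<and> odd (m div 2) \<and>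
      (\<forall>i\<le>m. (\<exists>k. i = 2 ^ k) \<and> 2 < i \<longrightarrow>
         (odd (m div i) \<longleftrightarrow> (\<exists>s\<le>i. s * s = i \<and> odd (m div s)))))"
    by (simp add: PPow2_def sat_Pow2 sat_Bit Let_def less_Suc_eq_le iff_conv_conj_imp)
  show ?thesis
  proof
    assume ?L
    then obtain k m where k: "?t = 2 ^ k" and m: "odd (m div ?t)" "even m" and
      step: "\<And>i. i \<le> m \<Longrightarrow> \<exists>k. i = 2 ^ k \<Longrightarrow> 2 < i \<Longrightarrow>
        odd (m div i) \<Longrightarrow> (\<exists>s\<le>i. s * s = i \<and> odd (m div s))"
      unfolding L by blast
    have "\<exists>i. (2::nat) ^ n = 2 ^ 2 ^ i" if "odd (m div 2 ^ n)" for n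
      using that
    proof (induction n rule: less_induct)
      case (less n)
      have n0: "n \<noteq> 0" using less.prems m by (intro notI) simp
      show ?case
      proof (cases "n = 1")
        case True
        then have "(2::nat) ^ n = 2 ^ 2 ^ 0" by simp
        then show ?thesis ..
      next
        case False
        then have "(2::nat) ^ 1 < 2 ^ n" using n0 by (intro power_strict_increasing) auto
        moreover have "2 ^ n \<le> m"
          using less.prems by (metis div_less even_zero not_le)
        ultimately obtain s where s: "s * s = 2 ^ n" "odd (m div s)"
          using step[of "2 ^ n"] less.prems by auto
        then obtain l where "s = 2 ^ l" "n = 2 * l" by (auto simp: square_eq_power2)
        then obtain i where "(2::nat) ^ l = 2 ^ 2 ^ i" using less.IH[of l] s n0 by auto
        then have "n = 2 ^ Suc i" using \<open>n = 2 * l\<close> by simp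
        then show ?thesis by blast
      qed
    qed
    then show "\<exists>i. ?t = 2 ^ 2 ^ i" using m k by simp
  next
    assume "\<exists>i. ?t = 2 ^ 2 ^ i"
    then obtain i where t: "?t = 2 ^ 2 ^ i" ..
    let ?m = "tower_bits i"
    have odd: "odd (?m div 2 ^ n) \<longleftrightarrow> (\<exists>k\<le>i. n = 2 ^ k)" for n
      using bit_tower_bits[of i n] by (simp add: bit_iff_odd)
    have "odd (?m div 2 ^ n) \<longleftrightarrow> (\<exists>s\<le>2 ^ n. s * s = 2 ^ n \<and> odd (?m div s))"
      if "2 ^ n \<le> ?m" "2 < (2::nat) ^ n" for n
    proof -
      have "(2::nat) ^ n < 2 ^ Suc (2 ^ i)" using that tower_bits_less[of i] by simp
      then have le: "n \<le> 2 ^ i" by (simp add: power_strict_increasing_iff less_Suc_eq_le del: power_Suc)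
      have "n \<noteq> 1" using that(2) by (intro notI) simp
      have "(\<exists>s\<le>2 ^ n. s * s = 2 ^ n \<and> odd (?m div s)) \<longleftrightarrow> (\<exists>l. n = 2 * l \<and> odd (?m div 2 ^ l))"
        by (auto simp: square_eq_power2 intro!: power_increasing)
      also have "\<dots> \<longleftrightarrow> (\<exists>k\<le>i. n = 2 * 2 ^ k)" unfolding odd by auto
      also have "\<dots> \<longleftrightarrow> (\<exists>k\<le>i. n = 2 ^ k)"
      proof
        assume "\<exists>k\<le>i. n = 2 * 2 ^ k"
        then obtain k where "n = 2 ^ Suc k" by auto
        moreover from this le have "Suc k \<le> i" by (simp del: power_Suc)
        ultimately show "\<exists>k\<le>i. n = 2 ^ k" by blast
      next
        assume "\<exists>k\<le>i. n = 2 ^ k"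
        then obtain k where "k \<le> i" "n = 2 ^ k" by auto
        with \<open>n \<noteq> 1\<close> show "\<exists>k\<le>i. n = 2 * 2 ^ k"
          by (cases k) (auto intro: exI[of _ "k - 1"])
      qed
      finally show ?thesis unfolding odd ..
    qed
    moreover have "even ?m" using odd[of 0] by simp
    moreover have "odd (?m div 2)" using odd[of "2 ^ 0"] by auto
    moreover have "odd (?m div 2 ^ 2 ^ i)" using odd by blast
    ultimately have "\<exists>m<2 * ?t. odd (m div ?t) \<and> even m \<and> odd (m div 2) \<and>
      (\<forall>i\<le>m. (\<exists>k. i = 2 ^ k) \<and> 2 < i \<longrightarrow>
         (odd (m div i) \<longleftrightarrow> (\<exists>s\<le>i. s * s = i \<and> odd (m div s))))"
      unfolding t
      by (intro exI[of _ ?m] conjI tower_bits_less allI impI) (assumption | elim conjE exE, hypsubst)+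
    then show ?L unfolding L using t by blast
  qed
qed


lemma sat_Exp_fm: "sat nat_struct e (Exp_fm s t) \<longleftrightarrow> eval nat_struct e t = 2 ^ eval nat_struct e s"
proof -
  define blk where "blk u z = z div u mod u" for u z :: nat
  define run where "run u X Y \<longleftrightarrow> (\<forall>v<u. (\<exists>i. v = 2 ^ 2 ^ i) \<and> 2 < v \<longrightarrow>
       blk (v * v) X = 2 * blk v X \<and> blk (v * v) Y = blk v Y * blk v Y \<or>
       blk (v * v) X = 2 * blk v X + 1 \<and> blk (v * v) Y = 2 * (blk v Y * blk v Y))" for u X Y :: nat
  define graph where "graph x y \<longleftrightarrow>
    (\<exists>u<Suc (y * y). (\<exists>i. u = 2 ^ 2 ^ i) \<and> 2 < u \<and> (\<exists>X<u * u. \<exists>Y<u * u.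
        blk 4 X = 1 \<and> blk 4 Y = 2 \<and> blk u X = x \<and> blk u Y = y \<and> run u X Y))" for x y :: nat
  have lt: "blk v z < v" if "v > 0" for v z using that by (simp add: blk_def)
  have var [simp]: "case_nat a f 2 = f (Suc 0)" "case_nat a f 3 = f 2" "case_nat a f 4 = f 3"
    for a and f :: "nat \<Rightarrow> nat"
    by (simp_all add: numeral_eq_Suc)
  have S: "sat nat_struct e (Exp_fm s t) \<longleftrightarrow>
      eval nat_struct e s = 0 \<and> eval nat_struct e t = 1 \<or>
      graph (eval nat_struct e s) (eval nat_struct e t)"
    by (simp add: Exp_fm_def Let_def sat_PPow2 sat_Block blk_def[symmetric]
        graph_def run_def lt conj_assoc cong: conj_cong imp_cong)
  have sq: "(2::nat) ^ 2 ^ Suc i = 2 ^ 2 ^ i * 2 ^ 2 ^ i" for i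
    by (simp add: power_add[symmetric] mult_2)
  have sound: "y = 2 ^ x" if "graph x y" for x y
  proof -
    obtain k X Y where k: "2 < (2::nat) ^ 2 ^ k"
      and fin: "blk (2 ^ 2 ^ k) X = x" "blk (2 ^ 2 ^ k) Y = y"
      and start: "blk 4 X = 1" "blk 4 Y = 2" and run: "run (2 ^ 2 ^ k) X Y"
      using \<open>graph x y\<close> unfolding graph_def by blast
    have "k \<noteq> 0" using k by (intro notI) simp
    have "blk (2 ^ 2 ^ i) Y = 2 ^ blk (2 ^ 2 ^ i) X" if "1 \<le> i" "i \<le> k" for i
      using that
    proof (induction i rule: nat_induct_at_least)
      case base
      then show ?case using start by simp
    next
      case (Suc i)
      let ?v = "2 ^ 2 ^ i :: nat"
      have "(2::nat) ^ 1 < 2 ^ 2 ^ i"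
        using Suc.hyps by (intro power_strict_increasing) (use one_less_power[of "2::nat" i] in simp_all)
      moreover have "?v < 2 ^ 2 ^ k" using Suc.prems by (intro power_strict_increasing) auto
      ultimately have "blk (?v * ?v) X = 2 * blk ?v X \<and> blk (?v * ?v) Y = blk ?v Y * blk ?v Y \<or>
          blk (?v * ?v) X = 2 * blk ?v X + 1 \<and> blk (?v * ?v) Y = 2 * (blk ?v Y * blk ?v Y)"
        using run unfolding run_def by auto
      then show ?case unfolding sq using Suc
        by (auto simp: power_add[symmetric] mult_2)
    qed
    then show ?thesis using fin \<open>k \<noteq> 0\<close> by fastforce
  qed
  have complete: "graph x (2 ^ x)" if "0 < x" for x
    using that
  proof (induction x rule: less_induct)
    case (less x)
    show ?case
    proof (cases "x = 1")
      case True
      have "\<exists>i. (4::nat) = 2 ^ 2 ^ i" by (intro exI[of _ 1]) simp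
      moreover have "run 4 4 8"
      proof -
        have "\<not> (2 < (2::nat) ^ 2 ^ i \<and> (2::nat) ^ 2 ^ i < 4)" for i
        proof (cases i)
          case (Suc n)
          then have "(2::nat) ^ 2 \<le> 2 ^ 2 ^ i" by (intro power_increasing) simp_all
          then show ?thesis by simp
        qed simp
        then show ?thesis by (auto simp: run_def)
      qed
      moreover have "blk 4 4 = 1" "blk 4 8 = 2" by (simp_all add: blk_def)
      moreover have "(4::nat) < Suc (2 ^ x * 2 ^ x)" "(4::nat) < 4 * 4" "(8::nat) < 4 * 4"
        "(2::nat) < 4" "(2::nat) ^ x = 2"
        using True by simp_all
      ultimately show ?thesis using True unfolding graph_def by metis
    next
      case False
      define x' where "x' = x div 2"
      have x: "x = 2 * x' \<or> x = 2 * x' + 1" unfolding x'_def by presburger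
      have "0 < x'" "x' < x" using less.prems False by (auto simp: x'_def)
      then have "graph x' (2 ^ x')" by (intro less.IH)
      then obtain k X Y where u: "(2::nat) ^ 2 ^ k \<le> 2 ^ x' * 2 ^ x'" "2 < (2::nat) ^ 2 ^ k"
        and XY: "X < 2 ^ 2 ^ Suc k" "Y < 2 ^ 2 ^ Suc k"
        and fin: "blk (2 ^ 2 ^ k) X = x'" "blk (2 ^ 2 ^ k) Y = 2 ^ x'"
        and start: "blk 4 X = 1" "blk 4 Y = 2" and run: "run (2 ^ 2 ^ k) X Y"
        unfolding graph_def sq less_Suc_eq_le by blast
      let ?u = "(2::nat) ^ 2 ^ k" and ?w = "(2::nat) ^ 2 ^ Suc k"
      have "k \<noteq> 0" using u(2) by (intro notI) simp
      have "(2::nat) ^ x' < ?u" using lt[of ?u Y] fin by simp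
      then have "x' < 2 ^ k" by simp
      then have "x < 2 ^ Suc k" using x by auto
      then have y: "2 ^ x < ?w" by (rule power_strict_increasing) simp
      then have xw: "x < ?w" using less_exp[of x] by linarith
      have bnd: "Z + c * ?w < ?w * ?w" if "Z < ?w" "c < ?w" for Z c
      proof -
        have "Z + c * ?w < (c + 1) * ?w" using that by simp
        also have "\<dots> \<le> ?w * ?w" using that by (intro mult_right_mono) auto
        finally show ?thesis .
      qed
      have new: "blk ?w (Z + c * ?w) = c" if "Z < ?w" "c < ?w" for Z c
        using that by (simp add: blk_def)
      have old: "blk (2 ^ 2 ^ i) (Z + c * ?w) = blk (2 ^ 2 ^ i) Z" if "i \<le> k" for i Z c
      proof -
        have "(2::nat) ^ 2 ^ Suc i dvd ?w" using that by (intro le_imp_power_dvd) simp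
        then obtain d where "?w = 2 ^ 2 ^ i * 2 ^ 2 ^ i * d" unfolding sq by (rule dvdE)
        then have eq: "Z + c * ?w = Z + 2 ^ 2 ^ i * (2 ^ 2 ^ i * (d * c))" by (simp add: mult_ac)
        show ?thesis unfolding blk_def eq by simp
      qed
      let ?X = "X + x * ?w" and ?Y = "Y + 2 ^ x * ?w"
      have "run ?w ?X ?Y"
        unfolding run_def
      proof (intro allI impI)
        fix v assume "v < ?w" and "(\<exists>i. v = 2 ^ 2 ^ i) \<and> 2 < v"
        then obtain i where v: "v = 2 ^ 2 ^ i" "2 < v" by blast
        then have "i \<le> k" using \<open>v < ?w\<close>
          by (simp add: power_strict_increasing_iff less_Suc_eq_le del: power_Suc)
        show "blk (v * v) ?X = 2 * blk v ?X \<and> blk (v * v) ?Y = blk v ?Y * blk v ?Y \<or>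
          blk (v * v) ?X = 2 * blk v ?X + 1 \<and> blk (v * v) ?Y = 2 * (blk v ?Y * blk v ?Y)"
        proof (cases "i = k")
          case True
          have "blk (v * v) ?X = x" "blk (v * v) ?Y = 2 ^ x"
            unfolding v True sq[symmetric] using new XY xw y by blast+
          moreover have "blk v ?X = x'" "blk v ?Y = 2 ^ x'"
            unfolding v True using old[of k] fin by simp_all
          moreover have "(2::nat) ^ (2 * x') = 2 ^ x' * 2 ^ x'" by (simp add: mult_2 power_add)
          moreover have "(2::nat) ^ (2 * x' + 1) = 2 * (2 ^ x' * 2 ^ x')"
            by (simp add: mult_2 power_add)
          ultimately show ?thesis using x by (elim disjE) (simp_all only:, simp_all)
        next
          case False
          then have "i < k" using \<open>i \<le> k\<close> by simp
          then have "v < ?u" unfolding v by (intro power_strict_increasing) auto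
          then have "blk (v * v) X = 2 * blk v X \<and> blk (v * v) Y = blk v Y * blk v Y \<or>
              blk (v * v) X = 2 * blk v X + 1 \<and> blk (v * v) Y = 2 * (blk v Y * blk v Y)"
            using run v unfolding run_def by blast
          moreover have "blk v ?X = blk v X" "blk v ?Y = blk v Y"
            unfolding v using old \<open>i \<le> k\<close> by blast+
          moreover have "blk (v * v) ?X = blk (v * v) X" "blk (v * v) ?Y = blk (v * v) Y"
            unfolding v sq[of i, symmetric] using old Suc_leI[OF \<open>i < k\<close>] by blast+
          ultimately show ?thesis by (simp only:)
        qed
      qed
      moreover have "blk 4 ?X = 1" "blk 4 ?Y = 2"
        using old[of 1 X x] old[of 1 Y "2 ^ x"] start \<open>k \<noteq> 0\<close> by (simp_all del: power_Suc)
      moreover have "?w < Suc (2 ^ x * 2 ^ x)"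
      proof -
        have "?w \<le> 2 ^ (2 * x') * 2 ^ (2 * x')"
          unfolding sq using mult_mono[OF u(1) u(1)] by (simp add: mult_2 power_add)
        also have "\<dots> \<le> 2 ^ x * 2 ^ x" using x by (intro mult_mono power_increasing) auto
        finally show ?thesis by simp
      qed
      moreover have "2 < ?w" unfolding sq using mult_strict_mono[OF u(2) u(2)] by simp
      moreover have "?X < ?w * ?w" "?Y < ?w * ?w"
        by (rule bnd[OF XY(1) xw], rule bnd[OF XY(2) y])
      moreover have "blk ?w ?X = x" "blk ?w ?Y = 2 ^ x"
        by (rule new[OF XY(1) xw], rule new[OF XY(2) y])
      ultimately show ?thesis unfolding graph_def by blast
    qed
  qed
  show ?thesis unfolding S
    using sound[of "eval nat_struct e s" "eval nat_struct e t"] complete[of "eval nat_struct e s"]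
    by (cases "eval nat_struct e s = 0") auto
qed

end

theory Submission
  imports Defs
begin

text \<open>The model is the non-negative part of a discretely ordered ring.  By \<open>\<Delta>\<^sub>0\<close>-elementarity \<open>j\<close>
  respects every \<open>\<Delta>\<^sub>0\<close>-definable relation, in particular the graph of exponentiation and the
  relation ``the binary digit of \<open>z\<close> at place \<open>v\<close> is \<open>1\<close>''.  If \<open>m\<close> is in the fixed cut \<open>I\<close> and
  \<open>y = 2^m\<close> exists, then \<open>j\<close> fixes all powers of two up to \<open>y\<close>, hence preserves the binary digits
  of every \<open>z < y\<close>, hence fixes \<open>z\<close>; so \<open>y \<in> I\<close>.  Take \<open>c\<close> with \<open>j c \<noteq> c\<close>, so that \<open>c\<close> lies above
  \<open>I\<close>.  The least \<open>m\<close> for which \<open>2^m < c\<close> fails cannot be in \<open>I\<close>: then \<open>2^(m - 1)\<close> and so also its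
  double would be in \<open>I\<close>.  Thus \<open>I\<close> is closed under exponentiation.  Collection holds by overspill,
  since \<open>I\<close> is a proper cut.\<close>

section \<open>Satisfaction\<close>

text \<open>Induction is available only for bounded formulae, and \<open>2^x\<close> is a relation,
  not a function. So every auxiliary fact about powers of two, digits and \<open>2^x\<close> is a
  \<open>Delta0\<close> induction whose quantifiers need explicit bounds; this is the origin of the
  many clauses such as \<open>z < y + 1\<close> with a fixed \<open>y\<close>. To avoid writing
  formulae, definability is tracked for HOL predicates on environments (\<open>dterm\<close>,
  \<open>dpred\<close>).

  Powers of two are at first given by divisibility, without exponents. The formula for
  \<open>2^x\<close> obtains a value from the one at half the exponent, so the law
  \<open>2^(x+1) = 2 * 2^x\<close> and uniqueness have to be proved. They yield the link between
  both notions: a power of two \<open>v \<le> 2^m\<close> is \<open>2^i\<close> for some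
  \<open>i \<le> m\<close>; as \<open>j\<close> fixes \<open>i\<close> and preserves the functional
  relation \<open>ex\<close>, it fixes \<open>v\<close>.

  Passing to a ring provides subtraction and the arithmetic of \<open>linordered_idom\<close>. The
  price is that the ring is a type, so the structure has to be chosen before the type is
  formed.\<close>

lemma eval_subst_tm: "eval M e (subst_tm \<sigma> t) = eval M (\<lambda>n. eval M e (\<sigma> n)) t"
  by (induction t) simp_all

lemma sat_subst: "sat M e (subst \<sigma> \<phi>) \<longleftrightarrow> sat M (\<lambda>n. eval M e (\<sigma> n)) \<phi>"
proof (induction \<phi> arbitrary: e \<sigma>)
  have "(\<lambda>n. eval M (case_nat a e) (case_nat (Var 0) (\<lambda>n. lift (\<sigma> n)) n))
      = case_nat a (\<lambda>n. eval M e (\<sigma> n))" for a e \<sigma>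
    by (auto simp: fun_eq_iff split: nat.split)
  note this [simp]
  case (Forall \<phi>)
  then show ?case by simp
next
  have "(\<lambda>n. eval M (case_nat a e) (case_nat (Var 0) (\<lambda>n. lift (\<sigma> n)) n))
      = case_nat a (\<lambda>n. eval M e (\<sigma> n))" for a e \<sigma>
    by (auto simp: fun_eq_iff split: nat.split)
  note this [simp]
  case (Exists \<phi>)
  then show ?case by simp
qed (simp_all add: eval_subst_tm)

lemma range_case_nat: "range (case_nat a e) \<subseteq> A \<longleftrightarrow> a \<in> A \<and> range e \<subseteq> A"
  by (auto simp: image_subset_iff split: nat.split)

lemma eval_in: "subuniverse M A \<Longrightarrow> range e \<subseteq> A \<Longrightarrow> eval M e t \<in> A"
  by (induction t) (auto simp: subuniverse_def)

lemma eval_isomorphism: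
  assumes "isomorphism f M N" "is_structure M" "range e \<subseteq> carr M"
  shows "eval N (\<lambda>n. f (e n)) t = f (eval M e t)"
proof -
  have "eval M e t \<in> carr M" for t using assms by (intro eval_in) (auto simp: is_structure_def)
  then show ?thesis using assms by (induction t) (auto simp: isomorphism_def)
qed

lemma sat_isomorphism:
  assumes iso: "isomorphism f M N" and M: "is_structure M"
  shows "range e \<subseteq> carr M \<Longrightarrow> sat N (\<lambda>n. f (e n)) \<phi> \<longleftrightarrow> sat M e \<phi>"
proof (induction \<phi> arbitrary: e)
  have ev: "eval M e t \<in> carr M" if "range e \<subseteq> carr M" for e t
    using that M by (intro eval_in) (auto simp: is_structure_def)
  {
    case (Eq s t)
    have "inj_on f (carr M)" using iso by (auto simp: isomorphism_def bij_betw_def)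
    then show ?case using Eq ev[OF Eq]
      by (simp add: eval_isomorphism[OF iso M Eq] inj_on_eq_iff)
  next
    case (Lt s t)
    then show ?case using iso ev[OF Lt] by (simp add: eval_isomorphism[OF iso M Lt] isomorphism_def)
  }
next
  have c: "(\<lambda>n. f (case_nat a e n)) = case_nat (f a) (\<lambda>n. f (e n))" for a e
    by (auto simp: fun_eq_iff split: nat.split)
  have N: "carr N = f ` carr M" using iso by (auto simp: isomorphism_def bij_betw_def)
  {
    case (Forall \<phi>)
    show ?case using Forall.IH[of "case_nat _ e"] Forall.prems
      by (simp add: N c range_case_nat)
  next
    case (Exists \<phi>)
    show ?case using Exists.IH[of "case_nat _ e"] Exists.prems
      by (simp add: N c range_case_nat)
  }
qed auto

lemma models_isomorphism:
  assumes iso: "isomorphism f M N" and M: "is_structure M"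
  shows "models N T \<longleftrightarrow> models M T"
proof -
  have N: "carr N = f ` carr M" using iso by (auto simp: isomorphism_def bij_betw_def)
  show ?thesis
  proof
    assume R: "models N T"
    show "models M T" unfolding models_def
    proof (intro ballI allI impI)
      fix \<phi> and e :: "nat \<Rightarrow> _" assume "\<phi> \<in> T" "range e \<subseteq> carr M"
      moreover from this have "range (\<lambda>n. f (e n)) \<subseteq> carr N" unfolding N by auto
      ultimately have "sat N (\<lambda>n. f (e n)) \<phi>" using R by (auto simp: models_def)
      then show "sat M e \<phi>" using sat_isomorphism[OF iso M] \<open>range e \<subseteq> carr M\<close> by blast
    qed
  next
    assume L: "models M T"
    show "models N T" unfolding models_def
    proof (intro ballI allI impI)
      fix \<phi> and e :: "nat \<Rightarrow> _" assume "\<phi> \<in> T" "range e \<subseteq> carr N"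
      define e' where "e' n = inv_into (carr M) f (e n)" for n
      have e': "e' n \<in> carr M" "f (e' n) = e n" for n
      proof -
        have "e n \<in> f ` carr M" using \<open>range e \<subseteq> carr N\<close> by (auto simp: N)
        then show "e' n \<in> carr M" "f (e' n) = e n"
          unfolding e'_def by (rule inv_into_into, rule f_inv_into_f)
      qed
      then have "range e' \<subseteq> carr M" by auto
      moreover from this have "sat M e' \<phi>" using L \<open>\<phi> \<in> T\<close> by (auto simp: models_def)
      ultimately have "sat N (\<lambda>n. f (e' n)) \<phi>" using sat_isomorphism[OF iso M] by blast
      then show "sat N e \<phi>" by (simp add: e')
    qed
  qed
qed

section \<open>Definability in discretely ordered rings\<close>

class idelta0_ring = linordered_idom +
  assumes models_nonneg: "models \<lparr>carr = {x. 0 \<le> x}, zero = 0, one = 1, add = (+), mul = (*), less = (<)\<rparr> IDelta0"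

definition nn :: "'a::linordered_idom arith_struct" where
  "nn = \<lparr>carr = {x. 0 \<le> x}, zero = 0, one = 1, add = (+), mul = (*), less = (<)\<rparr>"

lemma nn_simps [simp]:
  "carr nn = {x::'a::linordered_idom. 0 \<le> x}" "zero nn = (0::'a)" "one nn = (1::'a)"
  "add nn = ((+)::'a \<Rightarrow> _)" "mul nn = ((*)::'a \<Rightarrow> _)" "less nn = ((<)::'a \<Rightarrow> _)"
  by (simp_all add: nn_def)

lemma models_nn: "models (nn :: 'a::idelta0_ring arith_struct) IDelta0"
  using models_nonneg by (simp add: nn_def)

lemma is_structure_nn: "is_structure nn"
  by (simp add: is_structure_def subuniverse_def)

abbreviation nonneg_env :: "(nat \<Rightarrow> 'a::linordered_idom) \<Rightarrow> bool" where
  "nonneg_env e \<equiv> (\<forall>n. 0 \<le> e n)"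

lemma eval_nonneg: "nonneg_env e \<Longrightarrow> 0 \<le> eval nn e t"
  by (induction t) simp_all

lemma nonneg_env_case_nat [simp]: "nonneg_env (case_nat a e) \<longleftrightarrow> 0 \<le> a \<and> nonneg_env e"
  by (auto split: nat.split)

lemma eval_nn_Two [simp]: "eval nn e Two = 2"
  by (simp add: Two_def)

lemma sat_nn_BForall [simp]:
  "sat nn e (BForall t \<phi>) \<longleftrightarrow> (\<forall>a. 0 \<le> a \<and> a < eval nn e t \<longrightarrow> sat nn (case_nat a e) \<phi>)"
  by (auto simp: BForall_def)

lemma sat_nn_BExists [simp]:
  "sat nn e (BExists t \<phi>) \<longleftrightarrow> (\<exists>a. 0 \<le> a \<and> a < eval nn e t \<and> sat nn (case_nat a e) \<phi>)"
  by (auto simp: BExists_def)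

text \<open>Agreement is asked only on non-negative environments, which are the assignments into
  \<open>nn\<close>. The \<open>dintro\<close> rules read a defining term or formula off the shape
  of a HOL expression.\<close>

definition dterm :: "((nat \<Rightarrow> 'a::linordered_idom) \<Rightarrow> 'a) \<Rightarrow> bool" where
  "dterm f \<longleftrightarrow> (\<exists>t. \<forall>e. nonneg_env e \<longrightarrow> eval nn e t = f e)"

definition dpred :: "((nat \<Rightarrow> 'a::linordered_idom) \<Rightarrow> bool) \<Rightarrow> bool" where
  "dpred P \<longleftrightarrow> (\<exists>\<phi>. Delta0 \<phi> \<and> (\<forall>e. nonneg_env e \<longrightarrow> (sat nn e \<phi> \<longleftrightarrow> P e)))"

named_theorems dintro

lemma dterm_simple [dintro]:
  "dterm (\<lambda>e. e n)" "dterm (\<lambda>e. 0)" "dterm (\<lambda>e. 1)"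
  unfolding dterm_def
  by (rule exI[of _ "Var n"], simp, rule exI[of _ Zero], simp, rule exI[of _ One], simp)

lemma dterm_add [dintro]: "dterm f \<Longrightarrow> dterm g \<Longrightarrow> dterm (\<lambda>e. f e + g e)"
  unfolding dterm_def by (elim exE, rule_tac x="Add t ta" in exI) simp

lemma dterm_mul [dintro]: "dterm f \<Longrightarrow> dterm g \<Longrightarrow> dterm (\<lambda>e. f e * g e)"
  unfolding dterm_def by (elim exE, rule_tac x="Mul t ta" in exI) simp

lemma dterm_2 [dintro]: "dterm (\<lambda>e. 2)"
  using dterm_add[OF dterm_simple(3) dterm_simple(3)] by simp

lemma dpred_eq [dintro]: "dterm f \<Longrightarrow> dterm g \<Longrightarrow> dpred (\<lambda>e. f e = g e)"
  unfolding dterm_def dpred_def by (elim exE, rule_tac x="Eq t ta" in exI) (simp add: Delta0.intros)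

lemma dpred_less [dintro]: "dterm f \<Longrightarrow> dterm g \<Longrightarrow> dpred (\<lambda>e. f e < g e)"
  unfolding dterm_def dpred_def by (elim exE, rule_tac x="Lt t ta" in exI) (simp add: Delta0.intros)

lemma dpred_not [dintro]: "dpred P \<Longrightarrow> dpred (\<lambda>e. \<not> P e)"
  unfolding dpred_def by (elim exE, rule_tac x="Neg \<phi>" in exI) (simp add: Delta0.intros)

lemma dpred_conj [dintro]: "dpred P \<Longrightarrow> dpred Q \<Longrightarrow> dpred (\<lambda>e. P e \<and> Q e)"
  unfolding dpred_def by (elim exE, rule_tac x="And \<phi> \<phi>'" in exI) (simp add: Delta0.intros)

lemma dpred_disj [dintro]: "dpred P \<Longrightarrow> dpred Q \<Longrightarrow> dpred (\<lambda>e. P e \<or> Q e)"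
  unfolding dpred_def by (elim exE, rule_tac x="Or \<phi> \<phi>'" in exI) (simp add: Delta0.intros)

lemma dpred_imp [dintro]: "dpred P \<Longrightarrow> dpred Q \<Longrightarrow> dpred (\<lambda>e. P e \<longrightarrow> Q e)"
  unfolding dpred_def by (elim exE, rule_tac x="Imp \<phi> \<phi>'" in exI) (simp add: Delta0.intros)

lemma dpred_le [dintro]: "dterm f \<Longrightarrow> dterm g \<Longrightarrow> dpred (\<lambda>e. f e \<le> g e)"
  using dpred_not[OF dpred_less[of g f]] by (simp add: not_less)

text \<open>Under the quantifier the environment is shifted: the bound variable is
  \<open>e 0\<close> and the old environment starts at index 1. The clause \<open>0 \<le> a\<close>
  relativizes the quantifier to the model, since the type also has negative elements.\<close>

lemma dpred_all [dintro]:
  assumes "dterm f" "dpred (\<lambda>e. P (e 0) (\<lambda>n. e (Suc n)))"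
  shows "dpred (\<lambda>e. \<forall>a. 0 \<le> a \<and> a < f e \<longrightarrow> P a e)"
proof -
  obtain t \<phi> where t: "\<And>e. nonneg_env e \<Longrightarrow> eval nn e t = f e" and
    \<phi>: "Delta0 \<phi>" "\<And>e. nonneg_env e \<Longrightarrow> sat nn e \<phi> \<longleftrightarrow> P (e 0) (\<lambda>n. e (Suc n))"
    using assms by (auto simp: dterm_def dpred_def)
  have "sat nn e (BForall t \<phi>) \<longleftrightarrow> (\<forall>a. 0 \<le> a \<and> a < f e \<longrightarrow> P a e)" if "nonneg_env e" for e
    using that by (auto simp: t \<phi>)
  then show ?thesis unfolding dpred_def using \<phi> by (intro exI[of _ "BForall t \<phi>"]) (simp add: Delta0.intros)
qed

lemma dpred_ex [dintro]:
  assumes "dterm f" "dpred (\<lambda>e. P (e 0) (\<lambda>n. e (Suc n)))"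
  shows "dpred (\<lambda>e. \<exists>a. 0 \<le> a \<and> a < f e \<and> P a e)"
  using dpred_not[OF dpred_all[OF assms(1) dpred_not[OF assms(2)]]] by simp

lemma dpred_sat: "Delta0 \<phi> \<Longrightarrow> dpred (\<lambda>e. sat nn e \<phi>)"
  by (auto simp: dpred_def)

text \<open>The semantic side of substitution: choose a term for each component of \<open>g\<close>
  and substitute these terms into a formula for \<open>P\<close>.\<close>

lemma dpred_reindex:
  assumes "dpred P" "\<And>n. dterm (\<lambda>e. g e n)"
  shows "dpred (\<lambda>e. P (g e))"
proof -
  have D: "Delta0 (subst \<sigma> \<phi>)" if "Delta0 \<phi>" for \<sigma> \<phi>
    using that
  proof (induction arbitrary: \<sigma> rule: Delta0.induct)
    \<comment> \<open>The bound of a bounded quantifier has the form \<open>lift t\<close>.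
      Substitution under the binder commutes with \<open>lift\<close>, so the result is again a
      bounded quantifier.\<close>
    have l: "subst_tm (case_nat (Var 0) (\<lambda>n. lift (\<sigma> n))) (lift t) = lift (subst_tm \<sigma> t)" for \<sigma> t
      unfolding lift_def by (induction t) simp_all
    {
      case (7 \<phi> t)
      then show ?case unfolding BForall_def
        by (simp add: l) (simp flip: BForall_def add: Delta0.intros)
    next
      case (8 \<phi> t)
      then show ?case unfolding BExists_def
        by (simp add: l) (simp flip: BExists_def add: Delta0.intros)
    }
  qed (simp_all add: Delta0.intros)
  obtain \<phi> where \<phi>: "Delta0 \<phi>" "\<And>e. nonneg_env e \<Longrightarrow> sat nn e \<phi> \<longleftrightarrow> P e"
    using assms by (auto simp: dpred_def)
  obtain \<sigma> where \<sigma>: "\<And>n e. nonneg_env e \<Longrightarrow> eval nn e (\<sigma> n) = g e n"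
    using assms(2) unfolding dterm_def by metis
  have "nonneg_env (g e)" if "nonneg_env e" for e
    using that \<sigma> eval_nonneg by metis
  then have "sat nn e (subst \<sigma> \<phi>) \<longleftrightarrow> P (g e)" if "nonneg_env e" for e
    using that by (simp add: sat_subst \<sigma> \<phi>(2))
  then show ?thesis using D[OF \<phi>(1)] unfolding dpred_def by blast
qed

lemma nn_positive: "0 < x \<Longrightarrow> (1::'a::idelta0_ring) \<le> x"
proof -
  assume x: "0 < x"
  have ax: "Imp (Lt Zero (Var 0)) (Or (Eq (Var 0) One) (Lt One (Var 0))) \<in> IDelta0"
    by (simp add: IDelta0_def PA_minus_def Let_def)
  have "range (\<lambda>_::nat. x) \<subseteq> carr nn" using x by auto
  then have "sat nn (\<lambda>_. x) (Imp (Lt Zero (Var 0)) (Or (Eq (Var 0) One) (Lt One (Var 0))))"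
    using models_nn[where 'a='a] ax unfolding models_def by blast
  then show ?thesis using x by auto
qed

lemma less_iff_add_one_le: "x < y \<longleftrightarrow> x + 1 \<le> (y::'a::idelta0_ring)"
  using nn_positive[of "y - x"] by (auto simp: algebra_simps)

lemma le_iff_less_add_one: "x \<le> y \<longleftrightarrow> x < y + (1::'a::idelta0_ring)"
  using less_iff_add_one_le[of x "y + 1"] by simp

lemma dpred_induct:
  fixes P :: "(nat \<Rightarrow> 'a::idelta0_ring) \<Rightarrow> bool"
  assumes P: "dpred P" and e: "nonneg_env e" and P0: "P (case_nat 0 e)"
    and step: "\<And>x. 0 \<le> x \<Longrightarrow> P (case_nat x e) \<Longrightarrow> P (case_nat (x + 1) e)" and "0 \<le> x"
  shows "P (case_nat x e)"
proof -
  obtain \<phi> where \<phi>: "Delta0 \<phi>" "\<And>e. nonneg_env e \<Longrightarrow> sat nn e \<phi> \<longleftrightarrow> P e"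
    using assms by (auto simp: dpred_def)
  have "induction_ax \<phi> \<in> IDelta0" using \<phi> by (auto simp: IDelta0_def)
  moreover have "range e \<subseteq> carr nn" using e by auto
  ultimately have "sat nn e (induction_ax \<phi>)"
    using models_nn[where 'a='a] unfolding models_def by blast
  moreover have "(\<lambda>n. eval nn e (case_nat Zero Var n)) = case_nat 0 e"
    "(\<lambda>n. eval nn (case_nat a e) (case_nat (Add (Var 0) One) (\<lambda>n. Var (Suc n)) n))
      = case_nat (a + 1) e" for a
    by (auto simp: fun_eq_iff split: nat.split)
  ultimately show ?thesis using assms by (auto simp: induction_ax_def sat_subst \<phi>)
qed

lemma dpred_least:
  fixes P :: "(nat \<Rightarrow> 'a::idelta0_ring) \<Rightarrow> bool"
  assumes P: "dpred P" and e: "nonneg_env e" and x: "0 \<le> x" "P (case_nat x e)"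
  obtains y where "0 \<le> y" "y \<le> x" "P (case_nat y e)"
    "\<And>z. 0 \<le> z \<Longrightarrow> z < y \<Longrightarrow> \<not> P (case_nat z e)"
proof -
  define Q where "Q e \<longleftrightarrow> (\<forall>a. 0 \<le> a \<and> a < e 0 \<longrightarrow> \<not> P (case_nat a (\<lambda>n. e (Suc n))))" for e
  have "dterm (\<lambda>e. case_nat (e 0) (\<lambda>n. e (Suc (Suc n))) n)" for n :: nat
    by (cases n) (auto intro: dintro)
  then have "dpred Q" unfolding Q_def by (intro dintro dpred_reindex[OF P])
  have "\<exists>y. 0 \<le> y \<and> y \<le> x \<and> P (case_nat y e) \<and> (\<forall>z. 0 \<le> z \<and> z < y \<longrightarrow> \<not> P (case_nat z e))"
  proof (rule ccontr)
    assume no: "\<not> ?thesis"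
    have less: "a < y + 1 \<longleftrightarrow> a < y \<or> a = y" for a y :: 'a
      using le_iff_less_add_one[of a y] by auto
    \<comment> \<open>Minimality can be refuted only up to \<open>x\<close>; the disjunct
      \<open>y > x\<close> lets the induction run over all of the model.\<close>
    have "y > x \<or> Q (case_nat y e)" if "0 \<le> y" for y
    proof -
      have "dpred (\<lambda>e. e (Suc 0) < e 0 \<or> Q (case_nat (e 0) (\<lambda>n. e (Suc (Suc n)))))"
      proof (intro dintro dpred_reindex[OF \<open>dpred Q\<close>])
        show "dterm (\<lambda>e. case_nat (e 0) (\<lambda>n. e (Suc (Suc n))) n)" for n :: nat
          by (cases n) (auto intro: dintro)
      qed
      from dpred_induct[OF this, of "case_nat x e" y] show ?thesis
        using x e \<open>0 \<le> y\<close> no by (simp add: Q_def less) (smt (verit) not_less)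
    qed
    from this[of x] have "\<And>z. 0 \<le> z \<Longrightarrow> z < x \<Longrightarrow> \<not> P (case_nat z e)" using x(1) by (auto simp: Q_def)
    with no x show False by blast
  qed
  with that show ?thesis by blast
qed

text \<open>The two parameters mostly serve as bounds for the quantifiers inside \<open>P\<close>;
  where fewer are wanted, any non-negative value fills the place.\<close>

lemma less_induct_dpred [consumes 2, case_names definable nonneg less]:
  fixes P :: "'a::idelta0_ring \<Rightarrow> 'a \<Rightarrow> 'a \<Rightarrow> bool"
  assumes "0 \<le> a" "0 \<le> b" and P: "dpred (\<lambda>e. P (e 0) (e 1) (e 2))" and "0 \<le> x"
    and step: "\<And>x. 0 \<le> x \<Longrightarrow> (\<And>y. 0 \<le> y \<Longrightarrow> y < x \<Longrightarrow> P y a b) \<Longrightarrow> P x a b"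
  shows "P x a b"
proof (rule ccontr)
  assume "\<not> P x a b"
  obtain y where "0 \<le> y" "\<not> P y a b" "\<And>z. 0 \<le> z \<Longrightarrow> z < y \<Longrightarrow> P z a b"
    by (rule dpred_least[OF dpred_not[OF P], of "case_nat a (\<lambda>_. b)" x])
      (use assms(1,2,4) \<open>\<not> P x a b\<close> in \<open>simp_all add: numeral_2_eq_2\<close>)
  with step show False by blast
qed

section \<open>Division, parity and powers of two\<close>

lemma nn_less_cases: "0 \<le> r \<Longrightarrow> r < 2 \<Longrightarrow> r = 0 \<or> r = (1::'a::idelta0_ring)"
  using nn_positive[of r] nn_positive[of "r - 1"] by fastforce

lemma nonneg_factor: "0 < a \<Longrightarrow> 0 \<le> a * b \<Longrightarrow> 0 \<le> (b::'a::linordered_idom)"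
  by (simp add: zero_le_mult_iff)

lemma pos_factor: "0 < a \<Longrightarrow> 0 < a * b \<Longrightarrow> 0 < (b::'a::linordered_idom)"
  by (simp add: zero_less_mult_iff)

lemma nn_le_mult: "0 < y \<Longrightarrow> 0 \<le> q \<Longrightarrow> q \<le> q * (y::'a::idelta0_ring)"
  using mult_left_mono[OF nn_positive, of y q] by simp

lemma nn_dvd_le: "0 < y \<Longrightarrow> x dvd y \<Longrightarrow> (x::'a::idelta0_ring) \<le> y"
proof (elim dvdE)
  fix k assume "0 < y" and y: "y = x * k"
  show "x \<le> y"
  proof (cases "0 < x")
    case True
    then have "0 < k" using \<open>0 < y\<close> y pos_factor by blast
    then show ?thesis using nn_le_mult[of k x] True y by simp
  qed (use \<open>0 < y\<close> in simp)
qed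

lemma division_exists:
  fixes x y :: "'a::idelta0_ring"
  assumes "0 \<le> x" "0 < y"
  shows "\<exists>q r. 0 \<le> q \<and> 0 \<le> r \<and> r < y \<and> x = q * y + r"
proof -
  \<comment> \<open>The bound on \<open>q\<close> makes the statement definable; the induction is by
    repeated subtraction of \<open>y\<close>.\<close>
  have "\<exists>q. 0 \<le> q \<and> q < x + 1 \<and> (\<exists>r. 0 \<le> r \<and> r < y \<and> x = q * y + r)"
  proof (rule less_induct_dpred[where a=y and b=y and
        P="\<lambda>x y _. \<exists>q. 0 \<le> q \<and> q < x + 1 \<and> (\<exists>r. 0 \<le> r \<and> r < y \<and> x = q * y + r)"])
    fix x assume x: "0 \<le> x" and IH: "\<And>z. 0 \<le> z \<Longrightarrow> z < x \<Longrightarrow>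
        \<exists>q. 0 \<le> q \<and> q < z + 1 \<and> (\<exists>r. 0 \<le> r \<and> r < y \<and> z = q * y + r)"
    show "\<exists>q. 0 \<le> q \<and> q < x + 1 \<and> (\<exists>r. 0 \<le> r \<and> r < y \<and> x = q * y + r)"
    proof (cases "x < y")
      case True
      then show ?thesis using x by (intro exI[of _ 0]) auto
    next
      case False
      then obtain q r where "0 \<le> q" "0 \<le> r" "r < y" "x - y = q * y + r" "q < x - y + 1"
        using IH[of "x - y"] assms by auto
      moreover have "1 \<le> y" using assms nn_positive by blast
      ultimately show ?thesis by (intro exI[of _ "q + 1"]) (auto simp: algebra_simps intro!: exI[of _ r])
    qed
  qed (use assms in \<open>auto intro!: dintro\<close>)
  then show ?thesis by blast
qed

lemma division_unique_aux:
  fixes y :: "'a::idelta0_ring"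
  assumes "q * y + r = q' * y + r'" "0 \<le> r" "r < y" "0 \<le> r'" "r' < y"
  shows "q \<le> q'"
proof (rule ccontr)
  assume "\<not> q \<le> q'"
  then have "q' + 1 \<le> q" using less_iff_add_one_le[of q' q] by simp
  then have "(q' + 1) * y \<le> q * y" using assms by (intro mult_right_mono) auto
  then show False using assms by (simp add: distrib_right)
qed

text \<open>Meaningful only for \<open>0 \<le> x\<close> and \<open>0 < y\<close>: \<open>division_exists\<close> is not extended to negative dividends.\<close>

definition quo :: "'a::idelta0_ring \<Rightarrow> 'a \<Rightarrow> 'a" where
  "quo x y = (THE q. \<exists>r. 0 \<le> r \<and> r < y \<and> x = q * y + r)"

definition rmd :: "'a::idelta0_ring \<Rightarrow> 'a \<Rightarrow> 'a" where
  "rmd x y = x - quo x y * y"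

lemma quo_eqI:
  assumes "x = q * y + r" "0 \<le> r" "r < y"
  shows "quo x y = q" "rmd x y = r"
proof -
  show "quo x y = q" unfolding quo_def
  proof (rule the_equality)
    fix q' assume "\<exists>r. 0 \<le> r \<and> r < y \<and> x = q' * y + r"
    then obtain r' where r': "0 \<le> r'" "r' < y" "x = q' * y + r'" by blast
    then have "q \<le> q'" "q' \<le> q"
      using division_unique_aux[of q y r q' r'] division_unique_aux[of q' y r' q r] assms by simp_all
    then show "q' = q" by simp
  qed (use assms in blast)
  then show "rmd x y = r" using assms by (simp add: rmd_def)
qed

lemma quo_rmd:
  fixes x y :: "'a::idelta0_ring"
  assumes "0 \<le> x" "0 < y"
  shows "x = quo x y * y + rmd x y" "0 \<le> rmd x y" "rmd x y < y" "0 \<le> quo x y"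
proof -
  obtain q r where "0 \<le> q" "0 \<le> r" "r < y" "x = q * y + r"
    using division_exists[OF assms] by blast
  then show "x = quo x y * y + rmd x y" "0 \<le> rmd x y" "rmd x y < y" "0 \<le> quo x y"
    using quo_eqI[of x q y r] by auto
qed

lemma quo_less: "0 \<le> x \<Longrightarrow> x < y \<Longrightarrow> quo x y = 0" "0 \<le> x \<Longrightarrow> x < y \<Longrightarrow> rmd x y = x"
  using quo_eqI[of x 0 y x] by simp_all

lemma quo_add_mult: "0 \<le> x \<Longrightarrow> 0 < y \<Longrightarrow> quo (x + k * y) y = quo x y + k"
  "0 \<le> x \<Longrightarrow> 0 < y \<Longrightarrow> rmd (x + k * y) y = rmd x y"
  using quo_eqI[of "x + k * y" "quo x y + k" y "rmd x y"] quo_rmd[of x y]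
  by (simp_all add: algebra_simps)

lemma quo_1 [simp]: "quo x 1 = x"
  using quo_eqI[of x x 1 0] by simp

lemma quo_le: "0 \<le> x \<Longrightarrow> 0 < y \<Longrightarrow> quo x y \<le> x"
  using quo_rmd[of x y] nn_le_mult[of y "quo x y"] by linarith

abbreviation evn :: "'a::idelta0_ring \<Rightarrow> bool" where "evn x \<equiv> 2 dvd x"

lemma not_evn_double_add_one: "\<not> evn (2 * k + (1::'a::idelta0_ring))"
proof
  assume "evn (2 * k + 1)"
  then obtain d where "2 * k + 1 = 2 * d" by (rule dvdE)
  then have *: "2 * (d - k) = 1" by (simp add: algebra_simps)
  then have "0 < d - k" using pos_factor[of 2 "d - k"] by simp
  then have "1 \<le> d - k" by (rule nn_positive)
  then have "2 * 1 \<le> 2 * (d - k)" by (intro mult_left_mono) auto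
  then show False using * by simp
qed

lemma parity_cases:
  assumes "0 \<le> (x::'a::idelta0_ring)"
  obtains q where "0 \<le> q" "x = 2 * q" "evn x" | q where "0 \<le> q" "x = 2 * q + 1" "\<not> evn x"
proof -
  obtain q r where *: "0 \<le> q" "0 \<le> r" "r < 2" "x = q * 2 + r"
    using division_exists[OF assms, of 2] by auto
  show ?thesis using nn_less_cases[OF *(2,3)]
  proof
    assume "r = 0"
    then show ?thesis using that(1)[of q] * by (simp add: mult.commute)
  next
    assume "r = 1"
    then show ?thesis using that(2)[of q] * not_evn_double_add_one[of q] by (simp add: mult.commute)
  qed
qed

lemma evn_mult_cases: "0 \<le> a \<Longrightarrow> 0 \<le> b \<Longrightarrow> evn (a * b) \<Longrightarrow> evn a \<or> evn (b::'a::idelta0_ring)"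
proof (rule ccontr)
  assume *: "0 \<le> a" "0 \<le> b" "evn (a * b)" "\<not> (evn a \<or> evn b)"
  obtain p where p: "a = 2 * p + 1" using * by (metis parity_cases)
  obtain q where q: "b = 2 * q + 1" using * by (metis parity_cases)
  have "a * b = 2 * (2 * p * q + p + q) + 1" by (simp add: p q algebra_simps)
  then show False using * not_evn_double_add_one by metis
qed

section \<open>Powers of two, without exponents\<close>

definition pw :: "'a::idelta0_ring \<Rightarrow> bool" where
  "pw x \<longleftrightarrow> 0 < x \<and> (\<forall>r. 1 < r \<and> r dvd x \<longrightarrow> evn r)"

lemma pw_pos: "pw x \<Longrightarrow> 0 < x" by (simp add: pw_def)

lemma pw_1 [simp]: "pw 1"
  using nn_dvd_le[of 1] by (auto simp: pw_def dest!: leD)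

lemma pw_2 [simp]: "pw 2"
  unfolding pw_def
proof (intro conjI allI impI)
  fix r :: 'a assume r: "1 < r \<and> r dvd 2"
  then have "2 \<le> r" "r \<le> 2" using nn_dvd_le[of 2 r] less_iff_add_one_le[of 1 r] by auto
  then show "evn r" by simp
qed simp

lemma pw_dvd: "pw x \<Longrightarrow> 0 < d \<Longrightarrow> d dvd x \<Longrightarrow> pw d"
  unfolding pw_def using dvd_trans by blast

lemma pw_even: "pw x \<Longrightarrow> x \<noteq> 1 \<Longrightarrow> evn x"
  using nn_positive[of x] by (auto simp: pw_def)

lemma pw_half:
  assumes "pw x" "x \<noteq> 1" obtains y where "pw y" "x = 2 * y" "y < x"
proof -
  obtain y where y: "x = 2 * y" using pw_even[OF assms] by (rule dvdE)
  have "0 < y" using y pw_pos[OF assms(1)] by simp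
  then have "pw y" using pw_dvd[OF assms(1)] y by simp
  then show ?thesis using that y \<open>0 < y\<close> by simp
qed

text \<open>The number 2 is prime: an odd divisor \<open>r\<close> of \<open>2 * x\<close> has an
  even cofactor, so \<open>r\<close> already divides \<open>x\<close>.\<close>

lemma pw_double: "pw x \<Longrightarrow> pw (2 * x)"
  unfolding pw_def
proof (intro conjI allI impI)
  fix r :: 'a assume x: "0 < x \<and> (\<forall>r. 1 < r \<and> r dvd x \<longrightarrow> evn r)" and r: "1 < r \<and> r dvd 2 * x"
  show "evn r"
  proof (rule ccontr)
    assume "\<not> evn r"
    obtain k where k: "2 * x = r * k" using r by (auto elim: dvdE)
    have "0 < r" using r by auto
    then have "0 \<le> k" using pos_factor[of r k] x k by auto
    then have "evn k" using evn_mult_cases[of r k] k \<open>\<not> evn r\<close> \<open>0 < r\<close> by (metis dvd_triv_left less_imp_le)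
    then obtain l where "k = 2 * l" by (rule dvdE)
    then have "2 * x = 2 * (r * l)" using k by (simp add: mult.left_commute)
    then have "x = r * l" by simp
    then show False using x r \<open>\<not> evn r\<close> by auto
  qed
qed simp

text \<open>Divisibility in the ring puts no bound or sign on the cofactor. For
  \<open>s \<noteq> 0\<close> the signs of \<open>s\<close> and \<open>t\<close> force it into the
  range from 0 to \<open>t\<close>, and for \<open>s = 0\<close> the cofactor 0 will do.\<close>

lemma sat_nn_Dvd:
  assumes "nonneg_env e"
  shows "sat nn e (Dvd s t) \<longleftrightarrow> (eval nn e s :: 'a::idelta0_ring) dvd eval nn e t"
    (is "_ \<longleftrightarrow> ?s dvd ?t")
proof
  assume "?s dvd ?t"
  then obtain k where k: "?t = ?s * k" ..
  have *: "0 \<le> ?s" "0 \<le> ?t" using assms by (auto intro: eval_nonneg)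
  show "sat nn e (Dvd s t)"
  proof (cases "?s = 0")
    case True
    then show ?thesis using k by (auto simp: Dvd_def intro: exI[of _ 0])
  next
    case False
    then have "0 \<le> k" using * nonneg_factor[of ?s k] by (simp flip: k)
    moreover from this have "k \<le> ?t" using nn_le_mult[of ?s k] k False * by (simp add: mult.commute)
    ultimately show ?thesis using k unfolding Dvd_def by (auto simp: le_iff_less_add_one)
  qed
qed (auto simp: Dvd_def dvd_def dest: sym)

text \<open>The bound that \<open>Pow2\<close> puts on the divisor is automatic, as divisors of a
  positive element do not exceed it.\<close>

lemma sat_nn_Pow2:
  assumes "nonneg_env e"
  shows "sat nn e (Pow2 t) \<longleftrightarrow> pw (eval nn e t :: 'a::idelta0_ring)"
proof -
  have "1 < r \<and> r dvd x \<longleftrightarrow> 0 \<le> r \<and> r < x + 1 \<and> 1 < r \<and> r dvd x" if "0 < x" for r x :: 'a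
    using nn_dvd_le[OF that, of r] by (auto simp: le_iff_less_add_one)
  then show ?thesis using assms by (auto simp: Pow2_def pw_def sat_nn_Dvd)
qed

lemma dpred_dvd [dintro]: "dterm f \<Longrightarrow> dterm g \<Longrightarrow> dpred (\<lambda>e. (f e :: 'a::idelta0_ring) dvd g e)"
  unfolding dterm_def dpred_def
  by (elim exE, rule_tac x="Dvd t ta" in exI) (simp add: sat_nn_Dvd, simp add: Dvd_def Delta0.intros)

lemma dpred_pw [dintro]: "dterm f \<Longrightarrow> dpred (\<lambda>e. pw (f e :: 'a::idelta0_ring))"
  unfolding dterm_def dpred_def
  by (elim exE, rule_tac x="Pow2 t" in exI)
    (simp add: sat_nn_Pow2, simp add: Pow2_def Dvd_def Delta0.intros)

lemma pw_induct [consumes 3, case_names definable one double]: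
  fixes P :: "'a::idelta0_ring \<Rightarrow> 'a \<Rightarrow> 'a \<Rightarrow> bool"
  assumes "pw x" "0 \<le> a" "0 \<le> b" and P: "dpred (\<lambda>e. P (e 0) (e 1) (e 2))" and one: "P 1 a b"
    and double: "\<And>x. pw x \<Longrightarrow> P x a b \<Longrightarrow> P (2 * x) a b"
  shows "P x a b"
proof -
  have "pw x \<longrightarrow> P x a b"
  proof (rule less_induct_dpred[where P="\<lambda>x a b. pw x \<longrightarrow> P x a b"])
    show "dpred (\<lambda>e. pw (e 0 :: 'a) \<longrightarrow> P (e 0) (e 1) (e 2))" by (intro dintro P)
    show "pw x \<longrightarrow> P x a b" if "\<And>y. 0 \<le> y \<Longrightarrow> y < x \<Longrightarrow> pw y \<longrightarrow> P y a b" for x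
    proof
      assume "pw x"
      show "P x a b"
      proof (cases "x = 1")
        case False
        then obtain y where "pw y" "x = 2 * y" "y < x" using pw_half \<open>pw x\<close> by blast
        then show ?thesis using that[of y] double pw_pos[of y] by auto
      qed (use one in simp)
    qed
  qed (use assms(2,3) pw_pos[OF assms(1)] in auto)
  then show ?thesis using assms by blast
qed

lemma pw_mult:
  assumes "pw a" "pw b" shows "pw (a * b)"
proof -
  have "0 \<le> b" using pw_pos[OF assms(2)] by simp
  from assms(1) this this show ?thesis
  proof (induction rule: pw_induct[where P="\<lambda>a b _. pw (a * b)"])
    case definable
    show ?case by (intro dintro)
  next
    case (double x)
    then show ?case using pw_double[of "x * b"] by (simp add: mult.assoc)
  qed (use assms in simp)
qed

text \<open>Induction on \<open>a\<close>, for all powers \<open>c \<le> b\<close> at once, so that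
  the step can halve \<open>a\<close> and \<open>c\<close> together. Powers of two thus form a chain
  under divisibility, which replaces comparing exponents.\<close>

lemma pw_le_imp_dvd:
  assumes "pw a" "pw b" "a \<le> b" shows "a dvd b"
proof -
  have b: "0 \<le> b" using pw_pos[OF assms(2)] by simp
  from assms(1) this this have "\<forall>c. 0 \<le> c \<and> c < b + 1 \<longrightarrow> pw c \<longrightarrow> a \<le> c \<longrightarrow> a dvd c"
  proof (induction rule: pw_induct[where
      P="\<lambda>a b _. \<forall>c. 0 \<le> c \<and> c < b + 1 \<longrightarrow> pw c \<longrightarrow> a \<le> c \<longrightarrow> a dvd c"])
    case (double x)
    show ?case
    proof (intro allI impI)
      fix c assume c: "0 \<le> c \<and> c < b + 1" "pw c" "2 * x \<le> c"
      have "c \<noteq> 1" using c(3) nn_positive[OF pw_pos[OF double(1)]] by auto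
      then obtain d where d: "pw d" "c = 2 * d" "d < c" using pw_half c by blast
      then have "x dvd d" using double(2) c pw_pos[of d] by auto
      then show "2 * x dvd c" using d by (simp add: mult_dvd_mono)
    qed
  qed (auto intro!: dintro)
  then show ?thesis using assms b by (auto simp: le_iff_less_add_one)
qed

lemma pw_less:
  assumes "pw a" "pw b" "a < b" shows "2 * a \<le> b" "2 * a dvd b"
proof -
  obtain d where d: "b = a * d" using pw_le_imp_dvd[of a b] assms by (auto elim: dvdE)
  have "0 < d" using d assms pw_pos pos_factor by metis
  moreover have "d \<noteq> 1" using d assms by auto
  ultimately have "2 \<le> d" using nn_positive[of d] less_iff_add_one_le[of 1 d] by auto
  then have "a * 2 \<le> b" unfolding d using pw_pos[OF assms(1)] by (intro mult_left_mono) auto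
  then show "2 * a \<le> b" by (simp add: mult.commute)
  then show "2 * a dvd b" using assms by (intro pw_le_imp_dvd pw_double) auto
qed

lemma square_less_iff: "0 \<le> a \<Longrightarrow> 0 \<le> b \<Longrightarrow> a * a < b * b \<longleftrightarrow> a < (b::'a::linordered_idom)"
  by (metis mult_mono mult_strict_mono' not_less)

lemma square_le_iff: "0 \<le> a \<Longrightarrow> 0 \<le> b \<Longrightarrow> a * a \<le> b * b \<longleftrightarrow> a \<le> (b::'a::linordered_idom)"
  using square_less_iff[of b a] by (simp add: not_less[symmetric])

lemma pw_sqrt: "0 \<le> s \<Longrightarrow> pw (s * s) \<Longrightarrow> pw s"
  by (rule pw_dvd[of "s * s" s]) (auto simp: pw_def less_le)

text \<open>A substitute for the parity of exponents. Equality would give \<open>b < a\<close>,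
  hence \<open>2 * b \<le> a\<close> for powers of two, and then \<open>a * a\<close> would be at
  least four times \<open>b * b\<close>.\<close>

lemma pw_square_neq_double_square:
  assumes "pw a" "pw b" shows "a * a \<noteq> 2 * (b * b)"
proof
  assume eq: "a * a = 2 * (b * b)"
  have pos: "0 < a" "0 < b" using assms pw_pos by auto
  then have "b * b < a * a" by (simp add: eq)
  then have "b < a" using pos square_less_iff[of b a] by simp
  then have "2 * b \<le> a" using pw_less assms by blast
  then have "2 * b * (2 * b) \<le> a * a" using pos by (intro mult_mono) auto
  then show False using eq pos by simp
qed

section \<open>Binary digits\<close>

text \<open>The conjunct \<open>0 < u\<close> excludes the place 0, where \<open>quo\<close> has no
  meaning; \<open>Bit\<close> fails there too, since it asks for a remainder below
  \<open>u\<close>.\<close>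

definition bt :: "'a::idelta0_ring \<Rightarrow> 'a \<Rightarrow> bool" where
  "bt u m \<longleftrightarrow> 0 < u \<and> \<not> evn (quo m u)"

lemma sat_nn_Bit:
  assumes "nonneg_env e"
  shows "sat nn e (Bit u m) \<longleftrightarrow> bt (eval nn e u) (eval nn e m :: 'a::idelta0_ring)"
    (is "_ \<longleftrightarrow> bt ?u ?m")
proof
  have *: "0 \<le> ?u" "0 \<le> ?m" using assms by (auto intro: eval_nonneg)
  {
    assume bt: "bt ?u ?m"
    then have u: "0 < ?u" by (simp add: bt_def)
    note q = quo_rmd[OF *(2) u]
    obtain p where p: "0 \<le> p" "quo ?m ?u = 2 * p + 1"
      using bt unfolding bt_def by (metis parity_cases[OF q(4)])
    have "p < ?m + 1" using quo_le[OF *(2) u] p by linarith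
    moreover have "?m = (2 * p + 1) * ?u + rmd ?m ?u" using q(1) p(2) by simp
    ultimately have "\<exists>p. 0 \<le> p \<and> p < ?m + 1 \<and> (\<exists>r. 0 \<le> r \<and> r < ?u \<and> ?m = (2 * p + 1) * ?u + r)"
      using p(1) q(2,3) by blast
    then show "sat nn e (Bit u m)" by (simp add: Bit_def)
  next
    assume "sat nn e (Bit u m)"
    then obtain q r where "?m = (2 * q + 1) * ?u + r" "0 \<le> r" "r < ?u" by (auto simp: Bit_def)
    then show "bt ?u ?m"
      using quo_eqI[of ?m "2 * q + 1" ?u r] not_evn_double_add_one[of q] by (auto simp: bt_def)
  }
qed

lemma dpred_bt [dintro]: "dterm f \<Longrightarrow> dterm g \<Longrightarrow> dpred (\<lambda>e. bt (f e :: 'a::idelta0_ring) (g e))"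
  unfolding dterm_def dpred_def
  by (elim exE, rule_tac x="Bit t ta" in exI) (simp add: sat_nn_Bit, simp add: Bit_def Delta0.intros)

text \<open>Adding a multiple of \<open>2 * u\<close> changes the quotient by \<open>u\<close> by an
  even amount.\<close>

lemma bt_add_mult:
  assumes "0 \<le> m" "0 < u" "2 * u dvd w"
  shows "bt u (m + k * w) \<longleftrightarrow> bt u m"
proof -
  obtain d where d: "w = 2 * u * d" using assms by (auto elim: dvdE)
  then have "m + k * w = m + (2 * (k * d)) * u" by (simp add: mult_ac)
  then have "quo (m + k * w) u = quo m u + 2 * (k * d)" using quo_add_mult(1)[OF assms(1,2)] by metis
  then show ?thesis by (simp add: bt_def dvd_add_left_iff)
qed

lemma bt_rmd:
  assumes "0 \<le> m" "0 < u" "2 * u dvd w" "0 < w"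
  shows "bt u (rmd m w) \<longleftrightarrow> bt u m"
  using bt_add_mult[of "rmd m w" u w "quo m w"] quo_rmd[of m w] assms by (simp add: add.commute)

lemma bt_le: "0 \<le> m \<Longrightarrow> bt u m \<Longrightarrow> u \<le> m"
  using quo_less(1)[of m u] by (force simp: bt_def not_less[symmetric])

lemma bt_top: "0 \<le> m \<Longrightarrow> m < u \<Longrightarrow> bt u (m + u)"
  using quo_eqI(1)[of "m + u" 1 u m] not_evn_double_add_one[of 0] by (auto simp: bt_def)

text \<open>Induction on the power \<open>y\<close>: below \<open>2 * x\<close> a number is its
  digit at \<open>x\<close> together with its remainder modulo \<open>x\<close>, and the remainder
  has the same digits below \<open>x\<close>.\<close>

lemma bt_extensional:
  fixes a b y :: "'a::idelta0_ring"
  assumes "pw y" "0 \<le> a" "a < y" "0 \<le> b" "b < y"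
    and "\<And>v. pw v \<Longrightarrow> v \<le> y \<Longrightarrow> bt v a \<longleftrightarrow> bt v b"
  shows "a = b"
proof -
  \<comment> \<open>The numbers \<open>a\<close> and \<open>b\<close> are quantified inside because
    the step passes to their remainders. The equivalence is split into two implications, as there is
    no \<open>dintro\<close> rule for equivalences.\<close>
  define P where "P y \<longleftrightarrow> (\<forall>a. 0 \<le> a \<and> a < y \<longrightarrow> (\<forall>b. 0 \<le> b \<and> b < y \<longrightarrow>
    (\<forall>v. 0 \<le> v \<and> v < y + 1 \<longrightarrow> pw v \<longrightarrow> (bt v a \<longrightarrow> bt v b) \<and> (bt v b \<longrightarrow> bt v a)) \<longrightarrow> a = b))"
    for y :: 'a
  have "P y"
    using assms(1) order_refl order_refl
  proof (induction rule: pw_induct[where P="\<lambda>y a b. P y"])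
    case definable
    show ?case unfolding P_def by (intro dintro)
  next
    case one
    have "a = 0" if "0 \<le> a" "a < 1" for a :: 'a using that nn_positive[of a] by fastforce
    then show ?case by (auto simp: P_def)
  next
    case (double x)
    have x: "0 < x" using double pw_pos by blast
    show ?case unfolding P_def
    proof (intro allI impI)
      fix a b :: 'a assume a: "0 \<le> a \<and> a < 2 * x" and b: "0 \<le> b \<and> b < 2 * x" and
        eq: "\<forall>v. 0 \<le> v \<and> v < 2 * x + 1 \<longrightarrow> pw v \<longrightarrow> (bt v a \<longrightarrow> bt v b) \<and> (bt v b \<longrightarrow> bt v a)"
      have q: "quo c x = 0 \<or> quo c x = 1" if "0 \<le> c" "c < 2 * x" for c
      proof -
        have "quo c x * x < 2 * x" using that quo_rmd[of c x] x by linarith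
        then have "quo c x < 2" using x by simp
        then show ?thesis using quo_rmd(4)[of c x] that x by (intro nn_less_cases) auto
      qed
      have "bt x a \<longleftrightarrow> bt x b" using eq double(1) x by auto
      then have qq: "quo a x = quo b x"
        using q[of a] q[of b] a b x not_evn_double_add_one[of 0] by (auto simp: bt_def)
      have low: "bt v (rmd a x) \<longleftrightarrow> bt v (rmd b x)" if "pw v" "v \<le> x" for v
      proof (cases "v = x")
        case True
        then show ?thesis
          using quo_rmd[of a x] quo_rmd[of b x] a b x by (simp add: bt_def quo_less)
      next
        case False
        then have "2 * v dvd x" using pw_less(2)[of v x] that double(1) by auto
        moreover have "bt v a \<longleftrightarrow> bt v b" 
        proof -
          have "0 \<le> v \<and> v < 2 * x + 1" using that pw_pos[of v] x by (simp add: le_iff_less_add_one[symmetric])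
          then show ?thesis using eq that by blast
        qed
        ultimately show ?thesis using bt_rmd[of _ v x] a b x pw_pos[of v] that by simp
      qed
      have "0 \<le> rmd a x \<and> rmd a x < x" "0 \<le> rmd b x \<and> rmd b x < x"
        using quo_rmd[of a x] quo_rmd[of b x] a b x by simp_all
      then have "rmd a x = rmd b x"
        using double(2)[unfolded P_def, rule_format, of "rmd a x" "rmd b x"] low
        by (simp add: le_iff_less_add_one)
      then show "a = b" using qq quo_rmd(1)[of a x] quo_rmd(1)[of b x] a b x by simp
    qed
  qed
  from this[unfolded P_def, rule_format, of a b] show ?thesis
    using assms by (simp add: le_iff_less_add_one)
qed

section \<open>The graph of exponentiation\<close>

definition ppw_code :: "'a::idelta0_ring \<Rightarrow> 'a \<Rightarrow> bool" where
  "ppw_code t m \<longleftrightarrow> bt t m \<and> \<not> bt 1 m \<and> bt 2 m \<and>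
     (\<forall>i. 0 \<le> i \<and> i < m + 1 \<longrightarrow> pw i \<and> 2 < i \<longrightarrow>
       (bt i m \<longleftrightarrow> (\<exists>s. 0 \<le> s \<and> s < i + 1 \<and> s * s = i \<and> bt s m)))"

definition ppw :: "'a::idelta0_ring \<Rightarrow> bool" where
  "ppw t \<longleftrightarrow> pw t \<and> (\<exists>m. 0 \<le> m \<and> m < 2 * t \<and> ppw_code t m)"

lemma sat_nn_PPow2:
  assumes "nonneg_env e"
  shows "sat nn e (PPow2 t) \<longleftrightarrow> ppw (eval nn e t :: 'a::idelta0_ring)"
  using assms eval_nonneg[OF assms, of t]
  by (simp add: PPow2_def ppw_def ppw_code_def Let_def sat_nn_Pow2 sat_nn_Bit iff_conv_conj_imp
      cong: conj_cong)

lemma dpred_ppw [dintro]: "dterm f \<Longrightarrow> dpred (\<lambda>e. ppw (f e :: 'a::idelta0_ring))"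
  unfolding dterm_def dpred_def
  by (elim exE, rule_tac x="PPow2 t" in exI)
    (simp add: sat_nn_PPow2, simp add: PPow2_def Pow2_def Bit_def Dvd_def Let_def Delta0.intros)

lemma ppw_pw: "ppw u \<Longrightarrow> pw u" by (simp add: ppw_def)

lemma ppw_codeD:
  assumes "ppw_code t m" "0 \<le> m" "pw i" "2 < i" "bt i m"
  obtains s where "0 \<le> s" "s * s = i" "bt s m" "pw s"
proof -
  have "i < m + 1" using bt_le assms by (simp add: le_iff_less_add_one[symmetric])
  then obtain s where "0 \<le> s" "s * s = i" "bt s m"
    using assms unfolding ppw_code_def by (metis less_imp_le pw_pos)
  then show ?thesis using that pw_sqrt assms by blast
qed

lemma square_root_le: "0 \<le> s \<Longrightarrow> s \<le> s * (s::'a::idelta0_ring)"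
  using nn_le_mult[of s s] by (cases "s = 0") auto

text \<open>Truncate the code after its digit at \<open>s\<close>, that is, reduce it modulo
  \<open>2 * s\<close>. The digits up to \<open>s\<close> survive, and the condition at a place
  refers only to smaller places, so the result is a code for \<open>s\<close>.\<close>

lemma ppw_code_rmd:
  assumes code: "ppw_code t m" and m: "0 \<le> m" and s: "pw s" "bt s m"
  shows "ppw s"
proof -
  have s0: "0 < s" using s pw_pos by blast
  have "s \<noteq> 1" using code s by (auto simp: ppw_code_def)
  then have s2: "2 \<le> s" using nn_positive[OF s0] less_iff_add_one_le[of 1 s] by auto
  define n where "n = rmd m (2 * s)"
  have n: "0 \<le> n" "n < 2 * s" using quo_rmd[of m "2 * s"] m s0 by (auto simp: n_def)
  have bt: "bt i n \<longleftrightarrow> bt i m" if "pw i" "i \<le> s" for i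
    unfolding n_def using that s s0 m pw_pos by (intro bt_rmd mult_dvd_mono pw_le_imp_dvd) auto
  have "ppw_code s n" unfolding ppw_code_def
  proof (intro conjI allI impI)
    show "bt s n" using bt s by simp
    show "\<not> bt 1 n" using bt[of 1] s2 code by (auto simp: ppw_code_def)
    show "bt 2 n" using bt[of 2] s2 code by (auto simp: ppw_code_def)
    fix i assume i: "0 \<le> i \<and> i < n + 1" "pw i \<and> 2 < i"
    have "\<not> s < i" using pw_less(1)[of s i] i s n by (auto simp: le_iff_less_add_one[symmetric])
    then have le: "i \<le> s" by simp
    have "i \<le> m" using le bt_le s m by fastforce
    then have "bt i m \<longleftrightarrow> (\<exists>s. 0 \<le> s \<and> s < i + 1 \<and> s * s = i \<and> bt s m)"
      using code i unfolding ppw_code_def by (simp add: le_iff_less_add_one)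
    moreover have "bt r m \<longleftrightarrow> bt r n" if "0 \<le> r" "r * r = i" for r
      using bt[of r] pw_sqrt[of r] i that square_root_le[of r] le by auto
    ultimately show "bt i n \<longleftrightarrow> (\<exists>s. 0 \<le> s \<and> s < i + 1 \<and> s * s = i \<and> bt s n)"
      using bt[of i] i le by blast
  qed
  then show ?thesis using s n by (auto simp: ppw_def)
qed

text \<open>In a code for \<open>u\<close> the digit at \<open>u\<close> forces a digit at its
  square root \<open>s\<close>; truncating the code there shows that \<open>s\<close> belongs to the
  tower as well.\<close>

lemma ppw_sqrt:
  assumes "ppw u" "2 < u"
  obtains s where "ppw s" "u = s * s" "s < u"
proof -
  obtain m where m: "0 \<le> m" "ppw_code u m" "pw u" using assms by (auto simp: ppw_def)
  moreover from this have "bt u m" by (simp add: ppw_code_def)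
  ultimately obtain s where s: "0 \<le> s" "s * s = u" "bt s m" "pw s" using assms ppw_codeD by blast
  then have "ppw s" using ppw_code_rmd m by blast
  moreover have "s < u"
  proof -
    have "0 < s" using pw_pos s by blast
    moreover have "s \<noteq> 1" using s assms by auto
    ultimately have "1 < s" using nn_positive[of s] by auto
    then have "s * 1 < s * s" using \<open>0 < s\<close> by (intro mult_strict_left_mono)
    then show ?thesis using s by simp
  qed
  ultimately show ?thesis using that s by blast
qed

lemma ppw_ge_2: "ppw u \<Longrightarrow> 2 \<le> u"
proof -
  assume u: "ppw u"
  then have "0 < u" using ppw_pw pw_pos by blast
  moreover have "u \<noteq> 1" using u by (auto simp: ppw_def ppw_code_def)
  ultimately show ?thesis using nn_positive[of u] less_iff_add_one_le[of 1 u] by auto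
qed

text \<open>Consecutive members of the tower are a number and its square. Induction on
  \<open>u\<close>: take the square roots of \<open>u\<close> and \<open>v\<close>; the case
  \<open>v = 2\<close> is separate because 2 has no root in the tower.\<close>

lemma ppw_less_imp_square_le:
  assumes "ppw v" "ppw u" "v < u" shows "v * v \<le> u"
proof -
  have u0: "0 \<le> u" using ppw_ge_2[OF assms(2)] by simp
  have "\<forall>v. 0 \<le> v \<and> v < u \<longrightarrow> ppw v \<longrightarrow> ppw u \<longrightarrow> v * v \<le> u"
    using order_refl order_refl
  proof (rule less_induct_dpred[where x=u and a="0" and b="0" and
        P="\<lambda>u _ _. \<forall>v. 0 \<le> v \<and> v < u \<longrightarrow> ppw v \<longrightarrow> ppw u \<longrightarrow> v * v \<le> u"])
    show "dpred (\<lambda>e. \<forall>v. 0 \<le> v \<and> v < e 0 \<longrightarrow> ppw v \<longrightarrow> ppw (e 0) \<longrightarrow> v * v \<le> (e 0 :: 'a))"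
      by (intro dintro)
    fix u :: 'a assume IH: "\<And>y. 0 \<le> y \<Longrightarrow> y < u \<Longrightarrow>
        \<forall>v. 0 \<le> v \<and> v < y \<longrightarrow> ppw v \<longrightarrow> ppw y \<longrightarrow> v * v \<le> y"
    show "\<forall>v. 0 \<le> v \<and> v < u \<longrightarrow> ppw v \<longrightarrow> ppw u \<longrightarrow> v * v \<le> u"
    proof (intro allI impI)
      fix v assume v: "0 \<le> v \<and> v < u" "ppw v" "ppw u"
      have "2 \<le> v" using v ppw_ge_2 by blast
      then have "2 < u" using v by simp
      then obtain s where s: "ppw s" "u = s * s" "s < u" using ppw_sqrt v by blast
      have s2: "2 \<le> s" using s ppw_ge_2 by blast
      show "v * v \<le> u"
      proof (cases "v = 2")
        case True
        then show ?thesis using mult_mono[OF s2 s2] s2 s by simp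
      next
        case False
        then obtain r where r: "ppw r" "v = r * r" "r < v" using ppw_sqrt v \<open>2 \<le> v\<close> by (metis order_le_less)
        have r2: "2 \<le> r" using r ppw_ge_2 by blast
        have "r < s" using v r s square_less_iff[of r s] r2 s2 by simp
        then have "v \<le> s" using IH[of s] s r r2 s2 by auto
        then show ?thesis using s v square_le_iff[of v s] s2 by simp
      qed
    qed
  qed (use u0 in auto)
  then show ?thesis using assms ppw_ge_2[OF assms(1)] by auto
qed

text \<open>A code for \<open>u\<close> becomes one for \<open>u * u\<close> by adding a single
  digit at the place \<open>u * u\<close>, which lies above all others because
  \<open>m < 2 * u \<le> u * u\<close>.\<close>

lemma ppw_square:
  assumes "ppw u" shows "ppw (u * u)"
proof -
  obtain m where m: "0 \<le> m" "m < 2 * u" "ppw_code u m" and u: "pw u"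
    using assms by (auto simp: ppw_def)
  have u2: "2 \<le> u" using assms ppw_ge_2 by blast
  have le: "2 * u \<le> u * u" using u2 by (intro mult_right_mono) auto
  have pu: "pw (u * u)" using u pw_mult by blast
  have bt: "bt i (m + u * u) \<longleftrightarrow> bt i m" if "pw i" "i < u * u" for i
    using bt_add_mult[of m i "u * u" 1] pw_less(2)[OF that(1) pu that(2)] m pw_pos[OF that(1)] by simp
  have um: "u \<le> m" using bt_le m by (auto simp: ppw_code_def)
  have "ppw_code (u * u) (m + u * u)" unfolding ppw_code_def
  proof (intro conjI allI impI)
    show top: "bt (u * u) (m + u * u)" using bt_top[of m "u * u"] m(1) less_le_trans[OF m(2) le] by simp
    show "\<not> bt 1 (m + u * u)" using bt[of 1] le m u2 by (auto simp: ppw_code_def)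
    show "bt 2 (m + u * u)" using bt[of 2] le m u2 by (auto simp: ppw_code_def)
    fix i assume i: "0 \<le> i \<and> i < m + u * u + 1" "pw i \<and> 2 < i"
    have "\<not> u * u < i"
    proof
      assume "u * u < i"
      then have "2 * (u * u) \<le> i" using pw_less pu i by blast
      moreover have "i \<le> m + u * u" using i by (simp add: le_iff_less_add_one)
      ultimately show False using m le by simp
    qed
    then consider "i = u * u" | "i < u * u" by fastforce
    then show "bt i (m + u * u) \<longleftrightarrow> (\<exists>s. 0 \<le> s \<and> s < i + 1 \<and> s * s = i \<and> bt s (m + u * u))"
    proof cases
      case 1
      have "u < u * u" using le u2 by simp
      then have "bt u (m + u * u)" using bt[OF u] m by (simp add: ppw_code_def)
      then have "\<exists>s. 0 \<le> s \<and> s < i + 1 \<and> s * s = i \<and> bt s (m + u * u)"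
        using 1 u2 less_imp_le[OF \<open>u < u * u\<close>]
        by (intro exI[of _ u]) (simp add: le_iff_less_add_one[symmetric])
      then show ?thesis using top 1 by simp
    next
      case 2
      have root: "s < u \<and> pw s \<and> (bt s (m + u * u) \<longleftrightarrow> bt s m)" if "0 \<le> s" "s * s = i" for s
      proof -
        have "s < u" using square_less_iff[of s u] that 2 u2 by simp
        moreover have "pw s" using pw_sqrt that i by blast
        ultimately show ?thesis using bt[of s] le u2 by auto
      qed
      have "bt i m \<longleftrightarrow> (\<exists>s. 0 \<le> s \<and> s < i + 1 \<and> s * s = i \<and> bt s m)"
      proof (cases "i \<le> m")
        case True
        then show ?thesis using m(3) i unfolding ppw_code_def by (simp add: le_iff_less_add_one)
      next
        case False
        \<comment> \<open>The condition in the code \<open>m\<close> covers only places up to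
          \<open>m\<close>. For \<open>i > m\<close>, a digit at the root \<open>s\<close> would put
          \<open>s\<close> into the tower with \<open>s < u\<close>, whence
          \<open>i = s * s \<le> u \<le> m\<close>.\<close>
        have "\<not> bt s m" if "0 \<le> s" "s * s = i" for s
        proof
          assume "bt s m"
          then have "ppw s" using ppw_code_rmd m root that by blast
          then have "s * s \<le> u" using ppw_less_imp_square_le assms root that by blast
          then show False using False um that by simp
        qed
        moreover have "\<not> bt i m" using False bt_le m by blast
        ultimately show ?thesis by blast
      qed
      then show ?thesis using bt[of i] root i 2 by blast
    qed
  qed
  then show ?thesis unfolding ppw_def using pu m(1) less_le_trans[OF m(2) le]
    by (auto intro!: exI[of _ "m + u * u"])
qed

lemma ppw_2: "ppw 2"
proof -
  have q: "quo 2 2 = (1::'a)" using quo_eqI(1)[of 2 1 2 0] by simp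
  have "ppw_code (2::'a) 2" unfolding ppw_code_def
  proof (intro conjI allI impI)
    fix i :: 'a assume "0 \<le> i \<and> i < 2 + 1" "pw i \<and> 2 < i"
    then have False using le_iff_less_add_one[of i 2] by simp
    then show "bt i 2 \<longleftrightarrow> (\<exists>s. 0 \<le> s \<and> s < i + 1 \<and> s * s = i \<and> bt s 2)" ..
  qed (use q not_evn_double_add_one[of 0] in \<open>auto simp: bt_def\<close>)
  then show ?thesis unfolding ppw_def by (intro conjI exI[of _ 2]) auto
qed

lemma ppw_4: "ppw 4"
  using ppw_square[OF ppw_2] by simp

lemma ppw_ge_4:
  assumes "ppw u" "2 < u" shows "4 \<le> u"
  using ppw_less_imp_square_le[OF ppw_2 assms] by simp

section \<open>Sequences coded in blocks of digits, and runs of repeated squaring\<close>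

definition blk :: "'a::idelta0_ring \<Rightarrow> 'a \<Rightarrow> 'a" where
  "blk u z = rmd (quo z u) u"

lemma blk_bounds: "0 \<le> z \<Longrightarrow> 0 < u \<Longrightarrow> 0 \<le> blk u z" "0 \<le> z \<Longrightarrow> 0 < u \<Longrightarrow> blk u z < u"
  unfolding blk_def using quo_rmd[of z u] quo_rmd[of "quo z u" u] by auto

lemma sat_nn_Block:
  assumes "nonneg_env e"
  shows "sat nn e (Block u z w) \<longleftrightarrow>
    0 < eval nn e u \<and> blk (eval nn e u) (eval nn e z) = (eval nn e w :: 'a::idelta0_ring)"
    (is "_ \<longleftrightarrow> 0 < ?u \<and> blk ?u ?z = ?w")
proof
  have *: "0 \<le> ?u" "0 \<le> ?z" "0 \<le> ?w" using assms by (auto intro: eval_nonneg)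
  {
    assume "0 < ?u \<and> blk ?u ?z = ?w"
    then have u: "0 < ?u" "?w = rmd (quo ?z ?u) ?u" by (simp_all add: blk_def)
    note q = quo_rmd[OF *(2) u(1)]
    note q' = quo_rmd[OF q(4) u(1)]
    have "quo (quo ?z ?u) ?u < ?z + 1"
      using quo_le[OF q(4) u(1)] quo_le[OF *(2) u(1)] by (simp add: le_iff_less_add_one[symmetric])
    moreover have "?z = (quo (quo ?z ?u) ?u * ?u + ?w) * ?u + rmd ?z ?u"
      using q(1) q'(1) u(2) by simp
    ultimately have "\<exists>q. 0 \<le> q \<and> q < ?z + 1 \<and>
        (\<exists>r. 0 \<le> r \<and> r < ?u \<and> ?z = (q * ?u + ?w) * ?u + r)"
      using q(2,3) q'(4) by blast
    then show "sat nn e (Block u z w)" using u q'(3) by (simp add: Block_def Let_def)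
  next
    assume "sat nn e (Block u z w)"
    then obtain q r where z: "?z = (q * ?u + ?w) * ?u + r" and "0 \<le> r" "r < ?u" "?w < ?u"
      by (auto simp: Block_def Let_def)
    then show "0 < ?u \<and> blk ?u ?z = ?w"
      using quo_eqI(1)[OF z] quo_eqI(2)[of "q * ?u + ?w" q ?u ?w] * by (simp add: blk_def)
  }
qed

text \<open>\<open>blk\<close> is not a term, and \<open>Block\<close> expresses its graph together
  with positivity of \<open>u\<close>; hence one rule for both conjuncts. This dictates the form of
  the induction predicates in \<open>run_values\<close>.\<close>

lemma dpred_blk:
  "dterm f \<Longrightarrow> dterm g \<Longrightarrow> dterm h \<Longrightarrow> dpred (\<lambda>e. 0 < f e \<and> blk (f e :: 'a::idelta0_ring) (g e) = h e)"
  unfolding dterm_def dpred_def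
  by (elim exE, rule_tac x="Block t ta tb" in exI)
    (simp add: sat_nn_Block, simp add: Block_def Let_def Delta0.intros)

lemma blk_add_mult:
  assumes "0 \<le> z" "0 < u" "u * u dvd w"
  shows "blk u (z + k * w) = blk u z"
proof -
  obtain d where d: "w = u * u * d" using assms by (auto elim: dvdE)
  then have "z + k * w = z + (k * d * u) * u" by (simp add: mult_ac)
  then have "quo (z + k * w) u = quo z u + (k * d) * u" using quo_add_mult(1)[OF assms(1,2)] by metis
  then show ?thesis using quo_add_mult(2)[of "quo z u" u] quo_rmd[of z u] assms by (simp add: blk_def)
qed

lemma blk_rmd:
  assumes "0 \<le> z" "0 < u" "u * u dvd w" "0 < w"
  shows "blk u (rmd z w) = blk u z"
  using blk_add_mult[of "rmd z w" u w "quo z w"] quo_rmd[of z w] assms by (simp add: add.commute)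

lemma blk_top: "0 \<le> z \<Longrightarrow> z < w \<Longrightarrow> 0 \<le> c \<Longrightarrow> c < w \<Longrightarrow> blk w (z + c * w) = c"
  using quo_eqI(1)[of "z + c * w" c w z] quo_less(2)[of c w] by (simp add: blk_def)

definition run_step :: "'a::idelta0_ring \<Rightarrow> 'a \<Rightarrow> 'a \<Rightarrow> 'a \<Rightarrow> bool" where
  "run_step a b x y \<longleftrightarrow> x = 2 * a \<and> y = b * b \<or> x = 2 * a + 1 \<and> y = 2 * (b * b)"

definition is_run :: "'a::idelta0_ring \<Rightarrow> 'a \<Rightarrow> 'a \<Rightarrow> bool" where
  "is_run u X Y \<longleftrightarrow> (\<forall>v. 0 \<le> v \<and> v < u \<longrightarrow> ppw v \<and> 2 < v \<longrightarrow>
     run_step (blk v X) (blk v Y) (blk (v * v) X) (blk (v * v) Y))"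

definition ex_code :: "'a::idelta0_ring \<Rightarrow> 'a \<Rightarrow> 'a \<Rightarrow> bool" where
  "ex_code u x y \<longleftrightarrow> ppw u \<and> 2 < u \<and> (\<exists>X. 0 \<le> X \<and> X < u * u \<and> (\<exists>Y. 0 \<le> Y \<and> Y < u * u \<and>
     (blk 4 X = 1 \<and> blk 4 Y = 2) \<and> (blk u X = x \<and> blk u Y = y) \<and> is_run u X Y))"

lemma ex_codeI:
  assumes "ppw u" "2 < u" "0 \<le> X" "X < u * u" "0 \<le> Y" "Y < u * u" "blk 4 X = 1" "blk 4 Y = 2"
    "blk u X = x" "blk u Y = y" "is_run u X Y"
  shows "ex_code u x y"
  using assms unfolding ex_code_def by blast

definition ex :: "'a::idelta0_ring \<Rightarrow> 'a \<Rightarrow> bool" where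
  "ex x y \<longleftrightarrow> x = 0 \<and> y = 1 \<or> (\<exists>u. 0 \<le> u \<and> u < y * y + 1 \<and> ex_code u x y)"

text \<open>The pair quantified in each step of \<open>Exp_fm\<close> is determined by its
  \<open>Block\<close> conditions and lies below \<open>v\<close> by \<open>blk_bounds\<close>, so
  \<open>is_run\<close> can name it by \<open>blk\<close>.\<close>

lemma sat_nn_Exp_fm:
  assumes "nonneg_env e"
  shows "sat nn e (Exp_fm s t) \<longleftrightarrow> ex (eval nn e s) (eval nn e t :: 'a::idelta0_ring)"
proof -
  have var [simp]: "case_nat a f 2 = f (Suc 0)" "case_nat a f 3 = f 2" "case_nat a f 4 = f 3"
    for a and f :: "nat \<Rightarrow> 'a"
    by (simp_all add: numeral_eq_Suc)
  have pos: "0 < u" if "2 < u" for u :: 'a using that by (rule order.strict_trans[rotated]) simp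
  show ?thesis
    using assms eval_nonneg[OF assms, of s] eval_nonneg[OF assms, of t]
    by (simp add: Exp_fm_def ex_def ex_code_def Let_def sat_nn_PPow2 sat_nn_Block is_run_def run_step_def
      blk_bounds pos conj_assoc cong: conj_cong imp_cong)
qed

lemma dpred_exp [dintro]: "dterm f \<Longrightarrow> dterm g \<Longrightarrow> dpred (\<lambda>e. ex (f e :: 'a::idelta0_ring) (g e))"
  unfolding dterm_def dpred_def
  by (elim exE, rule_tac x="Exp_fm t ta" in exI) (simp add: sat_nn_Exp_fm Delta0_Exp_fm)

text \<open>Induction along 4, 16, 256, ... by square roots. The step may assume
  \<open>v < x\<close> because a run says nothing about indices from its last one on.\<close>

lemma ppw_induct [consumes 3, case_names definable base square]:
  fixes P :: "'a::idelta0_ring \<Rightarrow> 'a \<Rightarrow> bool"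
  assumes "ppw x" "2 < x" "0 \<le> a" and P: "dpred (\<lambda>e. P (e 0) (e 1))" and base: "P 4 a"
    and square: "\<And>v. ppw v \<Longrightarrow> 2 < v \<Longrightarrow> v < x \<Longrightarrow> P v a \<Longrightarrow> P (v * v) a"
  shows "P x a"
proof -
  have x0: "0 \<le> x" using assms(2) by (rule order.strict_implies_order[OF order.strict_trans[rotated]]) simp
  have "x \<le> x \<longrightarrow> ppw x \<longrightarrow> 2 < x \<longrightarrow> P x a"
  proof (rule less_induct_dpred[where P="\<lambda>v a x. v \<le> x \<longrightarrow> ppw v \<longrightarrow> 2 < v \<longrightarrow> P v a"])
    show "dpred (\<lambda>e. e 0 \<le> (e 2 :: 'a) \<longrightarrow> ppw (e 0) \<longrightarrow> 2 < e 0 \<longrightarrow> P (e 0) (e 1))" by (intro dintro P)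
    fix v assume IH: "\<And>y. 0 \<le> y \<Longrightarrow> y < v \<Longrightarrow> y \<le> x \<longrightarrow> ppw y \<longrightarrow> 2 < y \<longrightarrow> P y a"
    show "v \<le> x \<longrightarrow> ppw v \<longrightarrow> 2 < v \<longrightarrow> P v a"
    proof (intro impI)
      assume v: "v \<le> x" "ppw v" "2 < v"
      obtain s where s: "ppw s" "v = s * s" "s < v" using ppw_sqrt v by blast
      have s2: "2 \<le> s" using s ppw_ge_2 by blast
      show "P v a"
      proof (cases "s = 2")
        case True
        then show ?thesis using base s by simp
      next
        case False
        then have "2 < s" using s2 by simp
        moreover have "P s a" using IH[of s] s s2 v \<open>2 < s\<close> by auto
        ultimately show ?thesis using square[of s] s v by auto
      qed
    qed
  qed (use assms x0 in auto)
  then show ?thesis using assms by blast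
qed

lemma run_values:
  assumes run: "is_run u X Y" and X: "0 \<le> X" and Y: "0 \<le> Y" and u: "ppw u" "2 < u"
    and start: "blk 4 X = 1" "blk 4 Y = 2"
  shows "1 \<le> blk u X" "pw (blk u Y)"
proof -
  have step: "run_step (blk v X) (blk v Y) (blk (v * v) X) (blk (v * v) Y)"
    if "ppw v" "2 < v" "v < u" for v
    using run that ppw_ge_2[of v] by (auto simp: is_run_def)
  have pos: "0 < v" if "2 < v" for v :: 'a using that by (rule order.strict_trans[rotated]) simp
  \<comment> \<open>Positivity is put as the negation of \<open>blk v X = 0\<close>, a form covered
    by \<open>dpred_blk\<close>; with \<open>blk_bounds\<close> this is enough.\<close>
  have "\<not> (0 < u \<and> blk u X = 0)" using u X
  proof (induction rule: ppw_induct[where P="\<lambda>v X. \<not> (0 < v \<and> blk v X = 0)"])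
    case (square v)
    then have "0 < blk v X" using pos[of v] blk_bounds(1)[OF X, of v] by simp
    then have "0 < blk (v * v) X" using step[OF square(1-3)] by (auto simp: run_step_def)
    then show ?case by simp
  next
    case definable
    show ?case by (intro dpred_not dpred_blk dterm_simple)
  qed (use start in auto)
  then show "1 \<le> blk u X" using pos[OF u(2)] blk_bounds(1)[OF X, of u] by (intro nn_positive) simp
  \<comment> \<open>The rule for \<open>pw\<close> needs a term, so the block is named by a variable
    \<open>w\<close>, which its index bounds.\<close>
  have "\<forall>w. 0 \<le> w \<and> w < u \<longrightarrow> 0 < u \<and> blk u Y = w \<longrightarrow> pw w" using u Y
  proof (induction rule: ppw_induct[where
        P="\<lambda>v Y. \<forall>w. 0 \<le> w \<and> w < v \<longrightarrow> 0 < v \<and> blk v Y = w \<longrightarrow> pw w"])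
    case (square v)
    then have "pw (blk v Y)" using pos[of v] blk_bounds[OF Y, of v] by simp
    then have "pw (blk (v * v) Y)"
      using step[OF square(1-3)] by (auto simp: run_step_def pw_mult pw_double)
    then show ?case by simp
  next
    case definable
    show ?case by (intro dpred_all dpred_imp dpred_blk dpred_pw dterm_simple)
  qed (use start in auto)
  then show "pw (blk u Y)" using pos[OF u(2)] blk_bounds[OF Y, of u] by simp
qed

lemma ex_code_values:
  assumes "ex_code u x y" shows "1 \<le> x" "x < u" "pw y" "y < u" "ppw u" "2 < u"
proof -
  obtain X Y where *: "0 \<le> X" "0 \<le> Y" "blk 4 X = 1" "blk 4 Y = 2" "blk u X = x" "blk u Y = y"
    "is_run u X Y" and u: "ppw u" "2 < u"
    using assms by (auto simp: ex_code_def)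
  have "0 < u" using u(2) by (rule order.strict_trans[rotated]) simp
  then show "1 \<le> x" "x < u" "pw y" "y < u" "ppw u" "2 < u"
    using run_values[OF *(7,1,2) u *(3,4)] blk_bounds(2)[of _ u] * u by auto
qed

text \<open>The root \<open>w\<close> of the last index holds the previous pair. Reducing both
  sequences modulo \<open>w * w\<close> leaves every block at an index up to \<open>w\<close>
  unchanged, since such a block reads only digits below \<open>w * w\<close>.\<close>

lemma ex_code_cases:
  assumes "ex_code u x y"
  obtains "u = 4" "x = 1" "y = 2"
  | w a b where "ex_code w a b" "u = w * w" "run_step a b x y"
proof -
  obtain X Y where X: "0 \<le> X" and Y: "0 \<le> Y" and start: "blk 4 X = 1" "blk 4 Y = 2"
    and fin: "blk u X = x" "blk u Y = y" and run: "is_run u X Y" and u: "ppw u" "2 < u"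
    using assms by (auto simp: ex_code_def)
  obtain w where w: "ppw w" "u = w * w" "w < u" using ppw_sqrt u by blast
  have w2: "2 \<le> w" using w ppw_ge_2 by blast
  show ?thesis
  proof (cases "w = 2")
    case True
    then show ?thesis using that(1) start fin w by simp
  next
    case False
    then have "2 < w" using w2 by simp
    have ww: "0 < w * w" using w2 by (intro mult_pos_pos) auto
    have bl: "blk v (rmd Z (w * w)) = blk v Z" if "ppw v" "v \<le> w" "0 \<le> Z" for v Z
      using that w ww ppw_ge_2[of v] ppw_pw by (intro blk_rmd mult_dvd_mono pw_le_imp_dvd) auto
    have "run_step (blk w X) (blk w Y) x y"
      using run w \<open>2 < w\<close> w2 fin unfolding is_run_def by auto
    moreover have "ex_code w (blk w X) (blk w Y)"
    proof (rule ex_codeI[where X="rmd X (w * w)" and Y="rmd Y (w * w)"])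
      show "ppw w" "2 < w" using w \<open>2 < w\<close> by auto
      show "0 \<le> rmd X (w * w)" "rmd X (w * w) < w * w" "0 \<le> rmd Y (w * w)" "rmd Y (w * w) < w * w"
        using quo_rmd X Y ww by auto
      show "blk 4 (rmd X (w * w)) = 1" "blk 4 (rmd Y (w * w)) = 2"
        using ppw_ge_4[OF w(1) \<open>2 < w\<close>] X Y start by (simp_all add: bl ppw_4)
      show "blk w (rmd X (w * w)) = blk w X" "blk w (rmd Y (w * w)) = blk w Y"
        using bl w X Y by simp_all
      show "is_run w (rmd X (w * w)) (rmd Y (w * w))"
        unfolding is_run_def
      proof (intro allI impI)
        fix v assume v: "0 \<le> v \<and> v < w" "ppw v \<and> 2 < v"
        have "v * v \<le> w" using ppw_less_imp_square_le v w by blast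
        moreover have "run_step (blk v X) (blk v Y) (blk (v * v) X) (blk (v * v) Y)"
          using run v less_trans[of v w u] w(3) unfolding is_run_def by blast
        ultimately show "run_step (blk v (rmd X (w * w))) (blk v (rmd Y (w * w)))
            (blk (v * v) (rmd X (w * w))) (blk (v * v) (rmd Y (w * w)))"
          using v X Y by (simp add: bl ppw_square)
      qed
    qed
    ultimately show ?thesis using that(2) w by blast
  qed
qed

text \<open>The new pair is stacked on top of the old sequences: \<open>X + x * (u * u)\<close> has
  the block \<open>x\<close> at index \<open>u * u\<close>, and the blocks at indices up to
  \<open>u\<close> are those of \<open>X\<close>. The work lies in showing that the new values fit
  below \<open>u * u\<close>.\<close>

lemma ex_code_step:
  assumes code: "ex_code u a b" and step: "run_step a b x y"
  shows "ex_code (u * u) x y"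
proof -
  obtain X Y where X: "0 \<le> X" "X < u * u" and Y: "0 \<le> Y" "Y < u * u"
    and start: "blk 4 X = 1" "blk 4 Y = 2"
    and fin: "blk u X = a" "blk u Y = b" and run: "is_run u X Y"
    using code by (auto simp: ex_code_def)
  note val = ex_code_values[OF code]
  have u0: "2 \<le> u" using val by simp
  have b0: "0 < b" using val pw_pos by blast
  have x: "0 \<le> x" "x < u * u"
  proof -
    have "a + 1 \<le> u" using val less_iff_add_one_le by blast
    moreover have "2 * u \<le> u * u" using u0 by (intro mult_right_mono) auto
    ultimately have "2 * a + 2 \<le> u * u" by (simp add: distrib_left[symmetric] del: mult_le_cancel_right)
    then show "0 \<le> x" "x < u * u" using val step unfolding run_step_def
      by (auto intro: less_le_trans[of _ "2 * a + 2"])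
  qed
  have y: "0 \<le> y" "y < u * u"
  proof -
    \<comment> \<open>The bound \<open>b < u\<close> alone would not keep \<open>2 * (b * b)\<close>
      below \<open>u * u\<close>; the factor is gained because \<open>b\<close> and \<open>u\<close>
      are both powers of two.\<close>
    have "2 * b \<le> u" using pw_less(1) val ppw_pw by blast
    then have "2 * b * b \<le> u * b" using b0 by (intro mult_right_mono) auto
    also have "\<dots> < u * u" using val u0 by (intro mult_strict_left_mono) auto
    finally have 1: "2 * (b * b) < u * u" by (simp add: mult.assoc)
    moreover have "0 < b * b" using b0 by simp
    ultimately show "0 \<le> y" "y < u * u" using step unfolding run_step_def by auto
  qed
  have uu: "0 < u * u" using u0 by (intro mult_pos_pos) auto
  have bnd: "0 \<le> Z + c * (u * u) \<and> Z + c * (u * u) < u * u * (u * u)"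
    if "0 \<le> Z" "Z < u * u" "0 \<le> c" "c < u * u" for Z c
  proof -
    have "Z + c * (u * u) < (c + 1) * (u * u)" using that by (simp add: distrib_right)
    also have "\<dots> \<le> u * u * (u * u)"
      using that uu less_iff_add_one_le[of c "u * u"] by (intro mult_right_mono) auto
    finally show ?thesis using that uu by simp
  qed
  have bl: "blk v (Z + c * (u * u)) = blk v Z" if "ppw v" "v \<le> u" "0 \<le> Z" for v Z c
    using that val ppw_ge_2[of v] ppw_pw by (intro blk_add_mult mult_dvd_mono pw_le_imp_dvd) auto
  show ?thesis
  proof (rule ex_codeI[where X="X + x * (u * u)" and Y="Y + y * (u * u)"])
    show "ppw (u * u)" using ppw_square val by blast
    show "2 < u * u" using val(6) square_root_le[of u] u0 by (auto intro: less_le_trans)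
    show "0 \<le> X + x * (u * u)" "X + x * (u * u) < u * u * (u * u)"
      "0 \<le> Y + y * (u * u)" "Y + y * (u * u) < u * u * (u * u)"
      using bnd X Y x y by blast+
    show "blk 4 (X + x * (u * u)) = 1" "blk 4 (Y + y * (u * u)) = 2"
      using ppw_ge_4[OF val(5,6)] X Y start by (simp_all add: bl ppw_4)
    show new: "blk (u * u) (X + x * (u * u)) = x" "blk (u * u) (Y + y * (u * u)) = y"
      using blk_top X Y x y by blast+
    show "is_run (u * u) (X + x * (u * u)) (Y + y * (u * u))"
      unfolding is_run_def
    proof (intro allI impI)
      fix v assume v: "0 \<le> v \<and> v < u * u" "ppw v \<and> 2 < v"
      \<comment> \<open>The tower has no index strictly between \<open>u\<close> and
        \<open>u * u\<close>, so the only new step of the run is the one at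
        \<open>u\<close>.\<close>
      have "v * v \<le> u * u" using ppw_less_imp_square_le[of v "u * u"] v ppw_square val by blast
      then have "v \<le> u" using square_le_iff[of v u] v u0 by simp
      show "run_step (blk v (X + x * (u * u))) (blk v (Y + y * (u * u)))
          (blk (v * v) (X + x * (u * u))) (blk (v * v) (Y + y * (u * u)))"
      proof (cases "v = u")
        case True
        then show ?thesis using new step bl fin v X Y by simp
      next
        case False
        then have "v < u" using \<open>v \<le> u\<close> by simp
        then have "v * v \<le> u" using ppw_less_imp_square_le v val by blast
        moreover have "run_step (blk v X) (blk v Y) (blk (v * v) X) (blk (v * v) Y)"
          using run v \<open>v < u\<close> unfolding is_run_def by auto
        ultimately show ?thesis using v X Y \<open>v \<le> u\<close> by (simp add: bl ppw_square)
      qed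
    qed
  qed
qed

lemma ex_0_1: "ex 0 1" by (simp add: ex_def)

lemma ex_1_2: "ex 1 2"
proof -
  \<comment> \<open>The shortest run has the single index 4: \<open>X = 1 * 4\<close> and
    \<open>Y = 2 * 4\<close> hold the starting values in their block.\<close>
  have "blk 4 4 = (1::'a)" "blk 4 8 = (2::'a)"
    using blk_top[of 0 4 1] blk_top[of 0 4 "2::'a"] by simp_all
  moreover have "is_run 4 4 (8::'a)"
    unfolding is_run_def using ppw_ge_4 by (metis not_le)
  ultimately have "ex_code 4 1 (2::'a)" using ppw_4 by (intro ex_codeI[of 4 4 8]) auto
  then show ?thesis unfolding ex_def by (intro disjI2 exI[of _ 4]) auto
qed

lemma run_step_bounds:
  assumes "run_step a b x y" "1 \<le> a" "pw b"
  shows "a < x" "b * b \<le> y" "b \<le> y"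
proof -
  have "0 < b" using assms pw_pos by blast
  then have "0 < b * b" by simp
  then show *: "a < x" "b * b \<le> y"
    using assms by (auto simp: run_step_def intro: less_le_trans[of _ "a + a"])
  then show "b \<le> y" using order_trans[OF square_root_le[of b]] \<open>0 < b\<close> by simp
qed

lemma ex_pw: "ex x y \<Longrightarrow> pw y"
  unfolding ex_def using ex_code_values(3) by auto

lemma ex_nonneg: "ex x y \<Longrightarrow> 0 \<le> x"
  unfolding ex_def by (auto dest!: ex_code_values(1) intro: order_trans[of 0 1])

text \<open>The bound on the index in \<open>ex\<close> survives a step: from
  \<open>u \<le> b * b \<le> y\<close> follows \<open>u * u \<le> y * y\<close>.\<close>

lemma ex_step:
  assumes "ex a b" "1 \<le> a" "run_step a b x y" shows "ex x y"
proof -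
  obtain u where u: "0 \<le> u" "u \<le> b * b" "ex_code u a b"
    using assms unfolding ex_def le_iff_less_add_one by auto
  note rs = run_step_bounds[OF assms(3,2) ex_pw[OF assms(1)]]
  have "u \<le> y" using u(2) rs(2) by simp
  then have "u * u \<le> y * y" using u(1) by (intro mult_mono) auto
  then have "0 \<le> u * u \<and> u * u < y * y + 1" using u(1) by (simp add: le_iff_less_add_one[symmetric])
  then show ?thesis
    using ex_code_step[OF u(3) assms(3)] unfolding ex_def by blast
qed

text \<open>The issue is the bound on the index of the shortened run: from
  \<open>w * w \<le> y * y\<close> one gets only \<open>w \<le> y \<le> 2 * (b * b)\<close>, while
  \<open>w \<le> b * b\<close> is required. Since \<open>w\<close> is the square of a power of two,
  it differs from \<open>2 * (b * b)\<close>, and a smaller power of two is at most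
  \<open>b * b\<close>.\<close>

lemma ex_cases:
  assumes "ex x y"
  obtains "x = 0" "y = 1" | "x = 1" "y = 2"
  | a b where "ex a b" "1 \<le> a" "run_step a b x y"
proof (cases "x = 0 \<and> y = 1")
  case False
  then obtain u where u: "0 \<le> u" "u \<le> y * y" "ex_code u x y"
    using assms unfolding ex_def le_iff_less_add_one by auto
  from u(3) show ?thesis
  proof (cases rule: ex_code_cases)
    case 1
    then show ?thesis using that(2) by simp
  next
    case (2 w a b)
    note val = ex_code_values[OF 2(1)]
    have b0: "0 < b * b" using pw_pos[OF val(3)] by simp
    have pb: "pw (b * b)" using pw_mult val by blast
    have w0: "0 \<le> w" using val(6) by (auto intro: order_trans[of _ 2])
    have "w * w \<le> y * y" using u 2 by simp
    moreover have "0 \<le> y" using 2(3) b0 unfolding run_step_def by (elim disjE) simp_all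
    ultimately have "w \<le> y" using square_le_iff[of w y] w0 by simp
    then have "w \<le> 2 * (b * b)" using 2(3) b0 unfolding run_step_def by (elim disjE) simp_all
    moreover have "w \<noteq> 2 * (b * b)"
    proof -
      obtain s where s: "ppw s" "w = s * s" using ppw_sqrt val(5,6) by blast
      show ?thesis using pw_square_neq_double_square[OF ppw_pw[OF s(1)] val(3)] s(2) by simp
    qed
    ultimately have "\<not> b * b < w" using pw_less(1)[OF pb ppw_pw[OF val(5)]] by auto
    then have "w < b * b + 1" by (simp add: le_iff_less_add_one[symmetric])
    then have "ex a b" unfolding ex_def using 2(1) w0 by blast
    then show ?thesis using that(3) 2 val by blast
  qed
qed (use that in auto)

section \<open>Exponentiation by single steps of the exponent\<close>

lemma ex_0_iff [simp]: "ex 0 y \<longleftrightarrow> y = 1"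
proof
  assume "ex 0 y"
  then show "y = 1"
  proof (cases rule: ex_cases)
    case (3 a b)
    then show ?thesis using run_step_bounds(1)[OF 3(3,2)] ex_pw by fastforce
  qed auto
qed (simp add: ex_0_1)

text \<open>Runs double the exponent, so the successor law needs induction. If
  \<open>x = 2 * a\<close>, the last step is exchanged for the other kind; if
  \<open>x = 2 * a + 1\<close>, the law for \<open>a\<close> gives the value at
  \<open>a + 1\<close>, which is then squared. All values are kept below the fixed bound
  \<open>y + 1\<close>.\<close>

lemma ex_succ:
  fixes x y :: "'a::idelta0_ring"
  assumes "ex x y" shows "ex (x + 1) (2 * y)"
proof -
  have y0: "0 < y" using pw_pos[OF ex_pw[OF assms]] .
  have "\<forall>z. 0 \<le> z \<and> z < y + 1 \<longrightarrow> ex x z \<longrightarrow> ex (x + 1) (2 * z)"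
  proof (rule less_induct_dpred[where b=0 and a=y and
        P="\<lambda>x y _. \<forall>z. 0 \<le> z \<and> z < y + 1 \<longrightarrow> ex x z \<longrightarrow> ex (x + 1) (2 * z)"])
    fix x :: 'a assume IH: "\<And>x'. 0 \<le> x' \<Longrightarrow> x' < x \<Longrightarrow>
        \<forall>z. 0 \<le> z \<and> z < y + 1 \<longrightarrow> ex x' z \<longrightarrow> ex (x' + 1) (2 * z)"
    show "\<forall>z. 0 \<le> z \<and> z < y + 1 \<longrightarrow> ex x z \<longrightarrow> ex (x + 1) (2 * z)"
    proof (intro allI impI)
      fix z assume z: "0 \<le> z \<and> z < y + 1" "ex x z"
      from z(2) show "ex (x + 1) (2 * z)"
      proof (cases rule: ex_cases)
        case 1
        then show ?thesis using ex_1_2 by simp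
      next
        case 2
        then show ?thesis using ex_step[OF ex_1_2, of 2 4] by (simp add: run_step_def)
      next
        case (3 a b)
        note rs = run_step_bounds[OF 3(3,2) ex_pw[OF 3(1)]]
        have b0: "0 < b" using pw_pos[OF ex_pw[OF 3(1)]] .
        from 3(3) consider "x = 2 * a" "z = b * b" | "x = 2 * a + 1" "z = 2 * (b * b)"
          by (auto simp: run_step_def)
        then show ?thesis
        proof cases
          case 1
          then show ?thesis using 3 by (intro ex_step[OF 3(1,2)]) (simp add: run_step_def)
        next
          case 2
          have "0 \<le> a" "b < y + 1" using 3(2) rs(3) z(1) by (auto intro: order_trans[of 0 1])
          then have "ex (a + 1) (2 * b)" using IH[of a] rs(1) 3(1) b0 by simp
          then have "ex (2 * (a + 1)) (2 * b * (2 * b))"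
            by (rule ex_step) (use \<open>0 \<le> a\<close> in \<open>auto simp: run_step_def\<close>)
          then show ?thesis using 2 by (simp add: algebra_simps)
        qed
      qed
    qed
  qed (use y0 ex_nonneg[OF assms] in \<open>auto intro!: dintro\<close>)
  then show ?thesis using assms y0 by simp
qed

text \<open>The converse of \<open>ex_succ\<close>, by the same induction. An odd exponent loses its
  final doubling. For \<open>2 * a\<close> the induction hypothesis at \<open>a\<close> gives
  \<open>b = 2 * c\<close> with \<open>c\<close> the value at \<open>a - 1\<close>, and
  \<open>2 * (c * c)\<close> is the value at \<open>2 * (a - 1) + 1\<close>.\<close>

lemma ex_pred:
  fixes x y :: "'a::idelta0_ring"
  assumes "ex (x + 1) y" "0 \<le> x" obtains z where "0 \<le> z" "y = 2 * z" "ex x z"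
proof -
  have y0: "0 < y" using pw_pos[OF ex_pw[OF assms(1)]] .
  define P where "P t y \<longleftrightarrow> (\<forall>z. 0 \<le> z \<and> z < y + 1 \<longrightarrow> ex t z \<longrightarrow> (\<forall>x. 0 \<le> x \<and> x < t \<longrightarrow> t = x + 1 \<longrightarrow>
     (\<exists>z'. 0 \<le> z' \<and> z' < y + 1 \<and> (z = 2 * z' \<and> ex x z'))))" for t y :: 'a
  have "P (x + 1) y"
  proof (rule less_induct_dpred[where b=0 and a=y and P="\<lambda>t y _. P t y"])
    show "dpred (\<lambda>e. P (e 0) (e 1))" unfolding P_def by (intro dintro)
    fix t :: 'a assume IH: "\<And>t'. 0 \<le> t' \<Longrightarrow> t' < t \<Longrightarrow> P t' y"
    have "\<exists>z'. 0 \<le> z' \<and> z' \<le> z \<and> (z = 2 * z' \<and> ex x z')"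
      if z: "0 \<le> z" "z < y + 1" and "ex t z" and x: "0 \<le> x" "t = x + 1" for z x
      using \<open>ex t z\<close>
    proof (cases rule: ex_cases)
      case 1
      then show ?thesis using x by simp
    next
      case 2
      then show ?thesis using x ex_0_1 by (intro exI[of _ 1]) simp
    next
      case (3 a b)
      note rs = run_step_bounds[OF 3(3,2) ex_pw[OF 3(1)]]
      have b0: "0 < b" using pw_pos[OF ex_pw[OF 3(1)]] .
      then have bb: "0 < b * b" by simp
      from 3(3) consider "t = 2 * a" "z = b * b" | "t = 2 * a + 1" "z = 2 * (b * b)"
        by (auto simp: run_step_def)
      then show ?thesis
      proof cases
        case 1
        have a: "0 \<le> a" "0 \<le> a - 1" using 3(2) by (auto intro: order_trans[of 0 1])
        have "P a y" using IH a rs by blast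
        moreover have "0 \<le> b \<and> b < y + 1" "0 \<le> a - 1 \<and> a - 1 < a" "a = a - 1 + 1"
          using rs(3) z b0 a by simp_all
        ultimately obtain c where c: "0 \<le> c" "b = 2 * c" "ex (a - 1) c"
          using 3(1) unfolding P_def by blast
        have z4: "z = 2 * (2 * (c * c))" using 1 c by simp
        have cc: "0 \<le> c * c" using c by simp
        have "ex x (2 * (c * c))"
        \<comment> \<open>Here \<open>a - 1 = 0\<close>, from which no run starts, so
          \<open>ex_step\<close> cannot be applied and \<open>x = 1\<close> is settled by
          \<open>ex_1_2\<close>.\<close>
        proof (cases "a = 1")
          case True
          then have "c = 1" using c by simp
          then show ?thesis using True 1 x ex_1_2 by simp
        next
          case False
          then have "1 < a" using 3(2) by simp
          then have "1 \<le> a - 1" using nn_positive[of "a - 1"] by simp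
          moreover have "x = 2 * (a - 1) + 1" using x 1 by (simp add: algebra_simps)
          ultimately show ?thesis using ex_step[OF c(3), of x "2 * (c * c)"] by (simp add: run_step_def)
        qed
        then show ?thesis using z4 cc by (intro exI[of _ "2 * (c * c)"]) simp
      next
        case 2
        then have "ex x (b * b)" using x by (intro ex_step[OF 3(1,2)]) (simp add: run_step_def)
        then show ?thesis using 2 bb by (intro exI[of _ "b * b"]) simp
      qed
    qed
    then have "\<exists>z'. 0 \<le> z' \<and> z' < y + 1 \<and> (z = 2 * z' \<and> ex x z')"
      if "0 \<le> z \<and> z < y + 1" "ex t z" "0 \<le> x \<and> x < t" "t = x + 1" for z x
      using that by (metis le_less_trans)
    then show "P t y" unfolding P_def by blast
  qed (use y0 assms in auto)
  moreover have "0 \<le> y \<and> y < y + 1" "0 \<le> x \<and> x < x + 1" using y0 assms by simp_all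
  ultimately show ?thesis using that assms(1) unfolding P_def by blast
qed

lemma ex_cases_succ:
  assumes "ex x y" obtains "x = 0" "y = 1" | z w where "x = z + 1" "y = 2 * w" "0 \<le> z" "ex z w" "w < y"
proof (cases "x = 0")
  case True
  then show ?thesis using that(1) assms by simp
next
  case False
  then have x: "0 \<le> x - 1" using ex_nonneg[OF assms] nn_positive[of x] by simp
  then obtain w where "y = 2 * w" "ex (x - 1) w" using ex_pred[of "x - 1" y] assms by auto
  then show ?thesis using that(2)[of "x - 1" w] x pw_pos[OF ex_pw[of "x - 1" w]] by simp
qed

text \<open>By \<open>ex_pred\<close> both values are doubles of values at the preceding exponent.
  The values \<open>y\<close> and \<open>y'\<close> themselves serve as the bounds in the
  induction.\<close>

lemma ex_unique:
  fixes x y :: "'a::idelta0_ring"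
  assumes "ex x y" "ex x y'" shows "y = y'"
proof -
  have y: "0 < y" "0 < y'" using assms ex_pw pw_pos by blast+
  have "\<forall>z. 0 \<le> z \<and> z < y + 1 \<longrightarrow> (\<forall>z'. 0 \<le> z' \<and> z' < y' + 1 \<longrightarrow> ex x z \<longrightarrow> ex x z' \<longrightarrow> z = z')"
  proof (rule less_induct_dpred[where b=y' and a=y and
        P="\<lambda>x y y'. \<forall>z. 0 \<le> z \<and> z < y + 1 \<longrightarrow>
            (\<forall>z'. 0 \<le> z' \<and> z' < y' + 1 \<longrightarrow> ex x z \<longrightarrow> ex x z' \<longrightarrow> z = z')"])
    fix x :: 'a assume IH: "\<And>t. 0 \<le> t \<Longrightarrow> t < x \<Longrightarrow>
      \<forall>z. 0 \<le> z \<and> z < y + 1 \<longrightarrow> (\<forall>z'. 0 \<le> z' \<and> z' < y' + 1 \<longrightarrow> ex t z \<longrightarrow> ex t z' \<longrightarrow> z = z')"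
    show "\<forall>z. 0 \<le> z \<and> z < y + 1 \<longrightarrow> (\<forall>z'. 0 \<le> z' \<and> z' < y' + 1 \<longrightarrow> ex x z \<longrightarrow> ex x z' \<longrightarrow> z = z')"
    proof (intro allI impI)
      fix z z' assume z: "0 \<le> z \<and> z < y + 1" "0 \<le> z' \<and> z' < y' + 1" "ex x z" "ex x z'"
      show "z = z'"
      proof (cases "x = 0")
        case True
        then show ?thesis using z by simp
      next
        case False
        from z(3) False obtain t w where w: "x = t + 1" "z = 2 * w" "0 \<le> t" "ex t w" "w < z"
          by (cases rule: ex_cases_succ) auto
        from z(4) False w(1) obtain w' where w': "z' = 2 * w'" "ex t w'" "w' < z'"
          by (cases rule: ex_cases_succ) auto
        have "0 \<le> w" "0 \<le> w'" using w w' ex_pw pw_pos less_imp_le by blast+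
        then have "w = w'" using IH[of t] w w' z(1,2) by auto
        then show ?thesis using w w' by simp
      qed
    qed
  qed (use y ex_nonneg[OF assms(1)] in \<open>auto intro!: dintro\<close>)
  then show ?thesis using assms y by simp
qed

text \<open>Halve \<open>v\<close> and lower the exponent \<open>x\<close> by one at the same time.
  This ties the powers of two given by divisibility to the graph of exponentiation, and makes them
  accessible through exponents that \<open>j\<close> fixes.\<close>

lemma pw_below_ex:
  fixes x y v :: "'a::idelta0_ring"
  assumes "ex x y" "pw v" "v \<le> y" obtains i where "0 \<le> i" "i \<le> x" "ex i v"
proof -
  have y: "0 < y" using assms ex_pw pw_pos by blast
  define P where "P x y \<longleftrightarrow> (\<forall>z. 0 \<le> z \<and> z < y + 1 \<longrightarrow> ex x z \<longrightarrow>
    (\<forall>v. 0 \<le> v \<and> v < z + 1 \<longrightarrow> pw v \<longrightarrow> (\<exists>i. 0 \<le> i \<and> i < x + 1 \<and> ex i v)))" for x y :: 'a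
  have "P x y"
  proof (rule less_induct_dpred[where b=0 and a=y and P="\<lambda>t y _. P t y"])
    show "dpred (\<lambda>e. P (e 0) (e 1))" unfolding P_def by (intro dintro)
    fix x :: 'a assume IH: "\<And>t. 0 \<le> t \<Longrightarrow> t < x \<Longrightarrow> P t y" and x0: "0 \<le> x"
    show "P x y" unfolding P_def
    proof (intro allI impI)
      fix z v assume z: "0 \<le> z \<and> z < y + 1" "ex x z" and v: "0 \<le> v \<and> v < z + 1" "pw v"
      show "\<exists>i. 0 \<le> i \<and> i < x + 1 \<and> ex i v"
      proof (cases "v = 1")
        case True
        then show ?thesis using ex_0_1 x0 by (intro exI[of _ 0]) auto
      next
        case False
        then obtain v' where v': "pw v'" "v = 2 * v'" using pw_half v by blast
        have "1 < v" using False nn_positive[OF pw_pos[OF v(2)]] by simp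
        moreover have vz: "v \<le> z" using v by (simp add: le_iff_less_add_one)
        ultimately have "z \<noteq> 1" by auto
        with z(2) obtain t w where w: "x = t + 1" "z = 2 * w" "0 \<le> t" "ex t w" "w < z"
          by (cases rule: ex_cases_succ) auto
        have "v' \<le> w" using vz v' w by simp
        moreover have "0 < v'" "0 < w" using v' w ex_pw pw_pos by blast+
        moreover have "P t y" using IH w by simp
        moreover have "w < y + 1" using w z by auto
        ultimately have "0 \<le> w \<and> w < y + 1" "0 \<le> v' \<and> v' < w + 1" "P t y"
          by (simp_all add: le_iff_less_add_one[symmetric])
        then obtain i where i: "0 \<le> i" "i < t + 1" "ex i v'"
          using w(4) v'(1) unfolding P_def by blast
        then show ?thesis using ex_succ[OF i(3)] v' w by (intro exI[of _ "i + 1"]) auto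
      qed
    qed
  qed (use y ex_nonneg[OF assms(1)] in auto)
  moreover have "0 \<le> y \<and> y < y + 1" "0 \<le> v \<and> v < y + 1"
    using y assms(3) pw_pos[OF assms(2)] by (simp_all add: le_iff_less_add_one[symmetric])
  ultimately obtain i where "0 \<le> i" "i < x + 1" "ex i v" using assms(1,2) unfolding P_def by blast
  then show ?thesis using that by (simp add: le_iff_less_add_one)
qed

section \<open>The cut of fixed points\<close>

lemma induced_simps [simp]:
  "carr (induced M A) = A" "zero (induced M A) = zero M" "one (induced M A) = one M"
  "add (induced M A) = add M" "mul (induced M A) = mul M" "less (induced M A) = less M"
  by (simp_all add: induced_def)

lemma eval_induced [simp]: "eval (induced M A) e t = eval M e t"
  by (induction t) simp_all

lemma dterm_case_nat [dintro]:
  "dterm f \<Longrightarrow> (\<And>k. dterm (\<lambda>e. g e k)) \<Longrightarrow> dterm (\<lambda>e. case_nat (f e) (g e) n)"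
  by (cases n) simp_all

section \<open>Initial segments closed under the operations\<close>

locale nn_cut =
  fixes I :: "'a::idelta0_ring set"
  assumes closed: "subuniverse nn I" and initial: "x \<in> I \<Longrightarrow> 0 \<le> y \<Longrightarrow> y \<le> x \<Longrightarrow> y \<in> I"
begin

lemma cut_nonneg: "x \<in> I \<Longrightarrow> 0 \<le> x"
  using closed by (auto simp: subuniverse_def)

lemma cut_closed: "0 \<in> I" "1 \<in> I" "x \<in> I \<Longrightarrow> y \<in> I \<Longrightarrow> x + y \<in> I" "x \<in> I \<Longrightarrow> y \<in> I \<Longrightarrow> x * y \<in> I"
  using closed by (auto simp: subuniverse_def)

lemma cut_env: "range e \<subseteq> I \<Longrightarrow> nonneg_env e"
  using cut_nonneg by auto

text \<open>The value of a bounding term lies in the cut, so a bounded quantifier ranges over the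
  same elements in the cut and in the whole model.\<close>

lemma cut_absolute:
  assumes "Delta0 \<phi>" "range e \<subseteq> I"
  shows "sat (induced nn I) e \<phi> \<longleftrightarrow> sat nn e \<phi>"
  using assms
proof (induction arbitrary: e rule: Delta0.induct)
  case (7 \<phi> t)
  have t: "eval nn e t \<in> I" using eval_in closed 7 by blast
  have "a \<in> I \<longleftrightarrow> 0 \<le> a" if "a < eval nn e t" for a
    using that initial[OF t, of a] cut_nonneg[of a] by auto
  then show ?case using 7 by (auto simp: BForall_def range_case_nat)
next
  case (8 \<phi> t)
  have t: "eval nn e t \<in> I" using eval_in closed 8 by blast
  have "a \<in> I \<longleftrightarrow> 0 \<le> a" if "a < eval nn e t" for a
    using that initial[OF t, of a] cut_nonneg[of a] by auto
  then show ?case using 8 by (auto simp: BExists_def range_case_nat)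
qed simp_all

lemma cut_PA_minus: "models (induced nn I) PA_minus"
proof -
  have sub: "\<exists>z\<in>I. x + z = y" if "x \<in> I" "y \<in> I" "x < y" for x y
    using that initial[of y "y - x"] cut_nonneg[of x] by (intro bexI[of _ "y - x"]) auto
  have one: "x = 1 \<or> 1 < x" if "0 < x" for x :: 'a using nn_positive[OF that] by auto
  show ?thesis unfolding models_def
  proof (intro ballI allI impI)
    fix \<phi> and e :: "nat \<Rightarrow> 'a" assume \<phi>: "\<phi> \<in> PA_minus" and e: "range e \<subseteq> carr (induced nn I)"
    then have "e n \<in> I" "0 \<le> e n" for n using cut_nonneg by auto
    then show "sat (induced nn I) e \<phi>"
      using \<phi> sub[of "e 0" "e 1"] one[of "e 0"]
      unfolding PA_minus_def Let_def
      by (elim insertE) (auto simp: algebra_simps less_le intro: mult_strict_right_mono)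
  qed
qed

text \<open>By absoluteness a failure in the cut is a failure in the model, where a least one
  exists; it and its predecessor lie in the cut because the cut is initial.\<close>

lemma cut_induction:
  assumes \<phi>: "Delta0 \<phi>" and e: "range e \<subseteq> I"
  shows "sat (induced nn I) e (induction_ax \<phi>)"
proof -
  have abs: "sat (induced nn I) (case_nat a e) \<phi> \<longleftrightarrow> sat nn (case_nat a e) \<phi>" if "a \<in> I" for a
    using cut_absolute[OF \<phi>, of "case_nat a e"] e that by (simp add: range_case_nat)
  have env: "(\<lambda>n. eval nn e (case_nat Zero Var n)) = case_nat 0 e"
    "(\<lambda>n. eval nn (case_nat a e) (case_nat (Add (Var 0) One) (\<lambda>n. Var (Suc n)) n))
      = case_nat (a + 1) e" for a
    by (auto simp: fun_eq_iff split: nat.split)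
  have "sat nn (case_nat a e) \<phi>"
    if P0: "sat nn (case_nat 0 e) \<phi>"
      and step: "\<And>a. a \<in> I \<Longrightarrow> sat nn (case_nat a e) \<phi> \<Longrightarrow> sat nn (case_nat (a + 1) e) \<phi>"
      and a: "a \<in> I" for a
  proof (rule ccontr)
    assume "\<not> sat nn (case_nat a e) \<phi>"
    then obtain y where y: "0 \<le> y" "y \<le> a" "\<not> sat nn (case_nat y e) \<phi>"
      "\<And>z. 0 \<le> z \<Longrightarrow> z < y \<Longrightarrow> sat nn (case_nat z e) \<phi>"
      using dpred_least[OF dpred_not[OF dpred_sat[OF \<phi>]], of e a] cut_env[OF e] cut_nonneg[OF a]
      by auto
    then have "y \<noteq> 0" using P0 by auto
    then have "0 \<le> y - 1" using nn_positive[of y] y(1) by simp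
    moreover from this have "y - 1 \<in> I" using initial[OF a] y(2) by simp
    ultimately show False using step[of "y - 1"] y by simp
  qed
  then show ?thesis
    by (auto simp: induction_ax_def sat_subst env abs cut_closed)
qed

lemma cut_IDelta0: "models (induced nn I) IDelta0"
  using cut_PA_minus cut_induction by (auto simp: IDelta0_def models_def)

text \<open>A prefix of existential quantifiers is merged into one quantifier over a common strict
  bound for all witnesses, which avoids a pairing function. The matrix \<open>P\<close> is evaluated
  in the whole model, as overspill requires.\<close>

lemma Sigma1_bounded_witness:
  assumes "Sigma1 \<phi>"
  shows "\<exists>P. dpred P \<and> (\<forall>e. range e \<subseteq> I \<longrightarrow>
    (sat (induced nn I) e \<phi> \<longleftrightarrow> (\<exists>w\<in>I. P (case_nat w e))))"
  using assms
proof (induction rule: Sigma1.induct)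
  case (1 \<phi>)
  have "dpred (\<lambda>e. sat (nn :: 'a arith_struct) (\<lambda>n. e (Suc n)) \<phi>)"
    using 1 by (intro dpred_reindex[OF dpred_sat] dintro)
  then show ?case using cut_absolute[OF 1] cut_closed(1)
    by (intro exI[of _ "\<lambda>e. sat nn (\<lambda>n. e (Suc n)) \<phi>"]) auto
next
  case (2 \<phi>)
  then obtain P where P: "dpred P" and
    sat: "\<And>e. range e \<subseteq> I \<Longrightarrow> sat (induced nn I) e \<phi> \<longleftrightarrow> (\<exists>w\<in>I. P (case_nat w e))"
    by blast
  \<comment> \<open>Index 0 holds the new bound; it must exceed both the outer witness
    \<open>a\<close> and the bound \<open>w\<close> for the remaining ones. Below it is taken to be
    \<open>a + w + 1\<close>.\<close>
  define Q where "Q e \<longleftrightarrow> (\<exists>a. 0 \<le> a \<and> a < e 0 \<and> (\<exists>w. 0 \<le> w \<and> w < e 0 \<and>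
      P (case_nat w (case_nat a (\<lambda>n. e (Suc n))))))" for e :: "nat \<Rightarrow> 'a"
  have "dterm (\<lambda>e. case_nat (e 0) (case_nat (e (Suc 0)) (\<lambda>n. e (Suc (Suc (Suc n))))) n :: 'a)"
    for n :: nat
    by (intro dintro)
  then have "dpred Q" unfolding Q_def by (intro dintro dpred_reindex[OF P])
  moreover have "sat (induced nn I) e (Exists \<phi>) \<longleftrightarrow> (\<exists>b\<in>I. Q (case_nat b e))"
    if e: "range e \<subseteq> I" for e
  proof
    assume "sat (induced nn I) e (Exists \<phi>)"
    then obtain a w where aw: "a \<in> I" "w \<in> I" "P (case_nat w (case_nat a e))"
      using sat[of "case_nat _ e"] e by (auto simp: range_case_nat)
    moreover have "a < a + w + 1" "w < a + w + 1"
      using cut_nonneg aw by (auto simp: add_nonneg_pos)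
    ultimately have "\<exists>w'. 0 \<le> w' \<and> w' < a + w + 1 \<and> P (case_nat w' (case_nat a e))"
      using cut_nonneg by blast
    then have "Q (case_nat (a + w + 1) e)"
      unfolding Q_def by (intro exI[of _ a]) (use \<open>a < a + w + 1\<close> cut_nonneg[OF aw(1)] in simp)
    then show "\<exists>b\<in>I. Q (case_nat b e)" 
      using aw(1,2) by (intro bexI[of _ "a + w + 1"]) (auto intro: cut_closed)
  next
    assume "\<exists>b\<in>I. Q (case_nat b e)"
    then obtain b a w where "b \<in> I" "0 \<le> a" "a < b" "0 \<le> w" "w < b" "P (case_nat w (case_nat a e))"
      by (auto simp: Q_def)
    moreover from this have "a \<in> I" "w \<in> I" using initial[of b] by auto
    ultimately show "sat (induced nn I) e (Exists \<phi>)"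
      using sat[of "case_nat a e"] e by (auto simp: range_case_nat)
  qed
  ultimately show ?case by blast
qed

text \<open>Overspill: every element above the cut bounds all witnesses, and the least bound cannot lie
  above the cut because its predecessor would be a bound as well.\<close>

lemma cut_collection:
  assumes c: "0 \<le> c" "c \<notin> I" and \<phi>: "Sigma1 \<phi>" and e: "range e \<subseteq> I"
  shows "sat (induced nn I) e (collection_ax \<phi>)"
proof -
  obtain P where P: "dpred P" and
    sat: "\<And>e. range e \<subseteq> I \<Longrightarrow> sat (induced nn I) e \<phi> \<longleftrightarrow> (\<exists>w\<in>I. P (case_nat w e))"
    using Sigma1_bounded_witness[OF \<phi>] by blast
  have env: "(\<lambda>n. eval nn (case_nat y (case_nat x (case_nat z e)))
      (case_nat (Var 0) (case_nat (Var (Suc 0)) (\<lambda>n. Var (n + 3))) n)) = case_nat y (case_nat x e)" for x y z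
    by (auto simp: fun_eq_iff numeral_3_eq_3 split: nat.split)
  have e0: "e 0 \<in> I" using e by auto
  have "\<exists>z\<in>I. \<forall>x\<in>I. x < e 0 \<longrightarrow> (\<exists>y\<in>I. y < z \<and> sat (induced nn I) (case_nat y (case_nat x e)) \<phi>)"
    if hyp: "\<forall>x\<in>I. x < e 0 \<longrightarrow> (\<exists>y\<in>I. sat (induced nn I) (case_nat y (case_nat x e)) \<phi>)"
  proof -
    \<comment> \<open>Index 0 holds the candidate bound \<open>z\<close>, which limits both the
      witness \<open>y\<close> and the bound \<open>w\<close> for the quantifiers inside the
      formula; index 1 holds the bound on \<open>x\<close>.\<close>
    define Q where "Q e \<longleftrightarrow> (\<forall>x. 0 \<le> x \<and> x < e (Suc 0) \<longrightarrow> (\<exists>y. 0 \<le> y \<and> y < e 0 \<and> (\<exists>w. 0 \<le> w \<and> w < e 0 \<and>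
      P (case_nat w (case_nat y (case_nat x (\<lambda>n. e (Suc n))))))))" for e :: "nat \<Rightarrow> 'a"
    have "dterm (\<lambda>e. case_nat (e 0) (case_nat (e (Suc 0)) (case_nat (e (Suc (Suc 0)))
        (\<lambda>n. e (Suc (Suc (Suc (Suc n))))))) n :: 'a)" for n :: nat
      by (intro dintro)
    then have Q: "dpred Q" unfolding Q_def by (intro dintro dpred_reindex[OF P])
    have above: "Q (case_nat z e)" if z: "0 \<le> z" "z \<notin> I" for z
      unfolding Q_def
    proof (intro allI impI)
      fix x assume x: "0 \<le> x \<and> x < case_nat z e (Suc 0)"
      then have "x \<in> I" using initial[OF e0, of x] by simp
      then obtain y w where yw: "y \<in> I" "w \<in> I" "P (case_nat w (case_nat y (case_nat x e)))"
        using hyp x sat[of "case_nat _ (case_nat x e)"] e by (force simp: range_case_nat)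
      moreover have "y < z" "w < z" using initial[of y z] initial[of w z] yw z by (force simp: not_le[symmetric])+
      ultimately show "\<exists>y. 0 \<le> y \<and> y < case_nat z e 0 \<and> (\<exists>w. 0 \<le> w \<and> w < case_nat z e 0 \<and>
        P (case_nat w (case_nat y (case_nat x (\<lambda>n. case_nat z e (Suc n))))))"
        unfolding nat.case using cut_nonneg[of y] cut_nonneg[of w] by blast
    qed
    obtain z where z: "0 \<le> z" "z \<le> c" "Q (case_nat z e)"
      "\<And>z'. 0 \<le> z' \<Longrightarrow> z' < z \<Longrightarrow> \<not> Q (case_nat z' e)"
      by (rule dpred_least[OF Q cut_env[OF e] c(1) above[OF c]], rule that; blast)
    have "z \<in> I"
    proof (rule ccontr)
      assume nz: "z \<notin> I"
      then have "z \<noteq> 0" using cut_closed by auto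
      then have "0 \<le> z - 1" using nn_positive[of z] z(1) by simp
      moreover have "z - 1 \<notin> I" using nz cut_closed(3)[of "z - 1" 1] cut_closed(2) by auto
      ultimately show False using above[of "z - 1"] z(4)[of "z - 1"] by simp
    qed
    moreover have "\<exists>y\<in>I. y < z \<and> sat (induced nn I) (case_nat y (case_nat x e)) \<phi>"
      if x: "x \<in> I" "x < e 0" for x
    proof -
      obtain y w where yw: "0 \<le> y" "y < z" "0 \<le> w" "w < z" "P (case_nat w (case_nat y (case_nat x e)))"
        using z(3) x cut_nonneg[OF x(1)] by (auto simp: Q_def)
      then have "y \<in> I" "w \<in> I" using initial[OF \<open>z \<in> I\<close>] by auto
      then show ?thesis using yw sat[of "case_nat y (case_nat x e)"] e x by (auto simp: range_case_nat)
    qed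
    ultimately show ?thesis by blast
  qed
  then show ?thesis
    by (simp add: collection_ax_def BForall_def BExists_def sat_subst env)
qed

lemma cut_BSigma1: "0 \<le> c \<Longrightarrow> c \<notin> I \<Longrightarrow> models (induced nn I) BSigma1"
  using cut_collection by (auto simp: BSigma1_def models_def)

lemma cut_Exp:
  assumes "\<And>x. x \<in> I \<Longrightarrow> \<exists>y\<in>I. ex x y"
  shows "models (induced nn I) {Exp_ax}"
proof -
  have "sat (induced nn I) (case_nat y (case_nat x e)) (Exp_fm (Var 1) (Var 0)) \<longleftrightarrow> ex x y"
    if "range e \<subseteq> I" "x \<in> I" "y \<in> I" for e x y
    using that cut_absolute[OF Delta0_Exp_fm, of "case_nat y (case_nat x e)"] cut_nonneg cut_env
    by (simp add: range_case_nat sat_nn_Exp_fm)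
  then show ?thesis using assms by (simp add: models_def Exp_ax_def)
qed

end

section \<open>The embedding and its fixed points\<close>

lemma dpred_self_embedding:
  fixes j :: "'a::idelta0_ring \<Rightarrow> 'a"
  assumes j: "self_embedding nn j" and el: "Delta0_elementary (induced nn (j ` carr nn)) nn"
    and P: "dpred P" and e: "nonneg_env e"
  shows "P (\<lambda>n. j (e n)) \<longleftrightarrow> P e"
proof -
  obtain \<phi> where \<phi>: "Delta0 \<phi>" "\<And>e. nonneg_env e \<Longrightarrow> sat nn e \<phi> \<longleftrightarrow> P e"
    using P by (auto simp: dpred_def)
  have je: "range (\<lambda>n. j (e n)) \<subseteq> j ` carr nn" using e by auto
  have "nonneg_env (\<lambda>n. j (e n))"
    using j e by (auto simp: self_embedding_def subuniverse_def)
  then have "P (\<lambda>n. j (e n)) \<longleftrightarrow> sat nn (\<lambda>n. j (e n)) \<phi>" using \<phi> by simp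
  also have "\<dots> \<longleftrightarrow> sat (induced nn (j ` carr nn)) (\<lambda>n. j (e n)) \<phi>"
    using el \<phi>(1) je unfolding Delta0_elementary_def by (metis induced_simps(1))
  also have "\<dots> \<longleftrightarrow> sat nn e \<phi>"
    using j e by (intro sat_isomorphism is_structure_nn) (auto simp: self_embedding_def)
  finally show ?thesis using \<phi> e by simp
qed

lemma nn_I_fix:
  fixes j :: "'a::idelta0_ring \<Rightarrow> 'a"
  assumes j: "self_embedding nn j" and nt: "nontrivial nn j"
    and el: "Delta0_elementary (induced nn (j ` carr nn)) nn"
  shows "subuniverse nn (I_fix nn j) \<and>
    models (induced nn (I_fix nn j)) (IDelta0 \<union> BSigma1 \<union> {Exp_ax})"
proof -
  define I where "I = I_fix nn j"
  have I: "m \<in> I \<longleftrightarrow> 0 \<le> m \<and> (\<forall>x. 0 \<le> x \<and> x \<le> m \<longrightarrow> j x = x)" for m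
    by (auto simp: I_def I_fix_def)
  have j_hom: "j 0 = 0" "j 1 = 1" "\<And>x y. 0 \<le> x \<Longrightarrow> 0 \<le> y \<Longrightarrow> j (x + y) = j x + j y"
    "\<And>x y. 0 \<le> x \<Longrightarrow> 0 \<le> y \<Longrightarrow> j (x * y) = j x * j y"
    "\<And>x y. 0 \<le> x \<Longrightarrow> 0 \<le> y \<Longrightarrow> j x < j y \<longleftrightarrow> x < y"
    using j by (auto simp: self_embedding_def isomorphism_def)
  have j_nonneg: "0 \<le> j x" if "0 \<le> x" for x
    using j that by (auto simp: self_embedding_def subuniverse_def)
  have initial: "y \<in> I" if "x \<in> I" "0 \<le> y" "y \<le> x" for x y
    using that by (auto simp: I intro: order_trans)
  have fixed: "j x = x" if "x \<in> I" for x using that by (auto simp: I)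
  have add: "m + n \<in> I" if "m \<in> I" "n \<in> I" for m n
  proof -
    have *: "0 \<le> m" "0 \<le> n" using that by (auto simp: I)
    have "j x = x" if x: "0 \<le> x" "x \<le> m + n" for x
    proof (cases "x \<le> m")
      case True
      then show ?thesis using \<open>m \<in> I\<close> x by (auto simp: I)
    next
      case False
      then have "x - m \<in> I" using initial[OF \<open>n \<in> I\<close>, of "x - m"] x by (simp add: algebra_simps)
      then show ?thesis using j_hom(3)[of "x - m" m] fixed \<open>m \<in> I\<close> False * by simp
    qed
    then show ?thesis using * by (simp add: I)
  qed
  have mul: "m * n \<in> I" if "m \<in> I" "n \<in> I" for m n
  proof -
    have *: "0 \<le> m" "0 \<le> n" using that by (auto simp: I)
    have "j x = x" if x: "0 \<le> x" "x \<le> m * n" for x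
    proof (cases "n = 0")
      case True
      then show ?thesis using x j_hom by simp
    next
      case False
      then have "0 < n" using * by simp
      \<comment> \<open>The quotient of \<open>x\<close> by \<open>n\<close> is at most
        \<open>m\<close> and the remainder is below \<open>n\<close>, so both lie in the cut and are
        fixed; hence \<open>j\<close> fixes \<open>x\<close>.\<close>
      note q = quo_rmd[OF x(1) this]
      have "quo x n * n \<le> m * n" using q x by linarith
      then have "quo x n \<le> m" using \<open>0 < n\<close> by simp
      then have qI: "quo x n \<in> I" using initial[OF \<open>m \<in> I\<close>] q by simp
      have rI: "rmd x n \<in> I" using initial[OF \<open>n \<in> I\<close>] q by simp
      have "j x = j (quo x n * n + rmd x n)" using q(1) by simp
      also have "\<dots> = quo x n * n + rmd x n" using q(2,4) * qI rI \<open>n \<in> I\<close> by (simp add: j_hom fixed)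
      finally show ?thesis using q(1) by simp
    qed
    then show ?thesis using * by (simp add: I)
  qed
  have "0 \<in> I" using j_hom by (auto simp: I)
  have "1 \<in> I"
    unfolding I
  proof (intro conjI allI impI)
    fix x :: 'a assume x: "0 \<le> x \<and> x \<le> 1"
    then have "x < 2" by (auto intro: le_less_trans[of _ 1])
    then show "j x = x" using nn_less_cases[of x] x j_hom by auto
  qed simp
  have "I \<subseteq> carr nn" by (auto simp: I)
  then have "subuniverse nn I" using \<open>0 \<in> I\<close> \<open>1 \<in> I\<close> add mul by (simp add: subuniverse_def)
  then interpret nn_cut I using initial by unfold_locales
  have j_ex: "ex (j x) (j y) \<longleftrightarrow> ex x y" if "0 \<le> x" "0 \<le> y" for x y
    using dpred_self_embedding[OF j el, of "\<lambda>e. ex (e 0) (e 1)" "case_nat x (\<lambda>_. y)"] that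
    by (simp add: dintro)
  have j_bt: "bt (j x) (j y) \<longleftrightarrow> bt x y" if "0 \<le> x" "0 \<le> y" for x y
    using dpred_self_embedding[OF j el, of "\<lambda>e. bt (e 0) (e 1)" "case_nat x (\<lambda>_. y)"] that
    by (simp add: dintro)
  \<comment> \<open>The binary digits of \<open>z < 2^m\<close> sit at places \<open>2^i\<close> with \<open>i < m\<close>; these places are fixed by
    \<open>j\<close>, so \<open>z\<close> and \<open>j z\<close> have the same digits.\<close>
  have exp_in: "y \<in> I" if m: "m \<in> I" "ex m y" for m y
  proof -
    have y0: "0 < y" using pw_pos[OF ex_pw[OF m(2)]] .
    have place: "j v = v" if "pw v" "v \<le> y" for v
    proof -
      obtain i where i: "0 \<le> i" "i \<le> m" "ex i v" using pw_below_ex[OF m(2)] \<open>pw v\<close> \<open>v \<le> y\<close> by blast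
      have "j i = i" using fixed initial[OF m(1)] i by blast
      then have "ex i (j v)" using j_ex[of i v] i pw_pos[OF \<open>pw v\<close>] by simp
      then show ?thesis using ex_unique i by blast
    qed
    have jy: "j y = y" using place ex_pw[OF m(2)] by simp
    have "j z = z" if z: "0 \<le> z" "z \<le> y" for z
    proof (cases "z = y")
      case True
      then show ?thesis using jy by simp
    next
      case False
      then have "z < y" using z by simp
      moreover have "j z < y" using j_hom(5)[of z y] z y0 jy \<open>z < y\<close> by simp
      moreover have "bt v (j z) \<longleftrightarrow> bt v z" if "pw v" "v \<le> y" for v
        using j_bt[of v z] place that z pw_pos[OF \<open>pw v\<close>] by simp
      ultimately show ?thesis using bt_extensional[OF ex_pw[OF m(2)]] z j_nonneg by blast
    qed
    then show ?thesis using y0 by (simp add: I)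
  qed
  obtain c where c: "0 \<le> c" "j c \<noteq> c" using nt by (auto simp: nontrivial_def)
  then have "c \<notin> I" using fixed by blast
  then have below: "x < c" if "x \<in> I" for x using initial[OF that c(1)] by (simp add: not_le[symmetric]) blast
  have "\<exists>y\<in>I. ex m y" if m: "m \<in> I" for m
  proof -
    \<comment> \<open>The element \<open>c\<close> above the cut bounds the value and thereby makes
      the statement definable. Carrying \<open>m\<close> as a parameter keeps every \<open>x\<close>
      concerned inside the cut, where \<open>exp_in\<close> applies.\<close>
    have "m \<le> m \<longrightarrow> (\<exists>y. 0 \<le> y \<and> y < c \<and> ex m y)"
    proof (rule less_induct_dpred[where P="\<lambda>x c m. x \<le> m \<longrightarrow> (\<exists>y. 0 \<le> y \<and> y < c \<and> ex x y)"])
      fix x assume x: "0 \<le> x" and IH: "\<And>t. 0 \<le> t \<Longrightarrow> t < x \<Longrightarrow> t \<le> m \<longrightarrow> (\<exists>y. 0 \<le> y \<and> y < c \<and> ex t y)"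
      show "x \<le> m \<longrightarrow> (\<exists>y. 0 \<le> y \<and> y < c \<and> ex x y)"
      proof
        assume "x \<le> m"
        show "\<exists>y. 0 \<le> y \<and> y < c \<and> ex x y"
        proof (cases "x = 0")
          case True
          then show ?thesis using below[OF \<open>1 \<in> I\<close>] by (intro exI[of _ 1]) simp
        next
          case False
          then have x1: "0 \<le> x - 1" using x nn_positive[of x] by simp
          then obtain y where y: "0 \<le> y" "ex (x - 1) y" using IH[of "x - 1"] \<open>x \<le> m\<close> by auto
          have "x - 1 \<in> I" using initial[OF m x1] \<open>x \<le> m\<close> by (auto intro: order_trans[of _ x])
          then have "y \<in> I" using exp_in y by blast
          then have "2 * y < c" using below[OF add[of y y]] by (simp only: mult_2)
          then show ?thesis using ex_succ[OF y(2)] y by (intro exI[of _ "2 * y"]) simp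
        qed
      qed
    qed (use c m in \<open>auto simp: I intro!: dintro\<close>)
    then show ?thesis using exp_in m by blast
  qed
  then have "models (induced nn I) {Exp_ax}" by (rule cut_Exp)
  then have "models (induced nn I) (IDelta0 \<union> BSigma1 \<union> {Exp_ax})"
    using cut_IDelta0 cut_BSigma1[OF c(1) \<open>c \<notin> I\<close>] by (auto simp: models_def)
  then show ?thesis using closed by (simp add: I_def)
qed

section \<open>Invariance under isomorphism\<close>

lemma isomorphism_comp:
  "isomorphism f M N \<Longrightarrow> isomorphism g N K \<Longrightarrow> isomorphism (g \<circ> f) M K"
  unfolding isomorphism_def by (auto simp: bij_betw_trans bij_betwE)

lemma isomorphism_inv:
  assumes f: "isomorphism f M N" and M: "is_structure M"
  shows "isomorphism (inv_into (carr M) f) N M"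
proof -
  let ?g = "inv_into (carr M) f"
  have b: "bij_betw f (carr M) (carr N)" using f by (simp add: isomorphism_def)
  have gf: "?g (f x) = x" if "x \<in> carr M" for x using b that by (simp add: bij_betw_inv_into_left)
  have N: "carr N = f ` carr M" using b by (simp add: bij_betw_def)
  have cl: "zero M \<in> carr M" "one M \<in> carr M"
    "\<And>x y. x \<in> carr M \<Longrightarrow> y \<in> carr M \<Longrightarrow> add M x y \<in> carr M \<and> mul M x y \<in> carr M"
    using M by (auto simp: is_structure_def subuniverse_def)
  have f_hom: "zero N = f (zero M)" "one N = f (one M)"
    "\<And>x y. x \<in> carr M \<Longrightarrow> y \<in> carr M \<Longrightarrow> add N (f x) (f y) = f (add M x y) \<and>
      mul N (f x) (f y) = f (mul M x y) \<and> (less N (f x) (f y) \<longleftrightarrow> less M x y)"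
    using f by (auto simp: isomorphism_def)
  show ?thesis unfolding isomorphism_def
    using b by (auto simp: N f_hom gf cl bij_betw_inv_into[OF b, unfolded N])
qed

lemma isomorphism_induced:
  "isomorphism f M N \<Longrightarrow> A \<subseteq> carr M \<Longrightarrow> isomorphism f (induced M A) (induced N (f ` A))"
  unfolding isomorphism_def by (auto simp: bij_betw_def subset_iff intro: inj_on_subset)

lemma subuniverse_isomorphism:
  assumes f: "isomorphism f M N" and M: "is_structure M" and A: "A \<subseteq> carr M"
  shows "subuniverse N (f ` A) \<longleftrightarrow> subuniverse M A"
proof -
  have inj: "inj_on f (carr M)" and N: "carr N = f ` carr M"
    using f by (auto simp: isomorphism_def bij_betw_def)
  have cl: "zero M \<in> carr M" "one M \<in> carr M"
    "\<And>x y. x \<in> carr M \<Longrightarrow> y \<in> carr M \<Longrightarrow> add M x y \<in> carr M \<and> mul M x y \<in> carr M"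
    using M by (auto simp: is_structure_def subuniverse_def)
  have f_hom: "zero N = f (zero M)" "one N = f (one M)"
    "\<And>x y. x \<in> carr M \<Longrightarrow> y \<in> carr M \<Longrightarrow> add N (f x) (f y) = f (add M x y)"
    "\<And>x y. x \<in> carr M \<Longrightarrow> y \<in> carr M \<Longrightarrow> mul N (f x) (f y) = f (mul M x y)"
    using f by (auto simp: isomorphism_def)
  have mem: "f x \<in> f ` A \<longleftrightarrow> x \<in> A" if "x \<in> carr M" for x
    using inj_on_image_mem_iff[OF inj that A] .
  have "(\<forall>x\<in>f ` A. \<forall>y\<in>f ` A. add N x y \<in> f ` A \<and> mul N x y \<in> f ` A) \<longleftrightarrow>
      (\<forall>x\<in>A. \<forall>y\<in>A. add M x y \<in> A \<and> mul M x y \<in> A)"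
    using A by (simp add: f_hom mem cl subset_iff)
  then show ?thesis using A by (auto simp: subuniverse_def f_hom mem cl N)
qed

definition fixed_cut_property :: "'a arith_struct \<Rightarrow> bool" where
  "fixed_cut_property M \<longleftrightarrow> (\<forall>j. self_embedding M j \<longrightarrow> nontrivial M j \<longrightarrow>
     Delta0_elementary (induced M (j ` carr M)) M \<longrightarrow>
     subuniverse M (I_fix M j) \<and>
     models (induced M (I_fix M j)) (IDelta0 \<union> BSigma1 \<union> {Exp_ax}))"

text \<open>Conjugating \<open>j\<close> by \<open>f\<close> gives an embedding \<open>k\<close> of
  \<open>N\<close> with the same properties, whose fixed cut is the image under \<open>f\<close> of
  that of \<open>j\<close>.\<close>

lemma fixed_cut_property_isomorphism:
  assumes f: "isomorphism f M N" and M: "is_structure M" and N: "fixed_cut_property N"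
  shows "fixed_cut_property M"
  unfolding fixed_cut_property_def
proof (intro allI impI)
  fix j assume j: "self_embedding M j" and nt: "nontrivial M j"
    and el: "Delta0_elementary (induced M (j ` carr M)) M"
  define g where "g = inv_into (carr M) f"
  define k where "k = f \<circ> (j \<circ> g)"
  have inj: "inj_on f (carr M)" and cN: "carr N = f ` carr M"
    using f by (auto simp: isomorphism_def bij_betw_def)
  have gf: "g (f x) = x" if "x \<in> carr M" for x unfolding g_def using inj that by simp
  have kf: "k (f x) = f (j x)" if "x \<in> carr M" for x using gf that by (simp add: k_def)
  have jM: "j ` carr M \<subseteq> carr M" "subuniverse M (j ` carr M)"
    using j by (auto simp: self_embedding_def subuniverse_def)
  have kN: "k ` carr N = f ` (j ` carr M)" using kf by (auto simp: cN image_image)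
  have emb: "self_embedding N k"
    unfolding self_embedding_def
  proof
    show "subuniverse N (k ` carr N)" unfolding kN using subuniverse_isomorphism[OF f M] jM by blast
    have "isomorphism (j \<circ> g) N (induced M (j ` carr M))"
      using isomorphism_comp[OF isomorphism_inv[OF f M]] j by (auto simp: self_embedding_def g_def)
    from isomorphism_comp[OF this isomorphism_induced[OF f jM(1)]]
    show "isomorphism k N (induced N (k ` carr N))" by (simp add: k_def[symmetric] kN)
  qed
  have "nontrivial N k"
  proof -
    obtain m where m: "m \<in> carr M" "j m \<noteq> m" using nt by (auto simp: nontrivial_def)
    then have "k (f m) \<noteq> f m" using kf inj jM(1) by (auto simp: inj_on_eq_iff)
    then show ?thesis using m by (auto simp: nontrivial_def cN)
  qed
  moreover have "Delta0_elementary (induced N (k ` carr N)) N"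
    unfolding Delta0_elementary_def
  proof (intro conjI allI impI)
    show "carr (induced N (k ` carr N)) \<subseteq> carr N" 
      unfolding induced_simps kN using image_mono[OF jM(1)] by (simp add: cN)
    fix \<phi> and e :: "nat \<Rightarrow> 'b" assume \<phi>: "Delta0 \<phi>" and "range e \<subseteq> carr (induced N (k ` carr N))"
    then have "e n \<in> f ` (j ` carr M)" for n by (auto simp: kN)
    then have "\<exists>e'. \<forall>n. e' n \<in> j ` carr M \<and> e n = f (e' n)" by (intro choice) blast
    then obtain e' where e': "range e' \<subseteq> j ` carr M" "e = (\<lambda>n. f (e' n))" by auto
    have "is_structure (induced M (j ` carr M))" using jM by (simp add: is_structure_def subuniverse_def)
    then have "sat (induced N (k ` carr N)) e \<phi> \<longleftrightarrow> sat (induced M (j ` carr M)) e' \<phi>"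
      unfolding kN e'(2) using e'(1) by (intro sat_isomorphism isomorphism_induced[OF f jM(1)]) auto
    also have "\<dots> \<longleftrightarrow> sat M e' \<phi>" using el \<phi> e'(1) by (simp add: Delta0_elementary_def)
    also have "\<dots> \<longleftrightarrow> sat N e \<phi>"
      unfolding e'(2) using e'(1) jM(1) by (intro sat_isomorphism[OF f M, symmetric]) auto
    finally show "sat (induced N (k ` carr N)) e \<phi> \<longleftrightarrow> sat N e \<phi>" .
  qed
  ultimately have con: "subuniverse N (I_fix N k)"
    "models (induced N (I_fix N k)) (IDelta0 \<union> BSigma1 \<union> {Exp_ax})"
    using N emb unfolding fixed_cut_property_def by blast+
  have I: "I_fix M j \<subseteq> carr M" by (auto simp: I_fix_def)
  have "I_fix N k = f ` I_fix M j"
  proof -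
    have less: "less N (f x) (f y) \<longleftrightarrow> less M x y" if "x \<in> carr M" "y \<in> carr M" for x y
      using f that by (simp add: isomorphism_def)
    have "f m \<in> I_fix N k \<longleftrightarrow> m \<in> I_fix M j" if "m \<in> carr M" for m
      using that jM(1) inj by (auto simp: I_fix_def cN kf less inj_on_eq_iff image_subset_iff)
    then show ?thesis using I by (auto simp: I_fix_def cN)
  qed
  then have sub: "subuniverse M (I_fix M j)"
    using con(1) subuniverse_isomorphism[OF f M I] by simp
  moreover from this have "is_structure (induced M (I_fix M j))"
    by (simp add: is_structure_def subuniverse_def)
  ultimately show "subuniverse M (I_fix M j) \<and>
      models (induced M (I_fix M j)) (IDelta0 \<union> BSigma1 \<union> {Exp_ax})"
    using con(2) models_isomorphism[OF isomorphism_induced[OF f I]] \<open>I_fix N k = f ` I_fix M j\<close> by simp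
qed

section \<open>Models as non-negative parts of ordered rings\<close>

text \<open>Brings structures on \<open>'a\<close> and on \<open>nat\<close> into the common type
  \<open>'a + nat\<close>. The summand \<open>nat\<close> is there because \<open>'a\<close> may be
  finite and then carries no model at all.\<close>

definition image_struct :: "('a \<Rightarrow> 'b) \<Rightarrow> 'a arith_struct \<Rightarrow> 'b arith_struct" where
  "image_struct f M = \<lparr>carr = f ` carr M, zero = f (zero M), one = f (one M),
     add = (\<lambda>x y. f (add M (inv f x) (inv f y))), mul = (\<lambda>x y. f (mul M (inv f x) (inv f y))),
     less = (\<lambda>x y. less M (inv f x) (inv f y))\<rparr>"

lemma isomorphism_image_struct: "inj f \<Longrightarrow> isomorphism f M (image_struct f M)"
  by (auto simp: isomorphism_def image_struct_def bij_betw_def intro: inj_on_subset)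

lemma is_structure_isomorphism: "isomorphism f M N \<Longrightarrow> is_structure M \<Longrightarrow> is_structure N"
  using subuniverse_isomorphism[of f M N "carr M"]
  by (simp add: is_structure_def isomorphism_def bij_betw_def)

lemma nat_struct_IDelta0: "is_structure nat_struct" "models nat_struct IDelta0"
proof -
  show "is_structure nat_struct" by (simp add: is_structure_def subuniverse_def)
  have "sat nat_struct e (induction_ax \<phi>)" for e \<phi>
  proof -
    have "(\<lambda>n. eval nat_struct e (case_nat Zero Var n)) = case_nat 0 e"
      "(\<lambda>n. eval nat_struct (case_nat a e) (case_nat (Add (Var 0) One) (\<lambda>n. Var (Suc n)) n))
        = case_nat (Suc a) e" for a
      by (auto simp: fun_eq_iff split: nat.split)
    moreover have "sat nat_struct (case_nat a e) \<phi>"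
      if "sat nat_struct (case_nat 0 e) \<phi>"
        "\<And>a. sat nat_struct (case_nat a e) \<phi> \<Longrightarrow> sat nat_struct (case_nat (Suc a) e) \<phi>" for a
      using that by (induction a) auto
    ultimately show ?thesis unfolding induction_ax_def by (simp add: sat_subst)
  qed
  moreover have "sat nat_struct e \<phi>" if "\<phi> \<in> PA_minus" for e \<phi>
    using that le_Suc_ex[of "e 0" "e 1"] unfolding PA_minus_def Let_def
    by (elim insertE) (auto simp: algebra_simps less_imp_le)
  ultimately show "models nat_struct IDelta0" by (auto simp: models_def IDelta0_def)
qed

definition counterexample :: "'a arith_struct \<Rightarrow> bool" where
  "counterexample M \<longleftrightarrow> is_structure M \<and> models M IDelta0 \<and> \<not> fixed_cut_property M"

text \<open>A type cannot depend on a structure, so the theorem is reduced to one structure per type: a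
  counterexample if there is one, and the standard model otherwise.\<close>

definition the_model :: "('a + nat) arith_struct" where
  "the_model = (if \<exists>M::'a arith_struct. counterexample M
     then image_struct Inl (SOME M::'a arith_struct. counterexample M)
     else image_struct Inr nat_struct)"

lemma the_model:
  "is_structure (the_model :: ('a + nat) arith_struct)" "models (the_model :: ('a + nat) arith_struct) IDelta0"
proof -
  have "is_structure (the_model :: ('a + nat) arith_struct) \<and> models (the_model :: ('a + nat) arith_struct) IDelta0"
  proof (cases "\<exists>M::'a arith_struct. counterexample M")
    case True
    define M :: "'a arith_struct" where "M = (SOME M. counterexample M)"
    have M: "is_structure M" "models M IDelta0"
      using someI_ex[OF True] by (auto simp: M_def counterexample_def)
    have iso: "isomorphism Inl M (the_model :: ('a + nat) arith_struct)"
      using True by (simp add: the_model_def M_def isomorphism_image_struct)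
    show ?thesis using is_structure_isomorphism[OF iso M(1)] models_isomorphism[OF iso M(1)] M by simp
  next
    case False
    then have iso: "isomorphism Inr nat_struct (the_model :: ('a + nat) arith_struct)"
      by (simp add: the_model_def isomorphism_image_struct)
    show ?thesis
      using is_structure_isomorphism[OF iso] models_isomorphism[OF iso] nat_struct_IDelta0 by simp
  qed
  then show "is_structure (the_model :: ('a + nat) arith_struct)"
    "models (the_model :: ('a + nat) arith_struct) IDelta0" by auto
qed

lemma PA_minus_facts:
  assumes "models M PA_minus" "x \<in> carr M" "y \<in> carr M" "z \<in> carr M"
  shows "add M (add M x y) z = add M x (add M y z)" "add M x y = add M y x"
    "mul M (mul M x y) z = mul M x (mul M y z)" "mul M x y = mul M y x"
    "mul M x (add M y z) = add M (mul M x y) (mul M x z)" "add M x (zero M) = x"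
    "mul M x (zero M) = zero M" "mul M x (one M) = x" "less M x y \<Longrightarrow> less M y z \<Longrightarrow> less M x z"
    "\<not> less M x x" "less M x y \<or> x = y \<or> less M y x" "less M x y \<Longrightarrow> less M (add M x z) (add M y z)"
    "less M (zero M) z \<Longrightarrow> less M x y \<Longrightarrow> less M (mul M x z) (mul M y z)"
    "less M x y \<Longrightarrow> \<exists>w\<in>carr M. add M x w = y" "less M (zero M) (one M)"
    "x = zero M \<or> less M (zero M) x"
proof -
  let ?e = "case_nat x (case_nat y (\<lambda>_. z))"
  have "range ?e \<subseteq> carr M" using assms by (auto split: nat.split)
  then have sat: "sat M ?e \<phi>" if "\<phi> \<in> PA_minus" for \<phi>
    using assms(1) that unfolding models_def by blast
  have "\<forall>\<phi>\<in>PA_minus. sat M ?e \<phi>" using sat by blast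
  note facts = this[unfolded PA_minus_def Let_def, simplified, unfolded numeral_2_eq_2, simplified]
  show "add M (add M x y) z = add M x (add M y z)" "add M x y = add M y x"
    "mul M (mul M x y) z = mul M x (mul M y z)" "mul M x y = mul M y x"
    "mul M x (add M y z) = add M (mul M x y) (mul M x z)" "add M x (zero M) = x"
    "mul M x (zero M) = zero M" "mul M x (one M) = x" "less M x y \<Longrightarrow> less M y z \<Longrightarrow> less M x z"
    "\<not> less M x x" "less M x y \<or> x = y \<or> less M y x" "less M x y \<Longrightarrow> less M (add M x z) (add M y z)"
    "less M (zero M) z \<Longrightarrow> less M x y \<Longrightarrow> less M (mul M x z) (mul M y z)"
    "less M x y \<Longrightarrow> \<exists>w\<in>carr M. add M x w = y" "less M (zero M) (one M)"
    "x = zero M \<or> less M (zero M) x"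
    using facts by - (elim conjE, assumption | simp)+
qed

section \<open>The chosen model as an ordered semiring\<close>

typedef 'a model = "carr (the_model :: ('a + nat) arith_struct)"
  using the_model(1) by (auto simp: is_structure_def subuniverse_def)

setup_lifting type_definition_model

lemma the_model_closed:
  "zero the_model \<in> carr the_model" "one the_model \<in> carr the_model"
  "x \<in> carr the_model \<Longrightarrow> y \<in> carr the_model \<Longrightarrow> add the_model x y \<in> carr the_model"
  "x \<in> carr the_model \<Longrightarrow> y \<in> carr the_model \<Longrightarrow> mul the_model x y \<in> carr the_model"
  using the_model(1) by (auto simp: is_structure_def subuniverse_def)

lemma models_the_model: "models the_model PA_minus"
  using the_model(2) by (auto simp: IDelta0_def models_def)

instantiation model :: (type) "{comm_semiring_1, linorder}"
begin

lift_definition zero_model :: "'a model" is "zero the_model" by (rule the_model_closed)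
lift_definition one_model :: "'a model" is "one the_model" by (rule the_model_closed)
lift_definition plus_model :: "'a model \<Rightarrow> 'a model \<Rightarrow> 'a model" is "add the_model" by (rule the_model_closed)
lift_definition times_model :: "'a model \<Rightarrow> 'a model \<Rightarrow> 'a model" is "mul the_model" by (rule the_model_closed)
lift_definition less_model :: "'a model \<Rightarrow> 'a model \<Rightarrow> bool" is "less the_model" .
definition less_eq_model :: "'a model \<Rightarrow> 'a model \<Rightarrow> bool" where "less_eq_model x y \<longleftrightarrow> x < y \<or> x = y"

instance
proof
  fix a b c :: "'a model"
  note F = PA_minus_facts[OF models_the_model]
  show "a + b + c = a + (b + c)" by transfer (rule F(1))
  show ab: "a + b = b + a" for a b :: "'a model" by transfer (rule F(2))
  show "a * b * c = a * (b * c)" by transfer (rule F(3))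
  show ba: "a * b = b * a" for a b :: "'a model" by transfer (rule F(4))
  have "a + 0 = a" for a :: "'a model" by transfer (rule F(6))
  then show "0 + a = a" using ab[of 0 a] by simp
  have "a * 1 = a" for a :: "'a model" by transfer (rule F(8))
  then show "1 * a = a" using ba[of 1 a] by simp
  have "a * (b + c) = a * b + a * c" for a b c :: "'a model" by transfer (rule F(5))
  then show "(a + b) * c = a * c + b * c" using ba by simp
  show "a * 0 = 0" by transfer (rule F(7))
  then show "0 * a = 0" using ba[of a 0] by simp
  have irr: "\<not> a < a" for a :: "'a model" by transfer (rule F(10))
  have tr: "a < b \<Longrightarrow> b < c \<Longrightarrow> a < c" for a b c :: "'a model" by transfer (rule F(9))
  have "(0::'a model) < 1" by transfer (rule F(15)[OF the_model_closed(1) the_model_closed(1) the_model_closed(1)])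
  then show "(0::'a model) \<noteq> 1" using irr by metis
  show "a \<le> a" by (simp add: less_eq_model_def)
  show "a < b \<longleftrightarrow> a \<le> b \<and> \<not> b \<le> a" using irr[of a] tr[of a b a] by (auto simp: less_eq_model_def)
  show "a \<le> b \<Longrightarrow> b \<le> c \<Longrightarrow> a \<le> c" using tr unfolding less_eq_model_def by blast
  show "a \<le> b \<Longrightarrow> b \<le> a \<Longrightarrow> a = b"
    using irr[of a] tr[of a b a] by (auto simp: less_eq_model_def)
  have "a < b \<or> a = b \<or> b < a" by transfer (rule F(11))
  then show "a \<le> b \<or> b \<le> a" by (auto simp: less_eq_model_def)
qed

end

lemma model_order:
  fixes x y z :: "'a model"
  shows "x < y \<Longrightarrow> x + z < y + z" "0 < z \<Longrightarrow> x < y \<Longrightarrow> x * z < y * z" "x < y \<Longrightarrow> \<exists>w. x + w = y" "0 \<le> x"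
    "(0::'a model) < 1"
proof -
  note F = PA_minus_facts[OF models_the_model]
  show "x < y \<Longrightarrow> x + z < y + z" by transfer (rule F(12))
  show "0 < z \<Longrightarrow> x < y \<Longrightarrow> x * z < y * z" by transfer (rule F(13))
  show "x < y \<Longrightarrow> \<exists>w. x + w = y" by transfer (simp add: F(14))
  have "x = 0 \<or> 0 < x" by transfer (rule F(16))
  then show "0 \<le> x" by auto
  show "(0::'a model) < 1" by transfer (rule F(15)[OF the_model_closed(1) the_model_closed(1) the_model_closed(1)])
qed

text \<open>\<open>PA_minus\<close> has no cancellation axiom; cancellation follows from strict
  monotonicity of addition and linearity of the order.\<close>

lemma model_cancel:
  fixes x y z :: "'a model"
  shows "x + z = y + z \<longleftrightarrow> x = y" "x + z < y + z \<longleftrightarrow> x < y" "x + z \<le> y + z \<longleftrightarrow> x \<le> y"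
proof -
  show 1: "x + z = y + z \<longleftrightarrow> x = y"
    using model_order(1)[of x y z] model_order(1)[of y x z] by (cases x y rule: linorder_cases) auto
  show 2: "x + z < y + z \<longleftrightarrow> x < y"
    using model_order(1)[of x y z] model_order(1)[of y x z] by (cases x y rule: linorder_cases) auto
  show "x + z \<le> y + z \<longleftrightarrow> x \<le> y" using 1 2 by (simp add: le_less)
qed

section \<open>The ring of differences, where \<open>(a, b)\<close> stands for
  \<open>a - b\<close>\<close>

definition diff_rel :: "'a model \<times> 'a model \<Rightarrow> 'a model \<times> 'a model \<Rightarrow> bool" where
  "diff_rel = (\<lambda>(a, b) (c, d). a + d = c + b)"

lifting_forget model.lifting

quotient_type 'a diff_ring = "'a model \<times> 'a model" / diff_rel
  morphisms diff_ring_rep diff_ring_class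
proof (rule equivpI)
  show "reflp diff_rel" by (auto simp: reflp_def diff_rel_def)
  show "symp diff_rel" by (auto simp: symp_def diff_rel_def)
  show "transp diff_rel"
    unfolding diff_rel_def
  proof (rule transpI, clarsimp)
    fix a b c d e f :: "_ model" assume 1: "a + d = c + b" and 2: "c + f = e + d"
    have "a + f + d = (a + d) + f" by (simp add: add_ac)
    also have "\<dots> = c + f + b" by (simp add: 1 add_ac)
    also have "\<dots> = e + b + d" by (simp add: 2 add_ac)
    finally show "a + f = e + b" by (simp add: model_cancel)
  qed
qed

instantiation diff_ring :: (type) comm_ring_1
begin

lift_definition zero_diff_ring :: "'a diff_ring" is "(0, 0)" .
lift_definition one_diff_ring :: "'a diff_ring" is "(1, 0)" .

lift_definition plus_diff_ring :: "'a diff_ring \<Rightarrow> 'a diff_ring \<Rightarrow> 'a diff_ring"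
  is "\<lambda>(a, b) (c, d). (a + c, b + d)"
proof (clarsimp simp: diff_rel_def)
  fix a b c d a' b' c' d' :: "'a model" assume 1: "a + b' = a' + b" "c + d' = c' + d"
  have "a + c + (b' + d') = (a + b') + (c + d')" by (simp add: add_ac)
  then show "a + c + (b' + d') = a' + c' + (b + d)" by (simp add: 1 add_ac)
qed

lift_definition uminus_diff_ring :: "'a diff_ring \<Rightarrow> 'a diff_ring" is "\<lambda>(a, b). (b, a)"
  by (clarsimp simp: diff_rel_def add_ac)

definition minus_diff_ring :: "'a diff_ring \<Rightarrow> 'a diff_ring \<Rightarrow> 'a diff_ring" where
  "minus_diff_ring x y = x + - y"

lift_definition times_diff_ring :: "'a diff_ring \<Rightarrow> 'a diff_ring \<Rightarrow> 'a diff_ring"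
  is "\<lambda>(a, b) (c, d). (a * c + b * d, a * d + b * c)"
proof (clarsimp simp: diff_rel_def)
  fix a b c d a' b' c' d' :: "'a model" assume 1: "a + b' = a' + b" "c + d' = c' + d"
  \<comment> \<open>The mixed terms \<open>a' * d + b' * c\<close> are added on both sides so that
    the two equations can be applied inside products; they are cancelled at the end.\<close>
  have "a * c + b * d + (a' * d' + b' * c') + (a' * d + b' * c)
      = (a + b') * c + (a' + b) * d + a' * d' + b' * c'" by (simp add: algebra_simps)
  also have "\<dots> = (a' + b) * c + (a + b') * d + a' * d' + b' * c'" by (simp add: 1)
  also have "\<dots> = a * d + b * c + a' * (c + d') + b' * (c' + d)" by (simp add: algebra_simps)
  also have "\<dots> = a * d + b * c + a' * (c' + d) + b' * (c + d')" by (simp add: 1)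
  also have "\<dots> = a' * c' + b' * d' + (a * d + b * c) + (a' * d + b' * c)"
    by (simp add: algebra_simps)
  finally show "a * c + b * d + (a' * d' + b' * c') = a' * c' + b' * d' + (a * d + b * c)"
    by (simp add: model_cancel)
qed

instance
proof
  fix x y z :: "'a diff_ring"
  show "x + y + z = x + (y + z)" by transfer (clarsimp simp: diff_rel_def add_ac)
  show "x + y = y + x" by transfer (clarsimp simp: diff_rel_def add_ac)
  show "0 + x = x" by transfer (clarsimp simp: diff_rel_def)
  show "- x + x = 0" by transfer (clarsimp simp: diff_rel_def add_ac)
  show "x - y = x + - y" by (simp add: minus_diff_ring_def)
  show "x * y * z = x * (y * z)" by transfer (clarsimp simp: diff_rel_def algebra_simps)
  show "x * y = y * x" by transfer (clarsimp simp: diff_rel_def algebra_simps)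
  show "1 * x = x" by transfer (clarsimp simp: diff_rel_def)
  show "(x + y) * z = x * z + y * z" by transfer (clarsimp simp: diff_rel_def algebra_simps)
  show "(0::'a diff_ring) \<noteq> 1" by transfer (simp add: diff_rel_def)
qed

end

instantiation diff_ring :: (type) linorder
begin

lift_definition less_diff_ring :: "'a diff_ring \<Rightarrow> 'a diff_ring \<Rightarrow> bool"
  is "\<lambda>(a, b) (c, d). a + d < c + b"
proof (clarsimp simp: diff_rel_def)
  fix a b c d a' b' c' d' :: "'a model" assume 1: "a + b' = a' + b" "c + d' = c' + d"
  have "a + d < c + b \<longleftrightarrow> a + d + (b' + d') < c + b + (b' + d')" by (simp add: model_cancel)
  also have "a + d + (b' + d') = a + b' + d + d'" by (simp add: add_ac)
  also have "\<dots> = a' + d' + (b + d)" by (simp add: 1 add_ac)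
  also have "c + b + (b' + d') = c + d' + b + b'" by (simp add: add_ac)
  also have "\<dots> = c' + b' + (b + d)" by (simp add: 1 add_ac)
  finally show "a + d < c + b \<longleftrightarrow> a' + d' < c' + b'" by (simp add: model_cancel)
qed

definition less_eq_diff_ring :: "'a diff_ring \<Rightarrow> 'a diff_ring \<Rightarrow> bool" where
  "less_eq_diff_ring x y \<longleftrightarrow> x < y \<or> x = y"

instance
proof
  fix x y z :: "'a diff_ring"
  have irr: "\<not> x < x" for x :: "'a diff_ring" by transfer clarsimp
  have tr: "x < y \<Longrightarrow> y < z \<Longrightarrow> x < z" for x y z :: "'a diff_ring"
  proof (transfer, clarsimp)
    fix a b c d e f :: "'a model" assume 1: "a + d < c + b" "c + f < e + d"
    have "a + d + f < c + b + f" using 1 by (simp add: model_cancel)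
    also have "\<dots> = c + f + b" by (simp add: add_ac)
    also have "\<dots> < e + d + b" using 1 by (simp add: model_cancel)
    finally have "a + f + d < e + b + d" by (simp add: add_ac)
    then show "a + f < e + b" by (simp add: model_cancel)
  qed
  show "x \<le> x" by (simp add: less_eq_diff_ring_def)
  show "x < y \<longleftrightarrow> x \<le> y \<and> \<not> y \<le> x"
    using irr[of x] tr[of x y x] by (auto simp: less_eq_diff_ring_def)
  show "x \<le> y \<Longrightarrow> y \<le> z \<Longrightarrow> x \<le> z" using tr unfolding less_eq_diff_ring_def by blast
  show "x \<le> y \<Longrightarrow> y \<le> x \<Longrightarrow> x = y"
    using irr[of x] tr[of x y x] by (auto simp: less_eq_diff_ring_def)
  have "x < y \<or> x = y \<or> y < x" by transfer (simp add: diff_rel_def split_beta linorder_less_linear)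
  then show "x \<le> y \<or> y \<le> x" by (auto simp: less_eq_diff_ring_def)
qed

end

instantiation diff_ring :: (type) linordered_idom
begin

definition abs_diff_ring :: "'a diff_ring \<Rightarrow> 'a diff_ring" where "abs_diff_ring x = (if x < 0 then - x else x)"
definition sgn_diff_ring :: "'a diff_ring \<Rightarrow> 'a diff_ring" where
  "sgn_diff_ring x = (if x = 0 then 0 else if 0 < x then 1 else - 1)"

instance
proof
  fix x y z :: "'a diff_ring"
  have "x < y \<Longrightarrow> z + x < z + y"
  proof (transfer, clarsimp)
    fix a b c d e f :: "'a model" assume "a + d < c + b"
    then have "a + d + (e + f) < c + b + (e + f)" by (simp add: model_cancel)
    then show "e + a + (f + d) < e + c + (f + b)" by (simp add: add_ac)
  qed
  then show "x \<le> y \<Longrightarrow> z + x \<le> z + y" by (auto simp: less_eq_diff_ring_def)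
  show "x < y \<Longrightarrow> 0 < z \<Longrightarrow> z * x < z * y"
  proof (transfer, clarsimp)
    fix a b c d e f :: "'a model" assume 1: "a + d < c + b" and "f < e"
    then obtain w where w: "e = f + w" using model_order(3) by blast
    then have "0 < w" using \<open>f < e\<close> model_cancel(2)[of 0 f w] by (simp add: add.commute)
    then have "(a + d) * w < (c + b) * w" using 1 model_order(2) by blast
    \<comment> \<open>Substituting \<open>e = f + w\<close> in the goal makes these products with
      \<open>f\<close> occur on both sides; what remains is the inequality multiplied by
      \<open>w\<close>.\<close>
    then have "(a + d) * w + (f * a + f * b + f * c + f * d) < (c + b) * w + (f * a + f * b + f * c + f * d)"
      by (simp add: model_cancel)
    then show "e * a + f * b + (e * d + f * c) < e * c + f * d + (e * b + f * a)"
      unfolding w by (simp add: algebra_simps)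
  qed
  show "\<bar>x\<bar> = (if x < 0 then - x else x)" by (simp add: abs_diff_ring_def)
  show "sgn x = (if x = 0 then 0 else if 0 < x then 1 else - 1)" by (simp add: sgn_diff_ring_def)
qed

end

lift_definition of_model :: "'a model \<Rightarrow> 'a diff_ring" is "\<lambda>a. (a, 0)" .

text \<open>Every non-negative difference comes from the model by the subtraction axiom of
  \<open>PA_minus\<close>: if \<open>b < a\<close> then \<open>a = b + w\<close>, and
  \<open>(a, b)\<close> is equivalent to \<open>(w, 0)\<close>.\<close>

lemma isomorphism_diff_ring: "isomorphism (of_model \<circ> Abs_model) the_model (nn :: 'a diff_ring arith_struct)"
proof -
  define A :: "'a + nat \<Rightarrow> 'a model" where "A = Abs_model"
  have inj: "of_model a = of_model b \<longleftrightarrow> a = b" for a b :: "'a model"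
    by transfer (simp add: diff_rel_def)
  have less: "of_model a < of_model b \<longleftrightarrow> a < b" for a b :: "'a model" by transfer simp
  have hom: "of_model 0 = (0 :: 'a diff_ring)" "of_model 1 = (1 :: 'a diff_ring)"
    "of_model (a + b) = of_model a + of_model b" "of_model (a * b) = of_model a * of_model b"
    for a b :: "'a model"
    by (transfer; simp add: diff_rel_def)+
  have surj: "\<exists>a. x = of_model a" if "0 \<le> x" for x :: "'a diff_ring"
  proof -
    have "0 < x \<longrightarrow> (\<exists>a. x = of_model a)"
      by transfer (auto simp: diff_rel_def add.commute dest!: model_order(3))
    then show ?thesis using that hom(1) by (metis order_le_less)
  qed
  have nonneg: "0 \<le> of_model a" for a :: "'a model"
    using model_order(4)[of a] less[of 0 a] hom(1) by (metis order_le_less)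
  have A: "A (zero the_model) = 0" "A (one the_model) = 1"
    "\<And>x y. x \<in> carr the_model \<Longrightarrow> y \<in> carr the_model \<Longrightarrow> A (add the_model x y) = A x + A y"
    "\<And>x y. x \<in> carr the_model \<Longrightarrow> y \<in> carr the_model \<Longrightarrow> A (mul the_model x y) = A x * A y"
    "\<And>x y. x \<in> carr the_model \<Longrightarrow> y \<in> carr the_model \<Longrightarrow> less the_model x y \<longleftrightarrow> A x < A y"
    by (simp_all add: A_def zero_model_def one_model_def plus_model_def times_model_def less_model_def
        Abs_model_inverse)
  have "inj_on A (carr the_model)" unfolding A_def by (auto simp: inj_on_def Abs_model_inject)
  moreover have "A ` carr the_model = UNIV" unfolding A_def by (metis Abs_model_cases UNIV_eq_I imageI)
  moreover have "range (of_model :: 'a model \<Rightarrow> _) = {x. 0 \<le> x}" using surj nonneg by blast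
  ultimately have "bij_betw (of_model \<circ> A) (carr the_model) {x :: 'a diff_ring. 0 \<le> x}"
    by (intro bij_betw_trans[of _ _ UNIV]) (auto simp: bij_betw_def inj_def inj)
  then show ?thesis unfolding isomorphism_def A_def[symmetric] by (simp add: A hom less)
qed

instance diff_ring :: (type) idelta0_ring
proof
  show "models \<lparr>carr = {x :: 'a diff_ring. 0 \<le> x}, zero = 0, one = 1, add = (+), mul = (*), less = (<)\<rparr> IDelta0"
    using models_isomorphism[OF isomorphism_diff_ring[where 'a='a] the_model(1)] the_model(2)[where 'a='a] by (simp add: nn_def)
qed

theorem theorem3p2:
  fixes M :: "'a arith_struct" and j :: "'a \<Rightarrow> 'a"
  assumes "is_structure M"
    and "models M IDelta0"
    and "self_embedding M j"
    and "nontrivial M j"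
    and "Delta0_elementary (induced M (j ` carr M)) M"
  shows "subuniverse M (I_fix M j) \<and>
    models (induced M (I_fix M j)) (IDelta0 \<union> BSigma1 \<union> {Exp_ax})"
proof -
  \<comment> \<open>The type \<open>'a diff_ring\<close> depends on \<open>'a\<close> alone, but
    since \<open>the_model\<close> prefers a counterexample, proving the property for this one ring
    excludes counterexamples on \<open>'a\<close> altogether.\<close>
  have "\<not> (\<exists>M::'a arith_struct. counterexample M)"
  proof
    assume ce: "\<exists>M::'a arith_struct. counterexample M"
    define K :: "'a arith_struct" where "K = (SOME M. counterexample M)"
    have K: "counterexample K" using someI_ex[OF ce] by (simp add: K_def)
    have "isomorphism Inl K (the_model :: ('a + nat) arith_struct)"
      using ce by (simp add: the_model_def K_def isomorphism_image_struct)
    then have "isomorphism ((of_model \<circ> Abs_model) \<circ> Inl) K (nn :: 'a diff_ring arith_struct)"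
      using isomorphism_diff_ring by (rule isomorphism_comp)
    moreover have "fixed_cut_property (nn :: 'a diff_ring arith_struct)"
      using nn_I_fix unfolding fixed_cut_property_def by blast
    ultimately have "fixed_cut_property K"
      using K fixed_cut_property_isomorphism unfolding counterexample_def by blast
    then show False using K by (simp add: counterexample_def)
  qed
  then have "fixed_cut_property M" using assms(1,2) by (auto simp: counterexample_def)
  then show ?thesis using assms(3-5) unfolding fixed_cut_property_def by blast
qed

end
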